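(* Let $k$ be a field, $R=k[x_1,\dots,x_n]$, $d\ge1$, let $k_1<\dots<k_r$ be elements of $\{1,\dots,n\}$, and suppose $\deg\operatorname{lcm}(x_{k_s}^d,x_{k_t}^d)\ge d+2$ for all $s\ne t$. Let $K'$ be the equigenerated monomial ideal with complementary ideal $\overline{K'}=(x_{k_1}^d,\dots,x_{k_r}^d)$, i.e. $K'$ is generated by all monomials of degree $d$ other than $x_{k_1}^d,\dots,x_{k_r}^d$. Then $R/K'$ has Betti table $$\begin{array}{c|cccccc} & 0 & 1 & \cdots & \ell & \cdots & n\\ \hline 0 & 1 & \cdot & \cdots & \cdot & \cdots & \cdot\\ \vdots & \cdot & \cdot & \cdots & \cdot & \cdots & \cdot\\ d-1 & \cdot & \binom{n+d-1}{d}-r & \cdots & \binom{n+d-1}{\ell+d-1}\binom{d+\ell-2}{\ell-1}-r\binom{n-1}{\ell-1} & \cdots & \binom{n+d-2}{n-1}-r \end{array}$$ In particular, $R/K'$ has projective dimension $n$ with linear resolution and defines a ring of type $\binom{n+d-2}{n-1}-r$.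
   Context: Betti table convention: the entry in row $j$ and column $i$ is $\dim_k\operatorname{Tor}_i^R(R/K',k)_{i+j}$; dots and rows not shown are zero. The type of $R/K'$ is $\dim_k\operatorname{Tor}_p^R(R/K',k)$ with $p$ the projective dimension of $R/K'$.
   Formalization: The projective dimension and type claims are asserted only when r ≠ C(n+d-2,n-1), i.e. the last table entry is nonzero; otherwise they fail: for n=d=r=2, K'=(x1x2) and R/K' has projective dimension 1 and type 1, not 2 and 0. *)

theory Defs
  imports Main "HOL-Library.Poly_Mapping" "HOL-Library.Extended_Nat" "HOL-Library.Cardinality"
begin

section \<open>Polynomials and monomial ideals\<close>

text \<open>
  The polynomial ring over \<open>'k\<close> with one variable for each element of \<open>'n\<close>, as the monoid algebra
  of the exponent vectors. Its ring structure is that of \<^theory>\<open>HOL-Library.Poly_Mapping\<close>.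
\<close>

type_synonym ('n, 'k) mpoly = "('n \<Rightarrow>\<^sub>0 nat) \<Rightarrow>\<^sub>0 'k"

definition mdeg :: "('n \<Rightarrow>\<^sub>0 nat) \<Rightarrow> nat" where
  "mdeg t = (\<Sum>v\<in>Poly_Mapping.keys t. Poly_Mapping.lookup t v)"

lift_definition mlcm :: "('n \<Rightarrow>\<^sub>0 nat) \<Rightarrow> ('n \<Rightarrow>\<^sub>0 nat) \<Rightarrow> ('n \<Rightarrow>\<^sub>0 nat)"
  is "\<lambda>s t v. max (s v) (t v)"
proof -
  fix s t :: "'n \<Rightarrow> nat"
  assume "finite {v. s v \<noteq> 0}" "finite {v. t v \<noteq> 0}"
  then show "finite {v. max (s v) (t v) \<noteq> 0}"
    by (rule rev_finite_subset[OF finite_UnI]) (auto simp: max_def)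
qed

text \<open>The ideal generated by the monomials with exponent vectors in \<open>G\<close>.\<close>

definition monomial_ideal :: "('n \<Rightarrow>\<^sub>0 nat) set \<Rightarrow> ('n, 'k::field) mpoly set" where
  "monomial_ideal G = module.span (*) ((\<lambda>t. Poly_Mapping.single t 1) ` G)"

text \<open>
  The monomial ideal equigenerated in degree \<open>d\<close> whose complementary ideal is generated by the
  monomials in \<open>A\<close> (a set of exponent vectors of degree \<open>d\<close>).
\<close>

definition ideal_with_complement :: "nat \<Rightarrow> ('n \<Rightarrow>\<^sub>0 nat) set \<Rightarrow> ('n, 'k::field) mpoly set" where
  "ideal_with_complement d A = monomial_ideal ({t. mdeg t = d} - A)"

section \<open>Free modules\<close>

text \<open>
  Every free module used below is a submodule of the free module with basis \<open>nat\<close>, namely the span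
  of the basis vectors with index in some set \<open>B\<close>.
\<close>

definition fscale :: "'a::comm_ring_1 \<Rightarrow> ('b \<Rightarrow>\<^sub>0 'a) \<Rightarrow> ('b \<Rightarrow>\<^sub>0 'a)" where
  "fscale c v = Poly_Mapping.map ((*) c) v"

lemma lookup_fscale: "Poly_Mapping.lookup (fscale c v) b = c * Poly_Mapping.lookup v b"
  unfolding fscale_def by (simp add: Poly_Mapping.map.rep_eq when_def)

lemma module_fscale: "module (fscale :: 'a::comm_ring_1 \<Rightarrow> ('b \<Rightarrow>\<^sub>0 'a) \<Rightarrow> ('b \<Rightarrow>\<^sub>0 'a))"
  by unfold_locales
    (auto intro!: poly_mapping_eqI simp: lookup_fscale lookup_add algebra_simps)

lemma vector_space_fscale: "vector_space (fscale :: 'a::field \<Rightarrow> ('b \<Rightarrow>\<^sub>0 'a) \<Rightarrow> ('b \<Rightarrow>\<^sub>0 'a))"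
  by unfold_locales
    (auto intro!: poly_mapping_eqI simp: lookup_fscale lookup_add algebra_simps)

lemma module_mult: "module ((*) :: 'a::comm_ring_1 \<Rightarrow> 'a \<Rightarrow> 'a)"
  by unfold_locales (auto simp: algebra_simps)

definition free_on :: "nat set \<Rightarrow> (nat \<Rightarrow>\<^sub>0 'a::zero) set" where
  "free_on B = {v. Poly_Mapping.keys v \<subseteq> B}"

section \<open>Resolutions of a cyclic module\<close>

text \<open>
  The sequence \<open>\<dots> \<rightarrow> P 2 \<rightarrow> P 1 \<rightarrow> P 0 \<rightarrow> R/I \<rightarrow> 0\<close> is exact, where \<open>bd (Suc i)\<close> maps
  \<open>P (Suc i)\<close> to \<open>P i\<close> (\<open>bd 0\<close> is not used). The augmentation \<open>P 0 \<rightarrow> R/I\<close> is given by a lift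
  \<open>aug\<close> to \<open>R\<close>, which exists because \<open>P 0\<close> is projective. The \<open>P i\<close> are direct summands of the
  ambient free module, so every linear map on \<open>P i\<close> is the restriction of one on the ambient module.
\<close>

definition exact_resolution ::
  "'a::comm_ring_1 set \<Rightarrow> (nat \<Rightarrow> (nat \<Rightarrow>\<^sub>0 'a) set) \<Rightarrow> (nat \<Rightarrow> (nat \<Rightarrow>\<^sub>0 'a) \<Rightarrow> (nat \<Rightarrow>\<^sub>0 'a)) \<Rightarrow>
    ((nat \<Rightarrow>\<^sub>0 'a) \<Rightarrow> 'a) \<Rightarrow> bool" where
  "exact_resolution I P bd aug \<longleftrightarrow>
     (\<forall>i. module_hom fscale fscale (bd (Suc i))) \<and>
     module_hom fscale (*) aug \<and>
     (\<forall>i. bd (Suc i) ` P (Suc i) \<subseteq> P i) \<and>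
     (\<forall>f. \<exists>v\<in>P 0. f - aug v \<in> I) \<and>
     {v \<in> P 0. aug v \<in> I} = bd 1 ` P 1 \<and>
     (\<forall>i. {v \<in> P (Suc i). bd (Suc i) v = 0} = bd (Suc (Suc i)) ` P (Suc (Suc i)))"

subsection \<open>Projective dimension\<close>

text \<open>
  Projective modules are given as images of idempotent endomorphisms of a free module of countable
  rank. Nothing is lost for \<open>R/I\<close> with \<open>R\<close> Noetherian.
\<close>

definition projective_summand :: "(nat \<Rightarrow>\<^sub>0 'a::comm_ring_1) set \<Rightarrow> bool" where
  "projective_summand P \<longleftrightarrow>
     (\<exists>e. module_hom fscale fscale e \<and> (\<forall>v. e (e v) = e v) \<and> P = range e)"

definition has_projective_resolution :: "'a::comm_ring_1 set \<Rightarrow> nat \<Rightarrow> bool" where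
  "has_projective_resolution I p \<longleftrightarrow>
     (\<exists>P bd aug. exact_resolution I P bd aug \<and>
        (\<forall>i. projective_summand (P i)) \<and> (\<forall>i>p. P i = {0}))"

definition proj_dim :: "'a::comm_ring_1 set \<Rightarrow> enat" where
  "proj_dim I = Inf {enat p | p. has_projective_resolution I p}"

subsection \<open>Graded free resolutions\<close>

text \<open>
  The \<open>i\<close>-th module has basis \<open>gens F i\<close>, and its basis vector with index \<open>q\<close> has degree
  \<open>gdeg F i q\<close>; it is the direct sum of the twists \<open>R(- gdeg F i q)\<close>.
\<close>

record (overloaded) ('n, 'k) graded_free_complex =
  gens :: "nat \<Rightarrow> nat set"
  gdeg :: "nat \<Rightarrow> nat \<Rightarrow> int"
  bdry :: "nat \<Rightarrow> (nat \<Rightarrow>\<^sub>0 ('n, 'k) mpoly) \<Rightarrow> (nat \<Rightarrow>\<^sub>0 ('n, 'k) mpoly)"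
  augm :: "(nat \<Rightarrow>\<^sub>0 ('n, 'k) mpoly) \<Rightarrow> ('n, 'k) mpoly"

definition homogeneous :: "int \<Rightarrow> ('n, 'k::zero) mpoly \<Rightarrow> bool" where
  "homogeneous j f \<longleftrightarrow> (\<forall>t\<in>Poly_Mapping.keys f. int (mdeg t) = j)"

definition homogeneous_vec :: "(nat \<Rightarrow> int) \<Rightarrow> int \<Rightarrow> (nat \<Rightarrow>\<^sub>0 ('n, 'k::zero) mpoly) \<Rightarrow> bool" where
  "homogeneous_vec a j v \<longleftrightarrow> (\<forall>q. homogeneous (j - a q) (Poly_Mapping.lookup v q))"

definition graded_free_resolution ::
  "('n, 'k::field) mpoly set \<Rightarrow> ('n, 'k) graded_free_complex \<Rightarrow> bool" where
  "graded_free_resolution I F \<longleftrightarrow>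
     (\<forall>i. finite (gens F i)) \<and>
     exact_resolution I (\<lambda>i. free_on (gens F i)) (bdry F) (augm F) \<and>
     (\<forall>i j. \<forall>v\<in>free_on (gens F (Suc i)).
        homogeneous_vec (gdeg F (Suc i)) j v \<longrightarrow> homogeneous_vec (gdeg F i) j (bdry F (Suc i) v)) \<and>
     (\<forall>j. \<forall>v\<in>free_on (gens F 0). homogeneous_vec (gdeg F 0) j v \<longrightarrow> homogeneous j (augm F v))"

section \<open>Tor with coefficients in the residue field\<close>

text \<open>
  Base change along \<open>R \<rightarrow> k = R/(x\<^sub>1,\<dots>,x\<^sub>n)\<close>. The tensor product of the free module on \<open>B\<close>
  with \<open>k\<close> is the \<open>k\<close>-vector space \<open>free_on B\<close>, and the matrix of the induced differential consists
  of the constant terms of the entries of the original one.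
\<close>

definition to_residue :: "(nat \<Rightarrow>\<^sub>0 ('n, 'k::field) mpoly) \<Rightarrow> (nat \<Rightarrow>\<^sub>0 'k)" where
  "to_residue v = Poly_Mapping.map (\<lambda>f. Poly_Mapping.lookup f 0) v"

definition from_residue :: "(nat \<Rightarrow>\<^sub>0 'k::field) \<Rightarrow> (nat \<Rightarrow>\<^sub>0 ('n, 'k) mpoly)" where
  "from_residue w = Poly_Mapping.map (Poly_Mapping.single 0) w"

definition tensor_bdry ::
  "('n, 'k::field) graded_free_complex \<Rightarrow> nat \<Rightarrow> (nat \<Rightarrow>\<^sub>0 'k) \<Rightarrow> (nat \<Rightarrow>\<^sub>0 'k)" where
  "tensor_bdry F i w = to_residue (bdry F i (from_residue w))"

definition tensor_cycles :: "('n, 'k::field) graded_free_complex \<Rightarrow> nat \<Rightarrow> (nat \<Rightarrow>\<^sub>0 'k) set" where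
  "tensor_cycles F i = {w \<in> free_on (gens F i). i = 0 \<or> tensor_bdry F i w = 0}"

definition tensor_boundaries :: "('n, 'k::field) graded_free_complex \<Rightarrow> nat \<Rightarrow> (nat \<Rightarrow>\<^sub>0 'k) set" where
  "tensor_boundaries F i = tensor_bdry F (Suc i) ` free_on (gens F (Suc i))"

definition tensor_degree :: "('n, 'k::field) graded_free_complex \<Rightarrow> nat \<Rightarrow> int \<Rightarrow> (nat \<Rightarrow>\<^sub>0 'k) set" where
  "tensor_degree F i j = {w. \<forall>q\<in>Poly_Mapping.keys w. gdeg F i q = j}"

text \<open>
  \<open>dim\<^sub>k Tor\<^sub>i(R/I,k)\<close> and \<open>dim\<^sub>k Tor\<^sub>i(R/I,k)\<^sub>j\<close>, computed from a chosen graded free resolution.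
  The subtractions are between finite dimensions of a space of cycles and a subspace of it.
\<close>

definition chosen_resolution :: "('n, 'k::field) mpoly set \<Rightarrow> ('n, 'k) graded_free_complex" where
  "chosen_resolution I = (SOME F. graded_free_resolution I F)"

definition tor_dim :: "('n, 'k::field) mpoly set \<Rightarrow> nat \<Rightarrow> nat" where
  "tor_dim I i = (let F = chosen_resolution I in
     vector_space.dim fscale (tensor_cycles F i) - vector_space.dim fscale (tensor_boundaries F i))"

definition graded_tor_dim :: "('n, 'k::field) mpoly set \<Rightarrow> nat \<Rightarrow> int \<Rightarrow> nat" where
  "graded_tor_dim I i j = (let F = chosen_resolution I in
     vector_space.dim fscale (tensor_cycles F i \<inter> tensor_degree F i j) -
     vector_space.dim fscale (tensor_boundaries F i \<inter> tensor_degree F i j))"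

definition betti_entry :: "('n, 'k::field) mpoly set \<Rightarrow> int \<Rightarrow> nat \<Rightarrow> nat" where
  "betti_entry I j i = graded_tor_dim I i (int i + j)"

definition ring_type :: "('n, 'k::field) mpoly set \<Rightarrow> nat" where
  "ring_type I = tor_dim I (the_enat (proj_dim I))"

text \<open>
  \<open>R/I\<close>, with \<open>I\<close> generated in degree \<open>d\<close>, has a linear resolution: in its minimal graded free
  resolution, the zeroth module is generated in degree \<open>0\<close> and the \<open>i\<close>-th one in degree \<open>i + d - 1\<close>
  for \<open>i \<ge> 1\<close>.
\<close>

definition minimal_complex :: "('n, 'k::field) graded_free_complex \<Rightarrow> bool" where
  "minimal_complex F \<longleftrightarrow> (\<forall>i. \<forall>w\<in>free_on (gens F (Suc i)). tensor_bdry F (Suc i) w = 0)"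

definition has_linear_resolution :: "('n, 'k::field) mpoly set \<Rightarrow> nat \<Rightarrow> bool" where
  "has_linear_resolution I d \<longleftrightarrow>
     (\<exists>F. graded_free_resolution I F \<and> minimal_complex F \<and>
        (\<forall>q\<in>gens F 0. gdeg F 0 q = 0) \<and>
        (\<forall>i\<ge>1. \<forall>q\<in>gens F i. gdeg F i q = int i + int d - 1))"

end

theory Submission
  imports Defs
begin

text \<open>
  The ideal \<open>K'\<close> is generated by the monomials of degree \<open>d\<close> whose exponents are bounded by
  \<open>d - 1\<close> at the variables \<open>x\<^sub>k\<close> with \<open>k = k\<^sub>1, \<dots>, k\<^sub>r\<close>. Such an ideal has linear quotients in the
  lexicographic order: if the generators before \<open>u\<close> generate \<open>I\<close>, then \<open>I : u\<close> is generated by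
  a set of variables. The mapping cone of a lift of \<open>R/(I : u)(-d) \<rightarrow> R/I\<close> is therefore again linear,
  and as a Koszul complex is itself an iterated mapping cone, \<open>u\<close> with \<open>m\<close> variables in its colon
  ideal contributes \<open>m choose (l - 1)\<close> to the \<open>l\<close>-th Betti number. Compared with the full set of
  monomials of degree \<open>d\<close>, the missing contributions telescope to \<open>(n - 1) choose (l - 1)\<close> for each
  removed power. Linearity forces minimality, and comparison maps with their homotopies transfer the
  ranks to the Tor modules of any other resolution and bound the projective dimension from below.
\<close>

section \<open>Linear maps between free modules\<close>

text \<open>In the colon ideal of a generator u with last variable x_m, a variable x_i with i < m is
  missing exactly when x_i^d is removed and u = x_i^(d-1) * x_m. Removing x_i^d thus costs its own
  binomial C(p, l), where p is the number of variables before x_i, and one difference C(q, l) - C(q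
  - 1, l) for each later variable at position q. These differences add up to C(n - 1, l) - C(p, l),
  so the total cost does not depend on i. The count is right as long as no u loses two variables and
  every x_i^(d-1) * x_m is still a generator, which can fail only for d = 1, where the removed
  powers are variables. The lcm of two distinct d-th powers has degree 2d, so the lcm hypothesis
  gives r <= 1 in that case. Tor is computed from an unspecified resolution and the projective
  dimension ranges over all projective ones. The constructed resolution must therefore be compared
  with arbitrary ones, and lifts and homotopies are set up for images of idempotents, not for free
  modules alone.\<close>

interpretation fs: module "fscale :: 'a::comm_ring_1 \<Rightarrow> ('b \<Rightarrow>\<^sub>0 'a) \<Rightarrow> ('b \<Rightarrow>\<^sub>0 'a)"
  by (rule module_fscale)

interpretation fs2: module_pair
  "fscale :: 'a::comm_ring_1 \<Rightarrow> ('b \<Rightarrow>\<^sub>0 'a) \<Rightarrow> ('b \<Rightarrow>\<^sub>0 'a)"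
  "fscale :: 'a::comm_ring_1 \<Rightarrow> ('c \<Rightarrow>\<^sub>0 'a) \<Rightarrow> ('c \<Rightarrow>\<^sub>0 'a)"
  by unfold_locales

abbreviation rlinear :: "((nat \<Rightarrow>\<^sub>0 'a::comm_ring_1) \<Rightarrow> (nat \<Rightarrow>\<^sub>0 'a)) \<Rightarrow> bool" where
  "rlinear \<equiv> module_hom fscale fscale"

abbreviation rform :: "((nat \<Rightarrow>\<^sub>0 'a::comm_ring_1) \<Rightarrow> 'a) \<Rightarrow> bool" where
  "rform \<equiv> module_hom fscale (*)"

abbreviation bvec :: "nat \<Rightarrow> (nat \<Rightarrow>\<^sub>0 'a::comm_ring_1)" where
  "bvec q \<equiv> Poly_Mapping.single q 1"

lemmas hom_add = module_hom.add
lemmas hom_scale = module_hom.scale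
lemmas hom_zero = module_hom.zero
lemmas hom_diff = module_hom.diff
lemmas hom_neg = module_hom.neg
lemmas hom_sum = module_hom.sum

lemma rlinearI:
  assumes "\<And>v w. f (v + w) = f v + f w" "\<And>c v. f (fscale c v) = fscale c (f v)"
  shows "rlinear f"
  using assms by unfold_locales

lemma rformI:
  assumes "\<And>v w. f (v + w) = f v + f w" "\<And>c v. f (fscale c v) = c * f v"
  shows "rform f"
  using assms by (intro module_hom.intro module_fscale module_mult module_hom_axioms.intro)

lemma rlinear_compose:
  assumes "rlinear f" "rlinear g"
  shows "rlinear (\<lambda>v. f (g v))"
  by (rule rlinearI) (simp_all add: hom_add[OF assms(1)] hom_add[OF assms(2)]
      hom_scale[OF assms(1)] hom_scale[OF assms(2)])

lemma rform_compose:
  assumes "rform f" "rlinear g"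
  shows "rform (\<lambda>v. f (g v))"
  by (rule rformI) (simp_all add: hom_add[OF assms(1)] hom_add[OF assms(2)]
      hom_scale[OF assms(1)] hom_scale[OF assms(2)])

lemma basis_expansion: "v = (\<Sum>q\<in>Poly_Mapping.keys v. fscale (Poly_Mapping.lookup v q) (bvec q))"
proof (rule poly_mapping_eqI)
  fix k
  have "(\<Sum>q\<in>Poly_Mapping.keys v. Poly_Mapping.lookup v q * Poly_Mapping.lookup (bvec q) k) =
        (\<Sum>q\<in>Poly_Mapping.keys v. if q = k then Poly_Mapping.lookup v k else 0)"
    by (rule sum.cong) (auto simp: lookup_single when_def)
  also have "\<dots> = Poly_Mapping.lookup v k"
    by (simp add: sum.delta in_keys_iff)
  finally show "Poly_Mapping.lookup v k = Poly_Mapping.lookup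
      (\<Sum>q\<in>Poly_Mapping.keys v. fscale (Poly_Mapping.lookup v q) (bvec q)) k"
    by (simp add: lookup_sum lookup_fscale)
qed

lemma free_on_induct [consumes 1, case_names zero add scale basis]:
  assumes "v \<in> free_on B" "P 0" "\<And>x y. P x \<Longrightarrow> P y \<Longrightarrow> P (x + y)"
    "\<And>c x. P x \<Longrightarrow> P (fscale (c::'a::comm_ring_1) x)" "\<And>q. q \<in> B \<Longrightarrow> P (bvec q)"
  shows "P v"
proof -
  have "P (\<Sum>q\<in>A. fscale (Poly_Mapping.lookup v q) (bvec q))" if "finite A" "A \<subseteq> B" for A
    using that by induction (auto intro: assms)
  moreover have "Poly_Mapping.keys v \<subseteq> B" using assms(1) by (simp add: free_on_def)
  ultimately show ?thesis by (subst basis_expansion) simp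
qed

lemma free_on_UNIV [simp]: "free_on UNIV = UNIV"
  by (simp add: free_on_def)

lemma free_on_empty [simp]: "free_on {} = {0}"
  by (auto simp: free_on_def)

lemma bvec_in_free_on: "q \<in> B \<Longrightarrow> bvec q \<in> free_on B"
  by (auto simp: free_on_def in_keys_iff lookup_single)

lemma in_free_on_iff: "v \<in> free_on B \<longleftrightarrow> (\<forall>q. q \<notin> B \<longrightarrow> Poly_Mapping.lookup v q = 0)"
  by (auto simp: free_on_def in_keys_iff)

lemma subspace_free_on: "fs.subspace (free_on B)"
  by (rule fs.subspaceI) (auto simp: in_free_on_iff lookup_add lookup_fscale)

lemma rlinear_eqI:
  assumes "rlinear f" "rlinear g" "\<And>q. f (bvec q) = g (bvec q)"
  shows "f v = g v"
proof -
  have "v \<in> free_on UNIV" by simp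
  then show ?thesis
    by (induction rule: free_on_induct)
      (simp_all add: hom_zero[OF assms(1)] hom_zero[OF assms(2)] hom_add[OF assms(1)] hom_add[OF assms(2)]
        hom_scale[OF assms(1)] hom_scale[OF assms(2)] assms(3))
qed

section \<open>Linear maps given on a basis, and lifting out of projective modules\<close>

definition basis_ext :: "(nat \<Rightarrow> (nat \<Rightarrow>\<^sub>0 'a::comm_ring_1)) \<Rightarrow> (nat \<Rightarrow>\<^sub>0 'a) \<Rightarrow> (nat \<Rightarrow>\<^sub>0 'a)" where
  "basis_ext x v = (\<Sum>q\<in>Poly_Mapping.keys v. fscale (Poly_Mapping.lookup v q) (x q))"

lemma basis_ext_superset:
  assumes "finite A" "Poly_Mapping.keys v \<subseteq> A"
  shows "basis_ext x v = (\<Sum>q\<in>A. fscale (Poly_Mapping.lookup v q) (x q))"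
  unfolding basis_ext_def using assms by (intro sum.mono_neutral_left) (auto simp: in_keys_iff)

lemma rlinear_basis_ext: "rlinear (basis_ext x)"
proof (rule rlinearI)
  fix v w :: "nat \<Rightarrow>\<^sub>0 'a"
  let ?A = "Poly_Mapping.keys v \<union> Poly_Mapping.keys w"
  have "basis_ext x (v + w) = (\<Sum>q\<in>?A. fscale (Poly_Mapping.lookup (v + w) q) (x q))"
    by (rule basis_ext_superset) (auto dest: subsetD[OF keys_add])
  also have "\<dots> = basis_ext x v + basis_ext x w"
    by (simp add: basis_ext_superset[of ?A] lookup_add fs.scale_left_distrib sum.distrib)
  finally show "basis_ext x (v + w) = basis_ext x v + basis_ext x w" .
next
  fix c v
  have "basis_ext x (fscale c v) = (\<Sum>q\<in>Poly_Mapping.keys v. fscale (Poly_Mapping.lookup (fscale c v) q) (x q))"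
    by (rule basis_ext_superset) (auto simp: in_keys_iff lookup_fscale)
  then show "basis_ext x (fscale c v) = fscale c (basis_ext x v)"
    by (simp add: basis_ext_def fs.scale_sum_right lookup_fscale)
qed

lemma basis_ext_bvec [simp]: "basis_ext x (bvec q) = x q"
  by (simp add: basis_ext_superset[of "{q}"])

text \<open>Serves twice: on basis indices it is the idempotent that makes \<open>free_on B\<close>
  a projective summand, and on exponent vectors it cuts out a homogeneous component of a
  polynomial.\<close>

lift_definition restrict_keys :: "'b set \<Rightarrow> ('b \<Rightarrow>\<^sub>0 'a::zero) \<Rightarrow> ('b \<Rightarrow>\<^sub>0 'a)"
  is "\<lambda>B v q. if q \<in> B then v q else 0"
  by (rule finite_subset) auto

lemma lookup_restrict_keys:
  "Poly_Mapping.lookup (restrict_keys B v) q = (if q \<in> B then Poly_Mapping.lookup v q else 0)"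
  by transfer simp

lemma rlinear_restrict_keys: "rlinear (restrict_keys B)"
  by (rule rlinearI)
    (auto intro!: poly_mapping_eqI simp: lookup_restrict_keys lookup_add lookup_fscale)

lemma restrict_keys_id: "v \<in> free_on B \<Longrightarrow> restrict_keys B v = v"
  by (auto intro!: poly_mapping_eqI simp: lookup_restrict_keys in_free_on_iff)

lemma restrict_keys_in_free_on: "restrict_keys B v \<in> free_on B"
  by (simp add: in_free_on_iff lookup_restrict_keys)

lemma projective_summand_free_on: "projective_summand (free_on B)"
proof -
  have "free_on B = range (restrict_keys B :: _ \<Rightarrow> (nat \<Rightarrow>\<^sub>0 'a))"
  proof (intro equalityI subsetI)
    fix v :: "nat \<Rightarrow>\<^sub>0 'a" assume "v \<in> free_on B"
    then show "v \<in> range (restrict_keys B)" by (metis rangeI restrict_keys_id)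
  qed (auto simp: restrict_keys_in_free_on)
  then show ?thesis unfolding projective_summand_def
    by (intro exI[of _ "restrict_keys B"] conjI allI rlinear_restrict_keys
        restrict_keys_id[OF restrict_keys_in_free_on])
qed

lemma projective_summand_subspace:
  assumes "projective_summand P"
  shows "fs.subspace P"
proof -
  obtain e where e: "rlinear e" "P = range e"
    using assms by (auto simp: projective_summand_def)
  show ?thesis unfolding e(2) by (rule module_hom.subspace_image[OF e(1)]) simp
qed

lemma rlinear_range_in_subspace:
  assumes "rlinear f" "fs.subspace Q" "\<And>q. f (bvec q) \<in> Q"
  shows "f v \<in> Q"
proof -
  have "v \<in> free_on UNIV" by simp
  then show ?thesis
    by (induction rule: free_on_induct)
      (simp_all add: hom_zero[OF assms(1)] hom_add[OF assms(1)] hom_scale[OF assms(1)] assms(3)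
        fs.subspace_0[OF assms(2)] fs.subspace_add[OF assms(2)] fs.subspace_scale[OF assms(2)])
qed

text \<open>Preimages are chosen for \<open>f (e (bvec q))\<close> rather than for
  \<open>f (bvec q)\<close>, since \<open>bvec q\<close> need not lie in \<open>P\<close>. As
  \<open>e\<close> is the identity on \<open>P\<close>, the linear extension of these choices lifts
  \<open>f\<close> there.\<close>

lemma projective_lift:
  assumes P: "projective_summand P" and Q: "fs.subspace Q" and f: "rlinear f" and D: "rlinear D"
    and sub: "f ` P \<subseteq> D ` Q"
  shows "\<exists>g. rlinear g \<and> (\<forall>v\<in>P. g v \<in> Q \<and> D (g v) = f v)"
proof -
  obtain e where e: "rlinear e" "\<And>v. e (e v) = e v" "P = range e"
    using P by (auto simp: projective_summand_def)
  have "\<exists>y\<in>Q. D y = f (e (bvec q))" for q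
    using sub e(3) by (metis image_eqI rangeI subsetD imageE)
  then obtain x where x: "\<And>q. x q \<in> Q" "\<And>q. D (x q) = f (e (bvec q))"
    by metis
  have 1: "basis_ext x v \<in> Q" for v
    by (rule rlinear_range_in_subspace[OF rlinear_basis_ext Q]) (simp add: x)
  have "D (basis_ext x v) = f (e v)" for v
    by (rule rlinear_eqI[OF rlinear_compose[OF D rlinear_basis_ext] rlinear_compose[OF f e(1)]])
      (simp add: x)
  then have "D (basis_ext x v) = f v" if "v \<in> P" for v
    using that e by (metis imageE)
  with 1 show ?thesis using rlinear_basis_ext by blast
qed

text \<open>The lift that starts a comparison map. An augmentation stands for a map to R/I, so it is
  onto only modulo \<open>I\<close>, and the lift is a congruence; closure of \<open>I\<close> under
  sums and multiples carries it from basis vectors to all vectors.\<close>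

lemma projective_lift_mod:
  fixes u :: "'a::comm_ring_1"
  assumes P: "projective_summand P" and Q: "fs.subspace Q" and f: "rform f" and D: "rform D"
    and I: "0 \<in> I" "\<And>x y. x \<in> I \<Longrightarrow> y \<in> I \<Longrightarrow> x + y \<in> I" "\<And>c x. x \<in> I \<Longrightarrow> c * x \<in> I"
    and surj: "\<And>r. \<exists>y\<in>Q. r - D y \<in> I"
  shows "\<exists>g. rlinear g \<and> (\<forall>v\<in>P. g v \<in> Q \<and> f v - D (g v) \<in> I)"
proof -
  obtain e where e: "rlinear e" "\<And>v. e (e v) = e v" "P = range e"
    using P by (auto simp: projective_summand_def)
  have "\<exists>y\<in>Q. f (e (bvec q)) - D y \<in> I" for q
    using surj by blast
  then obtain x where x: "\<And>q. x q \<in> Q" "\<And>q. f (e (bvec q)) - D (x q) \<in> I"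
    by metis
  have 1: "basis_ext x v \<in> Q" for v
    by (rule rlinear_range_in_subspace[OF rlinear_basis_ext Q]) (simp add: x)
  have "f (e v) - D (basis_ext x v) \<in> I" for v
  proof -
    have "v \<in> free_on UNIV" by simp
    then show ?thesis
    proof (induction rule: free_on_induct)
      case zero
      then show ?case
        by (simp add: hom_zero[OF e(1)] hom_zero[OF f] hom_zero[OF D] hom_zero[OF rlinear_basis_ext] I)
    next
      case (add v w)
      from I(2)[OF this] show ?case
        by (simp add: hom_add[OF e(1)] hom_add[OF f] hom_add[OF D] hom_add[OF rlinear_basis_ext]
            algebra_simps)
    next
      case (scale c v)
      from I(3)[OF this, of c] show ?case
        by (simp add: hom_scale[OF e(1)] hom_scale[OF f] hom_scale[OF D] hom_scale[OF rlinear_basis_ext]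
            algebra_simps)
    qed (simp add: x)
  qed
  then have "f v - D (basis_ext x v) \<in> I" if "v \<in> P" for v
    using that e by (metis imageE)
  with 1 show ?thesis using rlinear_basis_ext by blast
qed

section \<open>Comparison of resolutions\<close>

definition is_ideal :: "'a::comm_ring_1 set \<Rightarrow> bool" where
  "is_ideal I \<longleftrightarrow> 0 \<in> I \<and> (\<forall>x\<in>I. \<forall>y\<in>I. x + y \<in> I) \<and> (\<forall>c. \<forall>x\<in>I. c * x \<in> I)"

lemma is_idealD:
  assumes "is_ideal I"
  shows "0 \<in> I" "x \<in> I \<Longrightarrow> y \<in> I \<Longrightarrow> x + y \<in> I" "x \<in> I \<Longrightarrow> c * x \<in> I"
    "x \<in> I \<Longrightarrow> - x \<in> I" "x \<in> I \<Longrightarrow> y \<in> I \<Longrightarrow> x - y \<in> I"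
proof -
  show 1: "0 \<in> I" "x \<in> I \<Longrightarrow> y \<in> I \<Longrightarrow> x + y \<in> I" "x \<in> I \<Longrightarrow> c * x \<in> I" for x y c
    using assms by (auto simp: is_ideal_def)
  show 2: "x \<in> I \<Longrightarrow> - x \<in> I" for x using 1(3)[of x "-1"] by simp
  show "x \<in> I \<Longrightarrow> y \<in> I \<Longrightarrow> x - y \<in> I" using 1(2)[of x "- y"] 2[of y] by simp
qed

lemma ideal_diff_trans:
  assumes "is_ideal I" "x - y \<in> I" "y - z \<in> I"
  shows "x - z \<in> I"
  using is_idealD(2)[OF assms] by simp

lemma exact_resolutionD:
  assumes "exact_resolution I P bd aug"
  shows "rlinear (bd (Suc i))" "rform aug" "v \<in> P (Suc i) \<Longrightarrow> bd (Suc i) v \<in> P i"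
    "\<exists>v\<in>P 0. f - aug v \<in> I" "v \<in> P 0 \<Longrightarrow> aug v \<in> I \<Longrightarrow> v \<in> bd (Suc 0) ` P (Suc 0)"
    "v \<in> P (Suc 0) \<Longrightarrow> aug (bd (Suc 0) v) \<in> I"
    "v \<in> P (Suc i) \<Longrightarrow> bd (Suc i) v = 0 \<Longrightarrow> v \<in> bd (Suc (Suc i)) ` P (Suc (Suc i))"
    "v \<in> P (Suc (Suc i)) \<Longrightarrow> bd (Suc i) (bd (Suc (Suc i)) v) = 0"
proof -
  note a = assms[unfolded exact_resolution_def]
  show "rlinear (bd (Suc i))" "rform aug" "\<exists>v\<in>P 0. f - aug v \<in> I"
    "v \<in> P (Suc i) \<Longrightarrow> bd (Suc i) v \<in> P i"
    using a by auto
  have "{v \<in> P 0. aug v \<in> I} = bd (Suc 0) ` P (Suc 0)" using a by simp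
  then show "v \<in> P 0 \<Longrightarrow> aug v \<in> I \<Longrightarrow> v \<in> bd (Suc 0) ` P (Suc 0)"
    "v \<in> P (Suc 0) \<Longrightarrow> aug (bd (Suc 0) v) \<in> I" by blast+
  have "{v \<in> P (Suc i). bd (Suc i) v = 0} = bd (Suc (Suc i)) ` P (Suc (Suc i))" using a by simp
  then show "v \<in> P (Suc i) \<Longrightarrow> bd (Suc i) v = 0 \<Longrightarrow> v \<in> bd (Suc (Suc i)) ` P (Suc (Suc i))"
    "v \<in> P (Suc (Suc i)) \<Longrightarrow> bd (Suc i) (bd (Suc (Suc i)) v) = 0" by blast+
qed

text \<open>A lift of multiplication by \<open>u\<close>, from the cyclic module resolved by
  \<open>P\<close> to R/I. With \<open>u = 1\<close> it compares two resolutions of R/I; with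
  \<open>u\<close> a new generator and \<open>P\<close> resolving the quotient by I : u it is the
  map whose cone is formed.\<close>

definition chain_map_over :: "'a::comm_ring_1 \<Rightarrow> 'a set \<Rightarrow>
    (nat \<Rightarrow> (nat \<Rightarrow>\<^sub>0 'a) set) \<Rightarrow> (nat \<Rightarrow> (nat \<Rightarrow>\<^sub>0 'a) \<Rightarrow> (nat \<Rightarrow>\<^sub>0 'a)) \<Rightarrow> ((nat \<Rightarrow>\<^sub>0 'a) \<Rightarrow> 'a) \<Rightarrow>
    (nat \<Rightarrow> (nat \<Rightarrow>\<^sub>0 'a) set) \<Rightarrow> (nat \<Rightarrow> (nat \<Rightarrow>\<^sub>0 'a) \<Rightarrow> (nat \<Rightarrow>\<^sub>0 'a)) \<Rightarrow> ((nat \<Rightarrow>\<^sub>0 'a) \<Rightarrow> 'a) \<Rightarrow>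
    (nat \<Rightarrow> (nat \<Rightarrow>\<^sub>0 'a) \<Rightarrow> (nat \<Rightarrow>\<^sub>0 'a)) \<Rightarrow> bool" where
  "chain_map_over u I P bd aug Q bd' aug' \<phi> \<longleftrightarrow>
     (\<forall>i. rlinear (\<phi> i)) \<and> (\<forall>i. \<forall>v\<in>P i. \<phi> i v \<in> Q i) \<and>
     (\<forall>v\<in>P 0. u * aug v - aug' (\<phi> 0 v) \<in> I) \<and>
     (\<forall>i. \<forall>v\<in>P (Suc i). bd' (Suc i) (\<phi> (Suc i) v) = \<phi> i (bd (Suc i) v))"

lemma chain_map_overD:
  assumes "chain_map_over u I P bd aug Q bd' aug' \<phi>"
  shows "rlinear (\<phi> i)" "v \<in> P i \<Longrightarrow> \<phi> i v \<in> Q i"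
    "v \<in> P 0 \<Longrightarrow> u * aug v - aug' (\<phi> 0 v) \<in> I"
    "v \<in> P (Suc i) \<Longrightarrow> bd' (Suc i) (\<phi> (Suc i) v) = \<phi> i (bd (Suc i) v)"
  using assms by (auto simp: chain_map_over_def)

text \<open>
  The predicate \<open>A\<close> collects further properties of the components, such as being homogeneous.
\<close>

lemma chain_map_over_exists:
  assumes P: "exact_resolution J P bd aug" and Q: "exact_resolution I Q bd' aug'"
    and I: "is_ideal I" and u: "\<And>f. f \<in> J \<Longrightarrow> u * f \<in> I"
    and base: "\<exists>g. rlinear g \<and> A 0 g \<and> (\<forall>v\<in>P 0. g v \<in> Q 0 \<and> u * aug v - aug' (g v) \<in> I)"
    and step: "\<And>i g. rlinear g \<Longrightarrow> A i g \<Longrightarrow> (\<And>v. v \<in> P (Suc i) \<Longrightarrow> g (bd (Suc i) v) \<in> bd' (Suc i) ` Q (Suc i)) \<Longrightarrow>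
      \<exists>g'. rlinear g' \<and> A (Suc i) g' \<and> (\<forall>v\<in>P (Suc i). g' v \<in> Q (Suc i) \<and> bd' (Suc i) (g' v) = g (bd (Suc i) v))"
  shows "\<exists>\<phi>. chain_map_over u I P bd aug Q bd' aug' \<phi> \<and> (\<forall>i. A i (\<phi> i))"
proof -
  \<comment> \<open>The last conjunct is what the next lift needs. It follows from exactness of
    \<open>Q\<close>: the vector is a cycle because \<open>g\<close> commutes with the boundaries
    or, in degree 0, because its augmentation lies in \<open>I\<close>.\<close>
  define Good where "Good = (\<lambda>i g. rlinear g \<and> A i g \<and> (\<forall>v\<in>P i. g v \<in> Q i) \<and>
     (i = 0 \<longrightarrow> (\<forall>v\<in>P 0. u * aug v - aug' (g v) \<in> I)) \<and>
     (\<forall>v\<in>P (Suc i). g (bd (Suc i) v) \<in> bd' (Suc i) ` Q (Suc i)))"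
  define Next where "Next = (\<lambda>i (g :: (nat \<Rightarrow>\<^sub>0 'a) \<Rightarrow> (nat \<Rightarrow>\<^sub>0 'a)) g'.
     \<forall>v\<in>P (Suc i). bd' (Suc i) (g' v) = g (bd (Suc i) v))"
  note p = exact_resolutionD[OF P] and q = exact_resolutionD[OF Q]
  have "\<exists>\<phi>. \<forall>i. Good i (\<phi> i) \<and> Next i (\<phi> i) (\<phi> (Suc i))"
  proof (rule dependent_nat_choice)
    obtain g where g: "rlinear g" "A 0 g" "\<And>v. v\<in>P 0 \<Longrightarrow> g v \<in> Q 0"
      "\<And>v. v\<in>P 0 \<Longrightarrow> u * aug v - aug' (g v) \<in> I" using base by blast
    have "g (bd (Suc 0) v) \<in> bd' (Suc 0) ` Q (Suc 0)" if v: "v \<in> P (Suc 0)" for v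
    proof (rule q(5))
      show "g (bd (Suc 0) v) \<in> Q 0" using v p g by blast
      have "u * aug (bd (Suc 0) v) \<in> I" using v p(6) u by blast
      with g(4)[OF p(3)[OF v]] show "aug' (g (bd (Suc 0) v)) \<in> I"
        using is_idealD(5)[OF I] by fastforce
    qed
    then show "\<exists>g. Good 0 g" unfolding Good_def using g by blast
  next
    fix i g assume "Good i g"
    then obtain g' where g': "rlinear g'" "A (Suc i) g'" "\<And>v. v\<in>P (Suc i) \<Longrightarrow> g' v \<in> Q (Suc i)"
      "\<And>v. v\<in>P (Suc i) \<Longrightarrow> bd' (Suc i) (g' v) = g (bd (Suc i) v)" and g: "rlinear g"
      using step[of g i] unfolding Good_def by blast
    have "g' (bd (Suc (Suc i)) v) \<in> bd' (Suc (Suc i)) ` Q (Suc (Suc i))" if v: "v \<in> P (Suc (Suc i))" for v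
    proof (rule q(7))
      show "g' (bd (Suc (Suc i)) v) \<in> Q (Suc i)" using v p g' by blast
      show "bd' (Suc i) (g' (bd (Suc (Suc i)) v)) = 0"
        using g'(4)[OF p(3)[OF v]] p(8)[OF v] hom_zero[OF g] by simp
    qed
    then show "\<exists>g'. Good (Suc i) g' \<and> Next i g g'" unfolding Good_def Next_def using g' by blast
  qed
  then obtain \<phi> where "\<And>i. Good i (\<phi> i)" "\<And>i. Next i (\<phi> i) (\<phi> (Suc i))" by blast
  then show ?thesis unfolding Good_def Next_def chain_map_over_def by blast
qed

lemma chain_map_over_exists_projective:
  assumes P: "exact_resolution J P bd aug" and Q: "exact_resolution I Q bd' aug'"
    and I: "is_ideal I" and u: "\<And>f. f \<in> J \<Longrightarrow> u * f \<in> I"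
    and proj: "\<And>i. projective_summand (P i)" and sub: "\<And>i. fs.subspace (Q i)"
  shows "\<exists>\<phi>. chain_map_over u I P bd aug Q bd' aug' \<phi>"
proof -
  have 1: "rform (\<lambda>v. u * aug v)"
    by (rule rformI)
      (simp_all only: hom_add[OF exact_resolutionD(2)[OF P]] hom_scale[OF exact_resolutionD(2)[OF P]]
        distrib_left mult.left_commute)
  have base: "\<exists>g. rlinear g \<and> (\<forall>v\<in>P 0. g v \<in> Q 0 \<and> u * aug v - aug' (g v) \<in> I)"
    by (rule projective_lift_mod[OF proj sub 1 exact_resolutionD(2)[OF Q] is_idealD(1)[OF I]
          is_idealD(2)[OF I] is_idealD(3)[OF I] exact_resolutionD(4)[OF Q]])
  have step: "\<exists>g'. rlinear g' \<and> (\<forall>v\<in>P (Suc i). g' v \<in> Q (Suc i) \<and> bd' (Suc i) (g' v) = g (bd (Suc i) v))"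
    if "rlinear g" "\<And>v. v \<in> P (Suc i) \<Longrightarrow> g (bd (Suc i) v) \<in> bd' (Suc i) ` Q (Suc i)" for i g
    by (rule projective_lift[OF proj sub rlinear_compose[OF that(1) exact_resolutionD(1)[OF P]]
          exact_resolutionD(1)[OF Q]]) (use that(2) in auto)
  have "\<exists>\<phi>. chain_map_over u I P bd aug Q bd' aug' \<phi> \<and> (\<forall>i::nat. True)"
    by (rule chain_map_over_exists[OF P Q I u, where A = "\<lambda>_ _. True"]) (use base step in auto)
  then show ?thesis by blast
qed

lemma chain_map_over_compose:
  assumes a: "chain_map_over u I P bd aug Q bd' aug' \<phi>" and b: "chain_map_over 1 I Q bd' aug' S bd'' aug'' \<psi>"
    and I: "is_ideal I"
    and P: "\<And>i v. v \<in> P (Suc i) \<Longrightarrow> bd (Suc i) v \<in> P i"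
  shows "chain_map_over u I P bd aug S bd'' aug'' (\<lambda>i v. \<psi> i (\<phi> i v))"
proof -
  note a' = chain_map_overD[OF a] and b' = chain_map_overD[OF b]
  have "u * aug v - aug'' (\<psi> 0 (\<phi> 0 v)) \<in> I" if "v \<in> P 0" for v
    using ideal_diff_trans[OF I a'(3)[OF that], of "aug'' (\<psi> 0 (\<phi> 0 v))"] b'(3)[OF a'(2)[OF that]] by simp
  then show ?thesis unfolding chain_map_over_def
    using a' b' P by (auto intro: rlinear_compose)
qed

text \<open>Since \<open>\<psi>\<close> lifts the zero map, \<open>\<psi> 0\<close> lands in the
  boundaries of \<open>Q\<close>. From then on \<open>\<psi> (Suc i)\<close> minus
  \<open>h i\<close> after the boundary is a cycle, hence a boundary, and projectivity of
  \<open>P\<close> turns this into the next component of \<open>h\<close>.\<close>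

lemma null_homotopy_exists:
  assumes P: "exact_resolution J P bd aug" and Q: "exact_resolution I Q bd' aug'"
    and proj: "\<And>i. projective_summand (P i)" and sub: "\<And>i. fs.subspace (Q i)"
    and lin: "\<And>i. rlinear (\<psi> i)" and into: "\<And>i v. v \<in> P i \<Longrightarrow> \<psi> i v \<in> Q i"
    and null: "\<And>v. v \<in> P 0 \<Longrightarrow> aug' (\<psi> 0 v) \<in> I"
    and comm: "\<And>i v. v \<in> P (Suc i) \<Longrightarrow> bd' (Suc i) (\<psi> (Suc i) v) = \<psi> i (bd (Suc i) v)"
  shows "\<exists>h. (\<forall>i. rlinear (h i)) \<and> (\<forall>i. \<forall>v\<in>P i. h i v \<in> Q (Suc i)) \<and>
      (\<forall>v\<in>P 0. \<psi> 0 v = bd' (Suc 0) (h 0 v)) \<and>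
      (\<forall>i. \<forall>v\<in>P (Suc i). \<psi> (Suc i) v = bd' (Suc (Suc i)) (h (Suc i) v) + h i (bd (Suc i) v))"
proof -
  note p = exact_resolutionD[OF P] and q = exact_resolutionD[OF Q]
  define Good where "Good = (\<lambda>i h. rlinear h \<and> (\<forall>v\<in>P i. h v \<in> Q (Suc i)) \<and>
     (i = 0 \<longrightarrow> (\<forall>v\<in>P 0. \<psi> 0 v = bd' (Suc 0) (h v))) \<and>
     (\<forall>v\<in>P (Suc i). bd' (Suc i) (\<psi> (Suc i) v - h (bd (Suc i) v)) = 0))"
  define Next where "Next = (\<lambda>i (h :: (nat \<Rightarrow>\<^sub>0 'a) \<Rightarrow> (nat \<Rightarrow>\<^sub>0 'a)) h'.
     \<forall>v\<in>P (Suc i). \<psi> (Suc i) v = bd' (Suc (Suc i)) (h' v) + h (bd (Suc i) v))"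
  have "\<exists>h. \<forall>i. Good i (h i) \<and> Next i (h i) (h (Suc i))"
  proof (rule dependent_nat_choice)
    have "\<psi> 0 ` P 0 \<subseteq> bd' (Suc 0) ` Q (Suc 0)"
      using q(5) into null by blast
    from projective_lift[OF proj sub lin q(1) this] obtain h
      where h: "rlinear h" "\<And>v. v \<in> P 0 \<Longrightarrow> h v \<in> Q (Suc 0)" "\<And>v. v \<in> P 0 \<Longrightarrow> bd' (Suc 0) (h v) = \<psi> 0 v" by blast
    have "bd' (Suc 0) (\<psi> (Suc 0) v - h (bd (Suc 0) v)) = 0" if "v \<in> P (Suc 0)" for v
      using comm[OF that] h(3)[OF p(3)[OF that]] by (simp add: hom_diff[OF q(1)])
    then show "\<exists>h. Good 0 h" unfolding Good_def using h by (intro exI[of _ h]) auto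
  next
    fix i h assume "Good i h"
    then have h: "rlinear h" "\<And>v. v \<in> P i \<Longrightarrow> h v \<in> Q (Suc i)"
      and ker: "\<And>v. v\<in>P (Suc i) \<Longrightarrow> bd' (Suc i) (\<psi> (Suc i) v - h (bd (Suc i) v)) = 0"
      unfolding Good_def by blast+
    have lin': "rlinear (\<lambda>v. \<psi> (Suc i) v - h (bd (Suc i) v))"
      by (intro fs2.module_hom_sub lin rlinear_compose[OF h(1) p(1)])
    have "(\<lambda>v. \<psi> (Suc i) v - h (bd (Suc i) v)) ` P (Suc i) \<subseteq> bd' (Suc (Suc i)) ` Q (Suc (Suc i))"
      using q(7) ker into h(2) p(3) fs.subspace_diff[OF sub] by blast
    from projective_lift[OF proj sub lin' q(1) this] obtain h'
      where h': "rlinear h'" "\<And>v. v \<in> P (Suc i) \<Longrightarrow> h' v \<in> Q (Suc (Suc i))"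
        "\<And>v. v \<in> P (Suc i) \<Longrightarrow> bd' (Suc (Suc i)) (h' v) = \<psi> (Suc i) v - h (bd (Suc i) v)" by blast
    have "bd' (Suc (Suc i)) (\<psi> (Suc (Suc i)) v - h' (bd (Suc (Suc i)) v)) = 0" if "v \<in> P (Suc (Suc i))" for v
      using comm[OF that] h'(3)[OF p(3)[OF that]] p(8)[OF that]
      by (simp add: hom_diff[OF q(1)] hom_zero[OF h(1)])
    then show "\<exists>h'. Good (Suc i) h' \<and> Next i h h'"
      unfolding Good_def Next_def using h' by (intro exI[of _ h']) auto
  qed
  then obtain h where "\<And>i. Good i (h i)" "\<And>i. Next i (h i) (h (Suc i))" by blast
  then show ?thesis unfolding Good_def Next_def by blast
qed

text \<open>Both \<open>\<phi>\<close> and the identity lift the identity of R/I, so their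
  difference lifts zero.\<close>

lemma chain_map_homotopic_id:
  assumes P: "exact_resolution I P bd aug" and I: "is_ideal I"
    and proj: "\<And>i. projective_summand (P i)"
    and \<phi>: "chain_map_over 1 I P bd aug P bd aug \<phi>"
  shows "\<exists>h. (\<forall>i. rlinear (h i)) \<and> (\<forall>i. \<forall>v\<in>P i. h i v \<in> P (Suc i)) \<and>
      (\<forall>v\<in>P 0. v - \<phi> 0 v = bd (Suc 0) (h 0 v)) \<and>
      (\<forall>i. \<forall>v\<in>P (Suc i). v - \<phi> (Suc i) v = bd (Suc (Suc i)) (h (Suc i) v) + h i (bd (Suc i) v))"
proof -
  note p = exact_resolutionD[OF P] and c = chain_map_overD[OF \<phi>]
  note sub = projective_summand_subspace[OF proj]
  show ?thesis
  proof (rule null_homotopy_exists[OF P P proj sub])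
    show "rlinear (\<lambda>v. v - \<phi> i v)" for i by (intro fs2.module_hom_sub fs.module_hom_ident c)
    show "v - \<phi> i v \<in> P i" if "v \<in> P i" for i v using fs.subspace_diff[OF sub that c(2)[OF that]] .
    show "aug (v - \<phi> 0 v) \<in> I" if "v \<in> P 0" for v
      using c(3)[OF that] by (simp add: hom_diff[OF p(2)])
    show "bd (Suc i) (v - \<phi> (Suc i) v) = bd (Suc i) v - \<phi> i (bd (Suc i) v)" if "v \<in> P (Suc i)" for i v
      using c(4)[OF that] by (simp add: hom_diff[OF p(1)])
  qed
qed

section \<open>Gradings\<close>

lemma mdeg_superset:
  assumes "finite A" "Poly_Mapping.keys t \<subseteq> A"
  shows "mdeg t = (\<Sum>v\<in>A. Poly_Mapping.lookup t v)"
  unfolding mdeg_def using assms by (intro sum.mono_neutral_left) (auto simp: in_keys_iff)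

lemma mdeg_add: "mdeg (s + t) = mdeg s + mdeg t"
proof -
  let ?A = "Poly_Mapping.keys s \<union> Poly_Mapping.keys t"
  have "Poly_Mapping.keys (s + t) \<subseteq> ?A" by (rule keys_add)
  then show ?thesis by (simp add: mdeg_superset[of ?A] lookup_add sum.distrib)
qed

lemma mdeg_zero [simp]: "mdeg 0 = 0"
  by (simp add: mdeg_def)

lemma mdeg_eq_0_iff: "mdeg t = 0 \<longleftrightarrow> t = 0"
proof
  assume "mdeg t = 0"
  then have "Poly_Mapping.lookup t v = 0" if "v \<in> Poly_Mapping.keys t" for v
    using that by (simp add: mdeg_def)
  then show "t = 0" by (metis in_keys_iff lookup_zero poly_mapping_eqI)
qed simp

lemma mdeg_single [simp]: "mdeg (Poly_Mapping.single v k) = k"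
  by (simp add: mdeg_superset[of "{v}"])

lemma homogeneous_0 [simp]: "homogeneous j 0"
  by (simp add: homogeneous_def)

lemma homogeneous_add: "homogeneous j f \<Longrightarrow> homogeneous j g \<Longrightarrow> homogeneous j (f + g)"
  unfolding homogeneous_def using keys_add[of f g] by blast

lemma homogeneous_mult:
  assumes "homogeneous i f" "homogeneous j g"
  shows "homogeneous (i + j) (f * g)"
proof -
  have "int (mdeg t) = i + j" if t: "t \<in> Poly_Mapping.keys (f * g)" for t
  proof -
    obtain a b where "t = a + b" "a \<in> Poly_Mapping.keys f" "b \<in> Poly_Mapping.keys g"
        using keys_mult[of f g] t by blast
    then show ?thesis using assms by (auto simp: homogeneous_def mdeg_add)
  qed
  then show ?thesis by (simp add: homogeneous_def)
qed

lemma homogeneous_single: "homogeneous (int (mdeg t)) (Poly_Mapping.single t c)"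
  by (auto simp: homogeneous_def)

definition hcomp :: "int \<Rightarrow> ('n, 'k::zero) mpoly \<Rightarrow> ('n, 'k) mpoly" where
  "hcomp j f = restrict_keys {t. int (mdeg t) = j} f"

lemma lookup_hcomp:
  "Poly_Mapping.lookup (hcomp j f) t = (if int (mdeg t) = j then Poly_Mapping.lookup f t else 0)"
  by (simp add: hcomp_def lookup_restrict_keys)

lemma hcomp_zero [simp]: "hcomp j 0 = 0"
  by (auto intro!: poly_mapping_eqI simp: lookup_hcomp)

lemma hcomp_add: "hcomp j (f + g) = hcomp j f + hcomp j g"
  by (auto intro!: poly_mapping_eqI simp: lookup_hcomp lookup_add)

lemma hcomp_diff: "hcomp j (f - g) = hcomp j f - hcomp j (g :: ('n, 'k::ab_group_add) mpoly)"
  by (auto intro!: poly_mapping_eqI simp: lookup_hcomp lookup_minus)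

lemma homogeneous_hcomp: "homogeneous j (hcomp j f)"
  by (auto simp: homogeneous_def in_keys_iff lookup_hcomp split: if_splits)

lemma hcomp_homogeneous: "homogeneous i f \<Longrightarrow> hcomp j f = (if i = j then f else 0)"
  by (auto intro!: poly_mapping_eqI simp: lookup_hcomp homogeneous_def in_keys_iff)

lemma homogeneous_hcomp_eq: "homogeneous j f \<Longrightarrow> hcomp j f = f"
  by (simp add: hcomp_homogeneous)

lift_definition vcomp :: "(nat \<Rightarrow> int) \<Rightarrow> int \<Rightarrow> (nat \<Rightarrow>\<^sub>0 ('n, 'k::zero) mpoly) \<Rightarrow> (nat \<Rightarrow>\<^sub>0 ('n, 'k) mpoly)"
  is "\<lambda>a j v q. hcomp (j - a q) (v q)"
proof -
  fix a j and v :: "nat \<Rightarrow> ('n, 'k) mpoly"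
  assume "finite {q. v q \<noteq> 0}"
  then show "finite {q. hcomp (j - a q) (v q) \<noteq> 0}" by (rule rev_finite_subset) auto
qed

lemma lookup_vcomp: "Poly_Mapping.lookup (vcomp a j v) q = hcomp (j - a q) (Poly_Mapping.lookup v q)"
  by transfer simp

lemma vcomp_zero [simp]: "vcomp a j 0 = 0"
  by (auto intro!: poly_mapping_eqI simp: lookup_vcomp)

lemma vcomp_add: "vcomp a j (v + w) = vcomp a j v + vcomp a j w"
  by (auto intro!: poly_mapping_eqI simp: lookup_vcomp lookup_add hcomp_add)

lemma vcomp_sum: "vcomp a j (sum f A) = (\<Sum>x\<in>A. vcomp a j (f x))"
  by (induction A rule: infinite_finite_induct) (auto simp: vcomp_add)

lemma hcomp_sum: "hcomp j (sum f A) = (\<Sum>x\<in>A. hcomp j (f x))"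
  by (induction A rule: infinite_finite_induct) (auto simp: hcomp_add)

lemma homogeneous_vcomp: "homogeneous_vec a j (vcomp a j v)"
  by (simp add: homogeneous_vec_def lookup_vcomp homogeneous_hcomp)

lemma vcomp_homogeneous: "homogeneous_vec a i v \<Longrightarrow> vcomp a j v = (if i = j then v else 0)"
proof (rule poly_mapping_eqI)
  fix q assume "homogeneous_vec a i v"
  then have "homogeneous (i - a q) (Poly_Mapping.lookup v q)" by (simp add: homogeneous_vec_def)
  from hcomp_homogeneous[OF this]
  show "Poly_Mapping.lookup (vcomp a j v) q = Poly_Mapping.lookup (if i = j then v else 0) q"
    by (simp add: lookup_vcomp)
qed

lemma vcomp_in_free_on: "v \<in> free_on B \<Longrightarrow> vcomp a j v \<in> free_on B"
  by (simp add: in_free_on_iff lookup_vcomp)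

lemma homogeneous_vec_0 [simp]: "homogeneous_vec a j 0"
  by (simp add: homogeneous_vec_def)

lemma homogeneous_vec_add:
  "homogeneous_vec a j v \<Longrightarrow> homogeneous_vec a j w \<Longrightarrow> homogeneous_vec a j (v + w)"
  by (simp add: homogeneous_vec_def lookup_add homogeneous_add)

lemma homogeneous_vec_sum:
  "(\<And>x. x \<in> A \<Longrightarrow> homogeneous_vec a j (f x)) \<Longrightarrow> homogeneous_vec a j (sum f A)"
  by (induction A rule: infinite_finite_induct) (auto simp: homogeneous_vec_add)

lemma homogeneous_vec_fscale:
  assumes "homogeneous i c" "homogeneous_vec a j v"
  shows "homogeneous_vec a (i + j) (fscale c v)"
  using homogeneous_mult[OF assms(1)] assms(2)
  by (simp add: homogeneous_vec_def lookup_fscale add_diff_eq[symmetric])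

lemma homogeneous_vec_bvec: "homogeneous_vec a (a q) (bvec q)"
  by (auto simp: homogeneous_vec_def lookup_single when_def homogeneous_def simp flip: single_one)

text \<open>Only finitely many degrees occur in a vector. The vanishing outside \<open>A\<close>
  lets a component be picked out of the sum whether or not its degree belongs to
  \<open>A\<close>.\<close>

lemma vec_eq_sum_vcomp: "\<exists>A. finite A \<and> v = (\<Sum>j\<in>A. vcomp a j v) \<and> (\<forall>j. j \<notin> A \<longrightarrow> vcomp a j v = 0)"
proof -
  let ?K = "SIGMA q:Poly_Mapping.keys v. Poly_Mapping.keys (Poly_Mapping.lookup v q)"
  let ?A = "(\<lambda>(q, t). int (mdeg t) + a q) ` ?K"
  have fin: "finite ?A" by (intro finite_imageI finite_SigmaI) auto
  have mem: "int (mdeg t) + a q \<in> ?A" if "Poly_Mapping.lookup (Poly_Mapping.lookup v q) t \<noteq> 0" for q t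
    using that by (force simp: in_keys_iff)
  have "v = (\<Sum>j\<in>?A. vcomp a j v)"
  proof (intro poly_mapping_eqI)
    fix q t
    have "Poly_Mapping.lookup (Poly_Mapping.lookup (\<Sum>j\<in>?A. vcomp a j v) q) t =
      (\<Sum>j\<in>?A. if j = int (mdeg t) + a q then Poly_Mapping.lookup (Poly_Mapping.lookup v q) t else 0)"
      unfolding lookup_sum lookup_vcomp lookup_hcomp by (rule sum.cong) auto
    also have "\<dots> = Poly_Mapping.lookup (Poly_Mapping.lookup v q) t"
      using mem[of q t] by (subst sum.delta[OF fin]) (simp split: if_split, blast)
    finally show "Poly_Mapping.lookup (Poly_Mapping.lookup v q) t =
        Poly_Mapping.lookup (Poly_Mapping.lookup (\<Sum>j\<in>?A. vcomp a j v) q) t" by simp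
  qed
  moreover have "vcomp a j v = 0" if "j \<notin> ?A" for j
    by (intro poly_mapping_eqI) (use that mem in \<open>force simp: lookup_vcomp lookup_hcomp\<close>)
  ultimately show ?thesis using fin by blast
qed

text \<open>Allows a solution of \<open>D y = w\<close> with homogeneous \<open>w\<close> to be
  replaced by its component of the right degree. Gradedness of \<open>D\<close> is given on
  homogeneous vectors only, so \<open>v\<close> is first split into components, each of which
  \<open>D\<close> sends into a single degree.\<close>

lemma vcomp_commute:
  assumes D: "rlinear D"
    and hom: "\<And>j v. v \<in> free_on B \<Longrightarrow> homogeneous_vec a j v \<Longrightarrow> homogeneous_vec b j (D v)"
    and v: "v \<in> free_on B"
  shows "D (vcomp a j v) = vcomp b j (D v)"
proof -
  obtain A where A: "finite A" "v = (\<Sum>j\<in>A. vcomp a j v)" "\<And>j. j \<notin> A \<Longrightarrow> vcomp a j v = 0"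
    using vec_eq_sum_vcomp[of v a] by blast
  have eq: "vcomp b j (D (vcomp a i v)) = (if i = j then D (vcomp a i v) else 0)" for i
    by (rule vcomp_homogeneous) (simp add: hom vcomp_in_free_on v homogeneous_vcomp)
  have "vcomp b j (D v) = vcomp b j (D (\<Sum>j\<in>A. vcomp a j v))"
    using A(2) by simp
  also have "\<dots> = (\<Sum>i\<in>A. if i = j then D (vcomp a i v) else 0)"
    by (simp only: hom_sum[OF D] vcomp_sum eq)
  also have "\<dots> = D (vcomp a j v)"
    using A(1,3) by (simp add: sum.delta hom_zero[OF D])
  finally show ?thesis by simp
qed

lemma hcomp_commute:
  assumes D: "rform D"
    and hom: "\<And>j v. v \<in> free_on B \<Longrightarrow> homogeneous_vec a j v \<Longrightarrow> homogeneous j (D v)"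
    and v: "v \<in> free_on B"
  shows "D (vcomp a j v) = hcomp j (D v)"
proof -
  obtain A where A: "finite A" "v = (\<Sum>j\<in>A. vcomp a j v)" "\<And>j. j \<notin> A \<Longrightarrow> vcomp a j v = 0"
    using vec_eq_sum_vcomp[of v a] by blast
  have eq: "hcomp j (D (vcomp a i v)) = (if i = j then D (vcomp a i v) else 0)" for i
    by (rule hcomp_homogeneous) (simp add: hom vcomp_in_free_on v homogeneous_vcomp)
  have "hcomp j (D v) = hcomp j (D (\<Sum>j\<in>A. vcomp a j v))"
    using A(2) by simp
  also have "\<dots> = (\<Sum>i\<in>A. if i = j then D (vcomp a i v) else 0)"
    by (simp only: hom_sum[OF D] hcomp_sum eq)
  also have "\<dots> = D (vcomp a j v)"
    using A(1,3) by (simp add: sum.delta hom_zero[OF D])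
  finally show ?thesis by simp
qed

text \<open>The shift \<open>s\<close> is 0 for boundary maps and the degree of the multiplier for
  chain maps over it.\<close>

definition graded_map :: "nat set \<Rightarrow> (nat \<Rightarrow> int) \<Rightarrow> (nat \<Rightarrow> int) \<Rightarrow> int \<Rightarrow>
    ((nat \<Rightarrow>\<^sub>0 ('n, 'k::zero) mpoly) \<Rightarrow> (nat \<Rightarrow>\<^sub>0 ('n, 'k) mpoly)) \<Rightarrow> bool" where
  "graded_map B a b s f \<longleftrightarrow>
     (\<forall>j. \<forall>v\<in>free_on B. homogeneous_vec a j v \<longrightarrow> homogeneous_vec b (j + s) (f v))"

lemma graded_mapD:
  "graded_map B a b s f \<Longrightarrow> v \<in> free_on B \<Longrightarrow> homogeneous_vec a j v \<Longrightarrow> homogeneous_vec b (j + s) (f v)"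
  by (simp add: graded_map_def)

lemma graded_map_basis_ext:
  fixes x :: "nat \<Rightarrow> (nat \<Rightarrow>\<^sub>0 ('n, 'k::field) mpoly)"
  assumes "\<And>q. q \<in> B \<Longrightarrow> homogeneous_vec b (a q + s) (x q)"
  shows "graded_map B a b s (basis_ext x)"
  unfolding graded_map_def
proof (intro allI ballI impI)
  fix j :: int and v :: "nat \<Rightarrow>\<^sub>0 ('n, 'k) mpoly"
  assume v: "v \<in> free_on B" "homogeneous_vec a j v"
  show "homogeneous_vec b (j + s) (basis_ext x v)"
    unfolding basis_ext_def
  proof (rule homogeneous_vec_sum)
    fix q assume "q \<in> Poly_Mapping.keys v"
    then have "q \<in> B" using v by (auto simp: free_on_def)
    have "homogeneous (j - a q) (Poly_Mapping.lookup v q)"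
      using v by (simp add: homogeneous_vec_def)
    from homogeneous_vec_fscale[OF this assms[OF \<open>q \<in> B\<close>]]
    show "homogeneous_vec b (j + s) (fscale (Poly_Mapping.lookup v q) (x q))" by simp
  qed
qed

lemma graded_free_resolutionD:
  assumes "graded_free_resolution I F"
  shows "finite (gens F i)" "exact_resolution I (\<lambda>i. free_on (gens F i)) (bdry F) (augm F)"
    "graded_map (gens F (Suc i)) (gdeg F (Suc i)) (gdeg F i) 0 (bdry F (Suc i))"
    "v \<in> free_on (gens F 0) \<Longrightarrow> homogeneous_vec (gdeg F 0) j v \<Longrightarrow> homogeneous j (augm F v)"
  using assms by (auto simp: graded_free_resolution_def graded_map_def)

definition homogeneous_ideal :: "('n, 'k::field) mpoly set \<Rightarrow> bool" where
  "homogeneous_ideal I \<longleftrightarrow> is_ideal I \<and> (\<forall>f\<in>I. \<forall>j. hcomp j f \<in> I)"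

text \<open>A basis vector is lifted by taking the component of the right degree of any lift.\<close>

lemma graded_chain_map_exists:
  fixes u :: "('n, 'k::field) mpoly"
  assumes G: "graded_free_resolution J G" and F: "graded_free_resolution I F"
    and I: "homogeneous_ideal I" and u: "\<And>f. f \<in> J \<Longrightarrow> u * f \<in> I" and s: "homogeneous s u"
  shows "\<exists>\<phi>. chain_map_over u I (\<lambda>i. free_on (gens G i)) (bdry G) (augm G)
       (\<lambda>i. free_on (gens F i)) (bdry F) (augm F) \<phi> \<and>
     (\<forall>i. graded_map (gens G i) (gdeg G i) (gdeg F i) s (\<phi> i))"
proof (rule chain_map_over_exists[OF graded_free_resolutionD(2)[OF G] graded_free_resolutionD(2)[OF F] _ u])
  note gr = graded_free_resolutionD[OF G] and fr = graded_free_resolutionD[OF F]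
  note gx = exact_resolutionD[OF gr(2)] and fx = exact_resolutionD[OF fr(2)]
  note sub = subspace_free_on
  show ideal: "is_ideal I" using I by (simp add: homogeneous_ideal_def)
  note il = is_idealD[OF ideal]
  show "\<exists>g. rlinear g \<and> graded_map (gens G 0) (gdeg G 0) (gdeg F 0) s g \<and>
      (\<forall>v\<in>free_on (gens G 0). g v \<in> free_on (gens F 0) \<and> u * augm G v - augm F (g v) \<in> I)"
  proof -
    have "\<exists>y\<in>free_on (gens F 0). u * augm G (bvec q) - augm F y \<in> I \<and>
      homogeneous_vec (gdeg F 0) (gdeg G 0 q + s) y" if q: "q \<in> gens G 0" for q
    proof -
      let ?f = "u * augm G (bvec q)" and ?j = "gdeg G 0 q + s"
      have "homogeneous (s + gdeg G 0 q) ?f"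
        by (rule homogeneous_mult[OF s gr(4)[OF bvec_in_free_on[OF q] homogeneous_vec_bvec]])
      then have h: "hcomp ?j ?f = ?f" by (simp add: homogeneous_hcomp_eq add.commute)
      obtain y where y: "y \<in> free_on (gens F 0)" "?f - augm F y \<in> I" using fx(4) by blast
      have "hcomp ?j (?f - augm F y) = ?f - augm F (vcomp (gdeg F 0) ?j y)"
        using hcomp_commute[OF fx(2) fr(4) y(1)] h by (simp add: hcomp_diff)
      then have "?f - augm F (vcomp (gdeg F 0) ?j y) \<in> I"
        using I y(2) unfolding homogeneous_ideal_def by metis
      then show ?thesis using vcomp_in_free_on[OF y(1)] homogeneous_vcomp by blast
    qed
    then obtain x where x: "\<And>q. q \<in> gens G 0 \<Longrightarrow> x q \<in> free_on (gens F 0)"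
      "\<And>q. q \<in> gens G 0 \<Longrightarrow> u * augm G (bvec q) - augm F (x q) \<in> I"
      "\<And>q. q \<in> gens G 0 \<Longrightarrow> homogeneous_vec (gdeg F 0) (gdeg G 0 q + s) (x q)" by metis
    let ?g = "basis_ext x"
    have lin: "rlinear ?g" by (rule rlinear_basis_ext)
    have "?g v \<in> free_on (gens F 0) \<and> u * augm G v - augm F (?g v) \<in> I" if "v \<in> free_on (gens G 0)" for v
      using that
    proof (induction rule: free_on_induct)
      case zero
      then show ?case
        by (simp add: hom_zero[OF lin] hom_zero[OF gx(2)] hom_zero[OF fx(2)] il(1) fs.subspace_0[OF sub])
    next
      case (add v w)
      have "(u * augm G v - augm F (?g v)) + (u * augm G w - augm F (?g w)) \<in> I"
        using il(2) add by blast
      moreover have "u * augm G (v + w) - augm F (?g (v + w)) =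
        (u * augm G v - augm F (?g v)) + (u * augm G w - augm F (?g w))"
        by (simp add: hom_add[OF lin] hom_add[OF gx(2)] hom_add[OF fx(2)] distrib_left)
      ultimately show ?case using add by (simp add: hom_add[OF lin] fs.subspace_add[OF sub])
    next
      case (scale c v)
      have "c * (u * augm G v - augm F (?g v)) \<in> I" using il(3) scale by blast
      moreover have "u * augm G (fscale c v) - augm F (?g (fscale c v)) = c * (u * augm G v - augm F (?g v))"
        by (simp add: hom_scale[OF lin] hom_scale[OF gx(2)] hom_scale[OF fx(2)] right_diff_distrib
            mult.left_commute)
      ultimately show ?case using scale by (simp add: hom_scale[OF lin] fs.subspace_scale[OF sub])
    next
      case (basis q)
      then show ?case using x by simp
    qed
    then show ?thesis using lin graded_map_basis_ext[of "gens G 0" "gdeg F 0" "gdeg G 0" s x] x(3)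
      by blast
  qed
  show "\<exists>g'. rlinear g' \<and> graded_map (gens G (Suc i)) (gdeg G (Suc i)) (gdeg F (Suc i)) s g' \<and>
      (\<forall>v\<in>free_on (gens G (Suc i)). g' v \<in> free_on (gens F (Suc i)) \<and>
         bdry F (Suc i) (g' v) = g (bdry G (Suc i) v))"
    if g: "rlinear g" "graded_map (gens G i) (gdeg G i) (gdeg F i) s g"
      "\<And>v. v \<in> free_on (gens G (Suc i)) \<Longrightarrow>
         g (bdry G (Suc i) v) \<in> bdry F (Suc i) ` free_on (gens F (Suc i))" for i g
  proof -
    have "\<exists>y\<in>free_on (gens F (Suc i)). bdry F (Suc i) y = g (bdry G (Suc i) (bvec q)) \<and>
      homogeneous_vec (gdeg F (Suc i)) (gdeg G (Suc i) q + s) y" if q: "q \<in> gens G (Suc i)" for q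
    proof -
      let ?f = "g (bdry G (Suc i) (bvec q))" and ?j = "gdeg G (Suc i) q + s"
      note qin = bvec_in_free_on[OF q]
      have "homogeneous_vec (gdeg F i) ?j ?f"
        using graded_mapD[OF g(2) gx(3)[OF qin] graded_mapD[OF gr(3) qin homogeneous_vec_bvec]] by simp
      then have h: "vcomp (gdeg F i) ?j ?f = ?f" by (simp add: vcomp_homogeneous)
      obtain y where y: "y \<in> free_on (gens F (Suc i))" "bdry F (Suc i) y = ?f"
        using g(3)[OF qin] by auto
      have hom: "homogeneous_vec (gdeg F i) j (bdry F (Suc i) v)"
        if "v \<in> free_on (gens F (Suc i))" "homogeneous_vec (gdeg F (Suc i)) j v" for j v
        using graded_mapD[OF fr(3) that] by simp
      have "bdry F (Suc i) (vcomp (gdeg F (Suc i)) ?j y) = ?f"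
        using vcomp_commute[OF fx(1) hom y(1), where j = ?j] h y(2) by simp
      then show ?thesis using vcomp_in_free_on[OF y(1)] homogeneous_vcomp by blast
    qed
    then obtain x where x: "\<And>q. q \<in> gens G (Suc i) \<Longrightarrow> x q \<in> free_on (gens F (Suc i))"
      "\<And>q. q \<in> gens G (Suc i) \<Longrightarrow> bdry F (Suc i) (x q) = g (bdry G (Suc i) (bvec q))"
      "\<And>q. q \<in> gens G (Suc i) \<Longrightarrow> homogeneous_vec (gdeg F (Suc i)) (gdeg G (Suc i) q + s) (x q)" by metis
    let ?g = "basis_ext x"
    have lin: "rlinear ?g" by (rule rlinear_basis_ext)
    have "?g v \<in> free_on (gens F (Suc i)) \<and> bdry F (Suc i) (?g v) = g (bdry G (Suc i) v)"
      if "v \<in> free_on (gens G (Suc i))" for v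
      using that
    proof (induction rule: free_on_induct)
      case zero
      then show ?case
        by (simp add: hom_zero[OF lin] hom_zero[OF gx(1)] hom_zero[OF fx(1)] hom_zero[OF g(1)]
            fs.subspace_0[OF sub])
    next
      case (add v w)
      then show ?case
        by (simp add: hom_add[OF lin] hom_add[OF gx(1)] hom_add[OF fx(1)] hom_add[OF g(1)]
            fs.subspace_add[OF sub])
    next
      case (scale c v)
      then show ?case
        by (simp add: hom_scale[OF lin] hom_scale[OF gx(1)] hom_scale[OF fx(1)] hom_scale[OF g(1)]
            fs.subspace_scale[OF sub])
    next
      case (basis q)
      then show ?case using x by simp
    qed
    then show ?thesis
      using lin graded_map_basis_ext[of "gens G (Suc i)" "gdeg F (Suc i)" "gdeg G (Suc i)" s x] x(3)
      by blast
  qed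
qed

section \<open>Tor does not depend on the resolution\<close>

interpretation fv: vector_space "fscale :: 'k::field \<Rightarrow> ('b \<Rightarrow>\<^sub>0 'k) \<Rightarrow> ('b \<Rightarrow>\<^sub>0 'k)"
  by (rule vector_space_fscale)

text \<open>Two exponent vectors add up to zero only if both are zero. So taking constant terms is a
  ring homomorphism, the projection to the residue field.\<close>

lemma lookup_mult_0: "Poly_Mapping.lookup (f * g) 0 = Poly_Mapping.lookup f 0 * Poly_Mapping.lookup g 0"
  for f g :: "('n, 'k::field) mpoly"
proof -
  have "(0 = l + q) = (l = 0 \<and> q = 0)" for l q :: "'n \<Rightarrow>\<^sub>0 nat"
    by (metis add.left_neutral add_is_0 mdeg_add mdeg_eq_0_iff)
  then have "Poly_Mapping.lookup (f * g) 0 =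
      (\<Sum>l. Poly_Mapping.lookup f l * (\<Sum>q. Poly_Mapping.lookup g q when l = 0 when q = 0))"
    by (simp add: lookup_mult when_when)
  also have "\<dots> = (\<Sum>l. Poly_Mapping.lookup f l * Poly_Mapping.lookup g 0 when l = 0)"
    by (simp add: mult_when)
  finally show ?thesis by simp
qed

lemma lookup_to_residue: "Poly_Mapping.lookup (to_residue v) q = Poly_Mapping.lookup (Poly_Mapping.lookup v q) 0"
  unfolding to_residue_def by (simp add: Poly_Mapping.map.rep_eq when_def)

lemma lookup_from_residue:
  "Poly_Mapping.lookup (from_residue w) q = Poly_Mapping.single 0 (Poly_Mapping.lookup w q)"
  unfolding from_residue_def by (simp add: Poly_Mapping.map.rep_eq when_def)

lemma to_residue_zero [simp]: "to_residue 0 = 0"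
  by (rule poly_mapping_eqI) (simp add: lookup_to_residue)

lemma to_residue_add: "to_residue (v + w) = to_residue v + to_residue w"
  by (rule poly_mapping_eqI) (simp add: lookup_to_residue lookup_add)

lemma to_residue_diff: "to_residue (v - w) = to_residue v - to_residue w"
  by (rule poly_mapping_eqI) (simp add: lookup_to_residue lookup_minus)

lemma to_residue_fscale: "to_residue (fscale c v) = fscale (Poly_Mapping.lookup c 0) (to_residue v)"
  by (rule poly_mapping_eqI) (simp add: lookup_to_residue lookup_fscale lookup_mult_0)

lemma from_residue_add: "from_residue (v + w) = from_residue v + from_residue w"
  by (rule poly_mapping_eqI) (simp add: lookup_from_residue lookup_add single_add)

lemma from_residue_fscale: "from_residue (fscale c v) = fscale (Poly_Mapping.single 0 c) (from_residue v)"
  by (rule poly_mapping_eqI) (simp add: lookup_from_residue lookup_fscale mult_single)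

lemma to_residue_from_residue [simp]: "to_residue (from_residue w) = w"
  by (rule poly_mapping_eqI) (simp add: lookup_from_residue lookup_to_residue)

lemma from_residue_bvec [simp]: "from_residue (bvec q) = bvec q"
  by (rule poly_mapping_eqI) (simp add: lookup_from_residue lookup_single when_def)

lemma to_residue_bvec [simp]: "to_residue (bvec q) = bvec q"
  by (rule poly_mapping_eqI) (simp add: lookup_to_residue lookup_single when_def)

lemma to_residue_in_free_on: "v \<in> free_on B \<Longrightarrow> to_residue v \<in> free_on B"
  by (simp add: in_free_on_iff lookup_to_residue)

lemma from_residue_in_free_on: "v \<in> free_on B \<Longrightarrow> from_residue v \<in> free_on B"
  by (simp add: in_free_on_iff lookup_from_residue)

text \<open>Base change of an arbitrary map, so that comparison maps and homotopies can be reduced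
  along with the boundaries.\<close>

definition tens :: "((nat \<Rightarrow>\<^sub>0 ('n, 'k::field) mpoly) \<Rightarrow> (nat \<Rightarrow>\<^sub>0 ('n, 'k) mpoly)) \<Rightarrow>
    (nat \<Rightarrow>\<^sub>0 'k) \<Rightarrow> (nat \<Rightarrow>\<^sub>0 'k)" where
  "tens f w = to_residue (f (from_residue w))"

lemma tensor_bdry_eq_tens: "tensor_bdry F i = tens (bdry F i)"
  by (simp add: fun_eq_iff tensor_bdry_def tens_def)

lemma rlinear_tens:
  assumes "rlinear f"
  shows "rlinear (tens f)"
  by (rule rlinearI)
    (simp_all add: tens_def from_residue_add from_residue_fscale hom_add[OF assms] hom_scale[OF assms]
      to_residue_add to_residue_fscale)

text \<open>A linear map preserves vectors whose entries have no constant term, so it descends to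
  the residue field. This makes \<open>tens\<close> respect composition.\<close>

lemma to_residue_rlinear:
  assumes f: "rlinear f"
  shows "to_residue (f v) = tens f (to_residue v)"
proof -
  have "v \<in> free_on UNIV" by simp
  then show ?thesis
    by (induction rule: free_on_induct)
      (simp_all add: hom_zero[OF f] hom_zero[OF rlinear_tens[OF f]] hom_add[OF f] hom_add[OF rlinear_tens[OF f]]
        hom_scale[OF f] hom_scale[OF rlinear_tens[OF f]] to_residue_add to_residue_fscale,
        simp add: tens_def)
qed

lemma tens_compose: "rlinear f \<Longrightarrow> tens f (tens g w) = to_residue (f (g (from_residue w)))"
  by (simp add: to_residue_rlinear tens_def[of g])

lemma tens_in_free_on:
  assumes "\<And>v. v \<in> free_on B \<Longrightarrow> f v \<in> free_on C" "w \<in> free_on B"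
  shows "tens f w \<in> free_on C"
  unfolding tens_def by (intro to_residue_in_free_on assms from_residue_in_free_on)

lemma homogeneous_from_residue:
  assumes "\<And>q. q \<in> Poly_Mapping.keys w \<Longrightarrow> a q = j"
  shows "homogeneous_vec a j (from_residue w)"
  using assms unfolding homogeneous_vec_def homogeneous_def
  by (auto simp: lookup_from_residue in_keys_iff lookup_single when_def split: if_splits)

text \<open>A constant has degree 0, so in a vector of degree \<open>j\<close> it can only stand at
  a basis vector of degree \<open>j\<close>. This is how degrees are read after base change and why
  linearity will force minimality.\<close>

lemma keys_to_residue_homogeneous:
  assumes "homogeneous_vec a j v" "q \<in> Poly_Mapping.keys (to_residue v)"
  shows "a q = j"
proof -
  have "0 \<in> Poly_Mapping.keys (Poly_Mapping.lookup v q)"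
    using assms(2) by (simp add: in_keys_iff lookup_to_residue)
  then have "int (mdeg (0 :: 'a \<Rightarrow>\<^sub>0 nat)) = j - a q"
    using assms(1) unfolding homogeneous_vec_def homogeneous_def by blast
  then show ?thesis by simp
qed

lemma tens_graded:
  assumes f: "graded_map B a b 0 f" and w: "w \<in> free_on B" "\<And>q. q \<in> Poly_Mapping.keys w \<Longrightarrow> a q = j"
    and q: "q \<in> Poly_Mapping.keys (tens f w)"
  shows "b q = j"
proof (rule keys_to_residue_homogeneous)
  show "q \<in> Poly_Mapping.keys (to_residue (f (from_residue w)))" using q by (simp add: tens_def)
  show "homogeneous_vec b j (f (from_residue w))"
    using graded_mapD[OF f from_residue_in_free_on[OF w(1)] homogeneous_from_residue[OF w(2)]] by simp
qed

section \<open>Dimension of homology after base change\<close>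

lemma free_on_subset_span: "free_on B \<subseteq> fs.span (bvec ` B)"
proof
  fix v :: "nat \<Rightarrow>\<^sub>0 'a" assume "v \<in> free_on B"
  then show "v \<in> fs.span (bvec ` B)"
    by (induction rule: free_on_induct) (auto intro: fs.span_zero fs.span_add fs.span_scale fs.span_base)
qed

text \<open>Rank-nullity for a surjection \<open>a\<close> of \<open>Z\<close> onto
  \<open>free_on C\<close> with section \<open>b\<close>: a basis of the kernel \<open>W\<close>
  together with the vectors \<open>b (bvec c)\<close> is a basis of \<open>Z\<close>. The kernel
  basis is finite because \<open>Z\<close> lies in \<open>free_on B\<close>.\<close>

lemma dim_eq_dim_kernel_plus:
  fixes Z W :: "(nat \<Rightarrow>\<^sub>0 'k::field) set"
  assumes B: "finite B" "Z \<subseteq> free_on B" and C: "finite C"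
    and a: "rlinear a" "\<And>z. z \<in> Z \<Longrightarrow> a z \<in> free_on C"
    and b: "rlinear b" "\<And>c. c \<in> free_on C \<Longrightarrow> b c \<in> Z" "\<And>c. c \<in> free_on C \<Longrightarrow> a (b c) = c"
    and Z: "fs.subspace Z" and W: "\<And>z. z \<in> W \<longleftrightarrow> z \<in> Z \<and> a z = 0"
  shows "fv.dim Z = fv.dim W + card C"
proof -
  have WZ: "W \<subseteq> Z" using W by blast
  obtain BW where BW: "BW \<subseteq> W" "fs.independent BW" "W \<subseteq> fs.span BW" "card BW = fv.dim W"
    by (rule fv.basis_exists[of W])
  have "BW \<subseteq> fs.span (bvec ` B)"
    using BW(1) WZ B(2) free_on_subset_span[of B] by blast
  then have finBW: "finite BW"
    using fv.independent_span_bound[of "bvec ` B" BW] BW(2) B(1) by blast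
  let ?E = "(\<lambda>c. b (bvec c)) ` C"
  have ab: "a (b (bvec c)) = bvec c" if "c \<in> C" for c using b(3) bvec_in_free_on that by blast
  have inj_bvec: "c = c'" if "(bvec c :: nat \<Rightarrow>\<^sub>0 'k) = bvec c'" for c c'
    using arg_cong[OF that, of "\<lambda>v. Poly_Mapping.lookup v c"] by (auto simp: lookup_single when_def split: if_splits)
  have inj: "inj_on (\<lambda>c. b (bvec c)) C"
    by (rule inj_onI) (metis ab inj_bvec)
  have disj: "BW \<inter> ?E = {}"
  proof -
    have "False" if "b (bvec c) \<in> BW" "c \<in> C" for c
    proof -
      have "a (b (bvec c)) = 0" using that BW(1) W by blast
      then have "(bvec c :: nat \<Rightarrow>\<^sub>0 'k) = 0" using ab that by metis
      then have "Poly_Mapping.lookup (bvec c :: nat \<Rightarrow>\<^sub>0 'k) c = 0" by simp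
      then show False by simp
    qed
    then show ?thesis by auto
  qed
  have fin: "finite (BW \<union> ?E)" using finBW C by simp
  have indep: "fs.independent (BW \<union> ?E)"
  proof
    assume "fs.dependent (BW \<union> ?E)"
    then obtain u where u: "\<exists>v\<in>BW \<union> ?E. u v \<noteq> 0" "(\<Sum>v\<in>BW \<union> ?E. fscale (u v) v) = 0"
      using fs.dependent_finite[OF fin] by blast
    have finE: "finite ?E" using C by simp
    have s: "(\<Sum>v\<in>BW. fscale (u v) v) + (\<Sum>v\<in>?E. fscale (u v) v) = 0"
      using u(2) unfolding sum.union_disjoint[OF finBW finE disj] .
    have "a (\<Sum>v\<in>BW. fscale (u v) v) = (\<Sum>v\<in>BW. 0)"
      unfolding hom_sum[OF a(1)] by (rule sum.cong) (use BW(1) W in \<open>auto simp: hom_scale[OF a(1)]\<close>)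
    moreover have "a (\<Sum>v\<in>?E. fscale (u v) v) = (\<Sum>c\<in>C. fscale (u (b (bvec c))) (bvec c))"
      by (simp add: hom_sum[OF a(1)] hom_scale[OF a(1)] sum.reindex[OF inj] ab)
    moreover have "a ((\<Sum>v\<in>BW. fscale (u v) v) + (\<Sum>v\<in>?E. fscale (u v) v)) = 0"
      using s by (simp add: hom_zero[OF a(1)])
    ultimately have z: "(\<Sum>c\<in>C. fscale (u (b (bvec c))) (bvec c)) = 0"
      by (simp add: hom_add[OF a(1)])
    have uE: "u (b (bvec c)) = 0" if "c \<in> C" for c
    proof -
      have "0 = Poly_Mapping.lookup (\<Sum>c\<in>C. fscale (u (b (bvec c))) (bvec c)) c"
        using z by simp
      also have "\<dots> = (\<Sum>c'\<in>C. if c' = c then u (b (bvec c)) else 0)"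
        unfolding lookup_sum by (rule sum.cong) (auto simp: lookup_fscale lookup_single when_def)
      finally show ?thesis using that C by simp
    qed
    then have "(\<Sum>v\<in>?E. fscale (u v) v) = 0"
      by (intro sum.neutral) auto
    then have "(\<Sum>v\<in>BW. fscale (u v) v) = 0" using s by simp
    then have "u v = 0" if "v \<in> BW" for v
      using fs.independentD[OF BW(2) finBW order_refl] that by blast
    then show False using u(1) uE by blast
  qed
  have span: "Z \<subseteq> fs.span (BW \<union> ?E)"
  proof
    fix z assume z: "z \<in> Z"
    \<comment> \<open>The section splits \<open>z\<close> into a kernel part and a part in the image
      of \<open>b\<close>.\<close>
    have "z - b (a z) \<in> W"
      using z a b by (simp add: W fs.subspace_diff[OF Z] hom_diff[OF a(1)])
    then have "z - b (a z) \<in> fs.span (BW \<union> ?E)"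
      using BW(3) fs.span_mono[of BW "BW \<union> ?E"] by blast
    moreover have "b c \<in> fs.span (BW \<union> ?E)" if "c \<in> free_on C" for c
      using that
      by (induction rule: free_on_induct)
        (auto simp: hom_zero[OF b(1)] hom_add[OF b(1)] hom_scale[OF b(1)]
          intro: fs.span_zero fs.span_add fs.span_scale fs.span_base)
    then have "b (a z) \<in> fs.span (BW \<union> ?E)" using a(2) z by blast
    ultimately have "(z - b (a z)) + b (a z) \<in> fs.span (BW \<union> ?E)" by (rule fs.span_add)
    then show "z \<in> fs.span (BW \<union> ?E)" by simp
  qed
  have "BW \<union> ?E \<subseteq> Z" using BW(1) WZ b(2) bvec_in_free_on by blast
  moreover have "card (BW \<union> ?E) = fv.dim W + card C"
    using card_Un_disjoint[OF finBW _ disj] C BW(4) card_image[OF inj] by simp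
  ultimately show ?thesis by (intro fv.dim_unique[OF _ span indep])
qed

text \<open>By minimality the reduced boundaries of \<open>F0\<close> vanish, so its homology in
  degree \<open>i\<close> is all of \<open>free_on (gens F0 i)\<close>. The reduced comparison maps
  then present the homology of \<open>F\<close>: \<open>a\<close> maps the cycles onto this space
  with the boundaries as kernel, and \<open>b\<close> is a section.\<close>

lemma tensor_homology_comparison:
  fixes I :: "('n, 'k::field) mpoly set"
  assumes F: "graded_free_resolution I F" and F0: "graded_free_resolution I F0"
    and min: "minimal_complex F0" and I: "homogeneous_ideal I"
  obtains a b where "rlinear a" "rlinear b"
    "\<And>w. w \<in> tensor_cycles F i \<Longrightarrow> a w \<in> free_on (gens F0 i)"
    "\<And>w. w \<in> free_on (gens F0 i) \<Longrightarrow> b w \<in> tensor_cycles F i"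
    "\<And>w. w \<in> free_on (gens F0 i) \<Longrightarrow> a (b w) = w"
    "\<And>w. w \<in> tensor_boundaries F i \<longleftrightarrow> w \<in> tensor_cycles F i \<and> a w = 0"
    "\<And>w j. w \<in> tensor_cycles F i \<Longrightarrow> w \<in> tensor_degree F i j \<Longrightarrow> a w \<in> tensor_degree F0 i j"
    "\<And>w j. w \<in> free_on (gens F0 i) \<Longrightarrow> w \<in> tensor_degree F0 i j \<Longrightarrow> b w \<in> tensor_degree F i j"
proof -
  note fr = graded_free_resolutionD[OF F] and hr = graded_free_resolutionD[OF F0]
  note fx = exact_resolutionD[OF fr(2)] and hx = exact_resolutionD[OF hr(2)]
  have ideal: "is_ideal I" using I by (simp add: homogeneous_ideal_def)
  have one: "homogeneous 0 (1 :: ('n, 'k) mpoly)" by (simp add: homogeneous_def)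
  obtain \<alpha> where \<alpha>: "chain_map_over 1 I (\<lambda>i. free_on (gens F i)) (bdry F) (augm F)
       (\<lambda>i. free_on (gens F0 i)) (bdry F0) (augm F0) \<alpha>"
    "\<And>i. graded_map (gens F i) (gdeg F i) (gdeg F0 i) 0 (\<alpha> i)"
    using graded_chain_map_exists[OF F F0 I _ one] by auto
  obtain \<beta> where \<beta>: "chain_map_over 1 I (\<lambda>i. free_on (gens F0 i)) (bdry F0) (augm F0)
       (\<lambda>i. free_on (gens F i)) (bdry F) (augm F) \<beta>"
    "\<And>i. graded_map (gens F0 i) (gdeg F0 i) (gdeg F i) 0 (\<beta> i)"
    using graded_chain_map_exists[OF F0 F I _ one] by auto
  note ca = chain_map_overD[OF \<alpha>(1)] and cb = chain_map_overD[OF \<beta>(1)]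
  obtain h where h: "\<And>i. rlinear (h i)" "\<And>i v. v \<in> free_on (gens F i) \<Longrightarrow> h i v \<in> free_on (gens F (Suc i))"
    "\<And>v. v \<in> free_on (gens F 0) \<Longrightarrow> v - \<beta> 0 (\<alpha> 0 v) = bdry F (Suc 0) (h 0 v)"
    "\<And>i v. v \<in> free_on (gens F (Suc i)) \<Longrightarrow>
      v - \<beta> (Suc i) (\<alpha> (Suc i) v) = bdry F (Suc (Suc i)) (h (Suc i) v) + h i (bdry F (Suc i) v)"
    using chain_map_homotopic_id[OF fr(2) ideal projective_summand_free_on
        chain_map_over_compose[OF \<alpha>(1) \<beta>(1) ideal fx(3)]] by blast
  obtain h0 where h0: "\<And>i. rlinear (h0 i)"
    "\<And>i v. v \<in> free_on (gens F0 i) \<Longrightarrow> h0 i v \<in> free_on (gens F0 (Suc i))"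
    "\<And>v. v \<in> free_on (gens F0 0) \<Longrightarrow> v - \<alpha> 0 (\<beta> 0 v) = bdry F0 (Suc 0) (h0 0 v)"
    "\<And>i v. v \<in> free_on (gens F0 (Suc i)) \<Longrightarrow>
      v - \<alpha> (Suc i) (\<beta> (Suc i) v) = bdry F0 (Suc (Suc i)) (h0 (Suc i) v) + h0 i (bdry F0 (Suc i) v)"
    using chain_map_homotopic_id[OF hr(2) ideal projective_summand_free_on
        chain_map_over_compose[OF \<beta>(1) \<alpha>(1) ideal hx(3)]] by blast
  \<comment> \<open>Minimality speaks of residue vectors only; naturality of reduction extends it to
    polynomial vectors.\<close>
  have min0: "to_residue (bdry F0 (Suc j) v) = 0" if "v \<in> free_on (gens F0 (Suc j))" for j v
    using min to_residue_in_free_on[OF that]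
    by (simp add: minimal_complex_def to_residue_rlinear[OF hx(1)] tensor_bdry_eq_tens)
  have cyc: "w \<in> free_on (gens F i)" if "w \<in> tensor_cycles F i" for w
    using that by (simp add: tensor_cycles_def)
  have ab: "tens (\<alpha> i) (tens (\<beta> i) w) = w" if w: "w \<in> free_on (gens F0 i)" for w
  proof -
    let ?v = "from_residue w :: nat \<Rightarrow>\<^sub>0 ('n, 'k) mpoly"
    have v: "?v \<in> free_on (gens F0 i)" by (rule from_residue_in_free_on[OF w])
    \<comment> \<open>Every term of the homotopy contains a boundary of \<open>F0\<close>, which
      reduces to zero. Hence the reduced composite equals the identity, not merely up to
      homotopy.\<close>
    have "to_residue (?v - \<alpha> i (\<beta> i ?v)) = 0"
    proof (cases i)
      case 0
      then show ?thesis using v h0(2,3) min0 by simp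
    next
      case (Suc j)
      then have "to_residue (?v - \<alpha> i (\<beta> i ?v)) =
          to_residue (bdry F0 (Suc (Suc j)) (h0 (Suc j) ?v)) + to_residue (h0 j (bdry F0 (Suc j) ?v))"
        using v h0(4) by (simp add: to_residue_add)
      also have "\<dots> = 0"
        using v Suc h0(2) min0
        by (simp add: to_residue_rlinear[OF h0(1)] hom_zero[OF rlinear_tens[OF h0(1)]])
      finally show ?thesis .
    qed
    then show ?thesis by (simp add: tens_compose[OF ca(1)] to_residue_diff)
  qed
  have bcyc: "tens (\<beta> i) w \<in> tensor_cycles F i" if w: "w \<in> free_on (gens F0 i)" for w
  proof -
    have "tensor_bdry F i (tens (\<beta> i) w) = 0" if "i = Suc j" for j
    proof -
      have "tensor_bdry F i (tens (\<beta> i) w) = to_residue (\<beta> j (bdry F0 (Suc j) (from_residue w)))"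
        using that w by (simp add: tensor_bdry_eq_tens tens_compose[OF fx(1)] cb(4) from_residue_in_free_on)
      also have "\<dots> = 0"
        using that w by (simp add: to_residue_rlinear[OF cb(1)] min0 from_residue_in_free_on
            hom_zero[OF rlinear_tens[OF cb(1)]])
      finally show ?thesis .
    qed
    moreover have "tens (\<beta> i) w \<in> free_on (gens F i)" by (rule tens_in_free_on[OF cb(2) w])
    ultimately show ?thesis unfolding tensor_cycles_def by (cases i) auto
  qed
  have bd_cyc: "w \<in> tensor_cycles F i \<and> tens (\<alpha> i) w = 0" if w: "w \<in> tensor_boundaries F i" for w
  proof -
    obtain x where x: "x \<in> free_on (gens F (Suc i))" "w = tens (bdry F (Suc i)) x"
      using w by (auto simp: tensor_boundaries_def tensor_bdry_eq_tens)
    have x': "(from_residue x :: nat \<Rightarrow>\<^sub>0 ('n, 'k) mpoly) \<in> free_on (gens F (Suc i))"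
      by (rule from_residue_in_free_on[OF x(1)])
    have "w \<in> free_on (gens F i)" unfolding x(2) by (rule tens_in_free_on[OF fx(3) x(1)])
    moreover have "tensor_bdry F i w = 0" if "i = Suc j" for j
      using that x' by (simp add: x(2) tensor_bdry_eq_tens tens_compose[OF fx(1)] fx(8))
    ultimately have "w \<in> tensor_cycles F i" unfolding tensor_cycles_def by (cases i) auto
    moreover have "tens (\<alpha> i) w = 0"
      using x' ca(2) by (simp add: x(2) tens_compose[OF ca(1)] ca(4)[symmetric] min0)
    ultimately show ?thesis ..
  qed
  have cyc_bd: "w \<in> tensor_boundaries F i" if w: "w \<in> tensor_cycles F i" and a0: "tens (\<alpha> i) w = 0" for w
  proof -
    let ?v = "from_residue w :: nat \<Rightarrow>\<^sub>0 ('n, 'k) mpoly"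
    have v: "?v \<in> free_on (gens F i)" by (rule from_residue_in_free_on[OF cyc[OF w]])
    have "to_residue (\<beta> i (\<alpha> i ?v)) = 0"
      using a0 by (simp add: tens_compose[OF cb(1), symmetric] hom_zero[OF rlinear_tens[OF cb(1)]])
    \<comment> \<open>On a cycle the homotopy term through \<open>bdry F i\<close> reduces to zero,
      and the remaining one exhibits \<open>w\<close> as a boundary.\<close>
    then have "w = to_residue (?v - \<beta> i (\<alpha> i ?v))" by (simp add: to_residue_diff)
    also have "\<dots> = to_residue (bdry F (Suc i) (h i ?v))"
    proof (cases i)
      case 0
      then show ?thesis using v h(3) by simp
    next
      case (Suc j)
      then have "to_residue (bdry F (Suc j) ?v) = 0"
        using w by (simp add: tensor_cycles_def tensor_bdry_def)
      then show ?thesis using v h(4) Suc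
        by (simp add: to_residue_add to_residue_rlinear[OF h(1)] hom_zero[OF rlinear_tens[OF h(1)]])
    qed
    also have "\<dots> = tensor_bdry F (Suc i) (to_residue (h i ?v))"
      by (simp add: to_residue_rlinear[OF fx(1)] tensor_bdry_eq_tens)
    finally show ?thesis
      unfolding tensor_boundaries_def using h(2)[OF v] to_residue_in_free_on by blast
  qed
  show ?thesis
  proof (rule that[of "tens (\<alpha> i)" "tens (\<beta> i)"])
    show "tens (\<alpha> i) w \<in> free_on (gens F0 i)" if "w \<in> tensor_cycles F i" for w
      by (rule tens_in_free_on[OF ca(2) cyc[OF that]])
    show "tens (\<alpha> i) w \<in> tensor_degree F0 i j" if "w \<in> tensor_cycles F i" "w \<in> tensor_degree F i j" for w j
      using tens_graded[OF \<alpha>(2) cyc[OF that(1)]] that(2) by (auto simp: tensor_degree_def)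
    show "tens (\<beta> i) w \<in> tensor_degree F i j" if "w \<in> free_on (gens F0 i)" "w \<in> tensor_degree F0 i j" for w j
      using tens_graded[OF \<beta>(2) that(1)] that(2) by (auto simp: tensor_degree_def)
  qed (use rlinear_tens ca(1) cb(1) ab bcyc bd_cyc cyc_bd in blast)+
qed

lemma tensor_cycles_eq_vimage:
  "tensor_cycles F i = free_on (gens F i) \<inter> {w. i = 0 \<or> tensor_bdry F i w = 0}"
  by (auto simp: tensor_cycles_def)

lemma subspace_tensor_cycles:
  assumes "graded_free_resolution I F"
  shows "fs.subspace (tensor_cycles F i)"
proof (cases i)
  case 0
  then show ?thesis by (simp add: tensor_cycles_def subspace_free_on)
next
  case (Suc j)
  have "rlinear (tensor_bdry F (Suc j))"
    unfolding tensor_bdry_eq_tens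
    by (rule rlinear_tens[OF exact_resolutionD(1)[OF graded_free_resolutionD(2)[OF assms]]])
  from fs.subspace_inter[OF subspace_free_on module_hom.subspace_kernel[OF this]] show ?thesis
    by (simp add: Suc tensor_cycles_eq_vimage)
qed

lemma tensor_degree_eq_free_on: "tensor_degree F i j = free_on {q. gdeg F i q = j}"
  by (auto simp: tensor_degree_def free_on_def)

text \<open>The resolution behind \<open>tor_dim\<close> is an arbitrary choice, possible because
  \<open>F0\<close> exists. Comparing it with \<open>F0\<close> fixes the difference of the two
  dimensions; for the graded version the same maps are restricted to degree
  \<open>j\<close>.\<close>

lemma tor_dim_eq_card_gens:
  assumes F0: "graded_free_resolution I F0" and min: "minimal_complex F0" and I: "homogeneous_ideal I"
  shows "tor_dim I i = card (gens F0 i)"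
    and "graded_tor_dim I i j = card {q \<in> gens F0 i. gdeg F0 i q = j}"
proof -
  define F where "F = chosen_resolution I"
  have F: "graded_free_resolution I F"
    unfolding F_def chosen_resolution_def by (rule someI[of _ F0]) (rule F0)
  have "tor_dim I i = card (gens F0 i) \<and> graded_tor_dim I i j = card {q \<in> gens F0 i. gdeg F0 i q = j}"
  proof (rule tensor_homology_comparison[OF F F0 min I, of i])
    fix a b :: "(nat \<Rightarrow>\<^sub>0 'b) \<Rightarrow> (nat \<Rightarrow>\<^sub>0 'b)" assume ab: "rlinear a" "rlinear b"
      "\<And>w. w \<in> tensor_cycles F i \<Longrightarrow> a w \<in> free_on (gens F0 i)"
      "\<And>w. w \<in> free_on (gens F0 i) \<Longrightarrow> b w \<in> tensor_cycles F i"
      "\<And>w. w \<in> free_on (gens F0 i) \<Longrightarrow> a (b w) = w"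
      "\<And>w. w \<in> tensor_boundaries F i \<longleftrightarrow> w \<in> tensor_cycles F i \<and> a w = 0"
      "\<And>w j. w \<in> tensor_cycles F i \<Longrightarrow> w \<in> tensor_degree F i j \<Longrightarrow> a w \<in> tensor_degree F0 i j"
      "\<And>w j. w \<in> free_on (gens F0 i) \<Longrightarrow> w \<in> tensor_degree F0 i j \<Longrightarrow> b w \<in> tensor_degree F i j"
    have fin: "finite (gens F i)" "finite (gens F0 i)"
      using graded_free_resolutionD(1) F F0 by blast+
    have cyc: "tensor_cycles F i \<subseteq> free_on (gens F i)" by (auto simp: tensor_cycles_def)
    have "fv.dim (tensor_cycles F i) = fv.dim (tensor_boundaries F i) + card (gens F0 i)"
      by (rule dim_eq_dim_kernel_plus[OF fin(1) cyc fin(2) ab(1,3,2,4,5) subspace_tensor_cycles[OF F] ab(6)])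
    then have 1: "tor_dim I i = card (gens F0 i)"
      by (simp add: tor_dim_def F_def[symmetric] Let_def)
    let ?C = "{q \<in> gens F0 i. gdeg F0 i q = j}"
    have C: "free_on ?C = free_on (gens F0 i) \<inter> tensor_degree F0 i j"
      by (auto simp: tensor_degree_eq_free_on free_on_def)
    have "fv.dim (tensor_cycles F i \<inter> tensor_degree F i j) =
        fv.dim (tensor_boundaries F i \<inter> tensor_degree F i j) + card ?C"
    proof (rule dim_eq_dim_kernel_plus[OF fin(1) _ _ ab(1) _ ab(2)])
      show "fs.subspace (tensor_cycles F i \<inter> tensor_degree F i j)"
        unfolding tensor_degree_eq_free_on
        by (intro fs.subspace_inter subspace_free_on subspace_tensor_cycles[OF F])
    qed (use cyc fin ab C in auto)
    then have "graded_tor_dim I i j = card ?C"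
      by (simp add: graded_tor_dim_def F_def[symmetric] Let_def)
    with 1 show "tor_dim I i = card (gens F0 i) \<and> graded_tor_dim I i j = card ?C" ..
  qed
  then show "tor_dim I i = card (gens F0 i)" "graded_tor_dim I i j = card {q \<in> gens F0 i. gdeg F0 i q = j}"
    by blast+
qed

text \<open>For the lower bound, suppose a projective resolution has length p < n. Comparison maps
  through it vanish in degree \<open>n\<close>, so the homotopy writes a basis vector of degree
  \<open>n\<close> as a sum of terms that reduce to zero, while the basis vector itself does
  not.\<close>

lemma proj_dim_eqI:
  assumes F0: "graded_free_resolution I F0" and min: "minimal_complex F0" and I: "is_ideal I"
    and ne: "gens F0 n \<noteq> {}" and above: "\<And>i. i > n \<Longrightarrow> gens F0 i = {}"
  shows "proj_dim I = enat n"
proof -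
  note hr = graded_free_resolutionD[OF F0]
  note hx = exact_resolutionD[OF hr(2)]
  have "has_projective_resolution I n"
    unfolding has_projective_resolution_def
    using hr(2) projective_summand_free_on above by (intro exI conjI) auto
  moreover have "n \<le> p" if p: "has_projective_resolution I p" for p
  proof (rule ccontr)
    assume "\<not> n \<le> p"
    obtain P bd aug where P: "exact_resolution I P bd aug" "\<And>i. projective_summand (P i)"
      "\<And>i. i > p \<Longrightarrow> P i = {0}"
      using p by (auto simp: has_projective_resolution_def)
    note px = exact_resolutionD[OF P(1)]
    note proj = projective_summand_free_on
    obtain \<alpha> where \<alpha>: "chain_map_over 1 I (\<lambda>i. free_on (gens F0 i)) (bdry F0) (augm F0) P bd aug \<alpha>"
      using chain_map_over_exists_projective[OF hr(2) P(1) I _ proj projective_summand_subspace[OF P(2)]]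
      by (metis mult_1)
    obtain \<beta> where \<beta>: "chain_map_over 1 I P bd aug (\<lambda>i. free_on (gens F0 i)) (bdry F0) (augm F0) \<beta>"
      using chain_map_over_exists_projective[OF P(1) hr(2) I _ P(2) subspace_free_on] by (metis mult_1)
    note ca = chain_map_overD[OF \<alpha>] and cb = chain_map_overD[OF \<beta>]
    obtain h where h: "\<And>i. rlinear (h i)"
      "\<And>i v. v \<in> free_on (gens F0 i) \<Longrightarrow> h i v \<in> free_on (gens F0 (Suc i))"
      "\<And>i v. v \<in> free_on (gens F0 (Suc i)) \<Longrightarrow>
        v - \<beta> (Suc i) (\<alpha> (Suc i) v) = bdry F0 (Suc (Suc i)) (h (Suc i) v) + h i (bdry F0 (Suc i) v)"
      using chain_map_homotopic_id[OF hr(2) I proj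
          chain_map_over_compose[OF \<alpha> \<beta> I hx(3)]] by blast
    \<comment> \<open>\<open>n\<close> exceeds \<open>p\<close>, hence is positive, and the homotopy
      formula for positive degrees applies.\<close>
    obtain m where m: "n = Suc m" using \<open>\<not> n \<le> p\<close> by (cases n) auto
    obtain q where q: "q \<in> gens F0 (Suc m)" using ne m by blast
    let ?v = "bvec q :: nat \<Rightarrow>\<^sub>0 ('a, 'b) mpoly"
    have v: "?v \<in> free_on (gens F0 (Suc m))" by (rule bvec_in_free_on[OF q])
    have min0: "to_residue (bdry F0 (Suc j) v) = 0" if "v \<in> free_on (gens F0 (Suc j))" for j v
      using min to_residue_in_free_on[OF that]
      by (simp add: minimal_complex_def to_residue_rlinear[OF hx(1)] tensor_bdry_eq_tens)
    have "\<alpha> (Suc m) ?v = 0" using ca(2)[OF v] P(3) m \<open>\<not> n \<le> p\<close> by auto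
    then have "?v = bdry F0 (Suc (Suc m)) (h (Suc m) ?v) + h m (bdry F0 (Suc m) ?v)"
      using h(3)[OF v] by (simp add: hom_zero[OF cb(1)])
    then have "to_residue ?v = to_residue (bdry F0 (Suc (Suc m)) (h (Suc m) ?v)) + to_residue (h m (bdry F0 (Suc m) ?v))"
      by (metis to_residue_add)
    also have "\<dots> = 0"
      using v h(2) min0 by (simp add: to_residue_rlinear[OF h(1)] hom_zero[OF rlinear_tens[OF h(1)]])
    finally have "Poly_Mapping.lookup (bvec q :: nat \<Rightarrow>\<^sub>0 'b) q = 0" by simp
    then show False by simp
  qed
  ultimately show ?thesis unfolding proj_dim_def
    by (intro antisym Inf_lower Inf_greatest) auto
qed

section \<open>Mapping cones\<close>

text \<open>All free modules live on basis \<open>nat\<close>, so a direct sum is encoded by giving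
  the even indices to one summand and the odd indices to the other.\<close>

lift_definition interleave :: "(nat \<Rightarrow>\<^sub>0 'a::zero) \<Rightarrow> (nat \<Rightarrow>\<^sub>0 'a) \<Rightarrow> (nat \<Rightarrow>\<^sub>0 'a)"
  is "\<lambda>f g q. if even q then f (q div 2) else g (q div 2)"
proof -
  fix f g :: "nat \<Rightarrow> 'a"
  assume "finite {q. f q \<noteq> 0}" "finite {q. g q \<noteq> 0}"
  then have "finite ((\<lambda>q. 2 * q) ` {q. f q \<noteq> 0} \<union> (\<lambda>q. 2 * q + 1) ` {q. g q \<noteq> 0})" by simp
  then show "finite {q. (if even q then f (q div 2) else g (q div 2)) \<noteq> 0}"
  proof (rule rev_finite_subset)
    show "{q. (if even q then f (q div 2) else g (q div 2)) \<noteq> 0} \<subseteq>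
        (\<lambda>q. 2 * q) ` {q. f q \<noteq> 0} \<union> (\<lambda>q. 2 * q + 1) ` {q. g q \<noteq> 0}"
    proof
      fix q assume "q \<in> {q. (if even q then f (q div 2) else g (q div 2)) \<noteq> 0}"
      then show "q \<in> (\<lambda>q. 2 * q) ` {q. f q \<noteq> 0} \<union> (\<lambda>q. 2 * q + 1) ` {q. g q \<noteq> 0}"
        by (cases "even q") (auto elim!: evenE oddE)
    qed
  qed
qed

lift_definition evens :: "(nat \<Rightarrow>\<^sub>0 'a::zero) \<Rightarrow> (nat \<Rightarrow>\<^sub>0 'a)" is "\<lambda>v q. v (2 * q)"
proof -
  fix v :: "nat \<Rightarrow> 'a" assume "finite {q. v q \<noteq> 0}"
  from finite_vimageI[OF this, of "\<lambda>q. 2 * q"] show "finite {q. v (2 * q) \<noteq> 0}"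
    by (simp add: inj_on_def vimage_def)
qed

lift_definition odds :: "(nat \<Rightarrow>\<^sub>0 'a::zero) \<Rightarrow> (nat \<Rightarrow>\<^sub>0 'a)" is "\<lambda>v q. v (2 * q + 1)"
proof -
  fix v :: "nat \<Rightarrow> 'a" assume "finite {q. v q \<noteq> 0}"
  from finite_vimageI[OF this, of "\<lambda>q. 2 * q + 1"] show "finite {q. v (2 * q + 1) \<noteq> 0}"
    by (simp add: inj_on_def vimage_def)
qed

lemma lookup_interleave: "Poly_Mapping.lookup (interleave f g) q =
    (if even q then Poly_Mapping.lookup f (q div 2) else Poly_Mapping.lookup g (q div 2))"
  by transfer simp

lemma lookup_evens: "Poly_Mapping.lookup (evens v) q = Poly_Mapping.lookup v (2 * q)"
  by transfer simp

lemma lookup_odds: "Poly_Mapping.lookup (odds v) q = Poly_Mapping.lookup v (2 * q + 1)"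
  by transfer simp

lemma evens_interleave [simp]: "evens (interleave f g) = f"
  by (rule poly_mapping_eqI) (simp add: lookup_evens lookup_interleave)

lemma odds_interleave [simp]: "odds (interleave f g) = g"
  by (rule poly_mapping_eqI) (simp add: lookup_odds lookup_interleave)

lemma interleave_evens_odds [simp]: "interleave (evens v) (odds v) = v"
  by (rule poly_mapping_eqI) (simp add: lookup_interleave lookup_evens lookup_odds)

lemma interleave_eq_iff: "interleave f g = v \<longleftrightarrow> f = evens v \<and> g = odds v"
  by auto

lemma evens_0 [simp]: "evens 0 = 0" and odds_0 [simp]: "odds 0 = 0"
  by (rule poly_mapping_eqI, simp add: lookup_evens lookup_odds)+

lemma rlinear_evens: "rlinear evens" and rlinear_odds: "rlinear odds"
  by (rule rlinearI; rule poly_mapping_eqI; simp add: lookup_evens lookup_odds lookup_add lookup_fscale)+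

lemma interleave_add: "interleave (f + f') (g + g') = interleave f g + interleave f' g'"
  by (rule poly_mapping_eqI) (simp add: lookup_interleave lookup_add)

lemma interleave_fscale: "interleave (fscale c f) (fscale c g) = fscale c (interleave f g)"
  by (rule poly_mapping_eqI) (simp add: lookup_interleave lookup_fscale)

lemma rlinear_interleave:
  assumes "rlinear f" "rlinear g"
  shows "rlinear (\<lambda>v. interleave (f v) (g v))"
  by (rule rlinearI)
    (simp_all add: hom_add[OF assms(1)] hom_add[OF assms(2)] hom_scale[OF assms(1)] hom_scale[OF assms(2)]
      interleave_add interleave_fscale)

lemma free_on_interleaved_iff:
  "v \<in> free_on ((\<lambda>q. 2 * q) ` A \<union> (\<lambda>q. 2 * q + 1) ` B) \<longleftrightarrow> evens v \<in> free_on A \<and> odds v \<in> free_on B"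
  (is "v \<in> free_on ?C \<longleftrightarrow> _")
proof -
  have *: "2 * q \<in> ?C \<longleftrightarrow> q \<in> A" "2 * q + 1 \<in> ?C \<longleftrightarrow> q \<in> B" for q
    by (auto, presburger+)
  show ?thesis
  proof
    assume "v \<in> free_on ?C"
    then show "evens v \<in> free_on A \<and> odds v \<in> free_on B"
      unfolding in_free_on_iff lookup_evens lookup_odds using * by blast
  next
    assume r: "evens v \<in> free_on A \<and> odds v \<in> free_on B"
    show "v \<in> free_on ?C" unfolding in_free_on_iff
    proof (intro allI impI)
      fix q assume q: "q \<notin> ?C"
      show "Poly_Mapping.lookup v q = 0"
      proof (cases "even q")
        case True
        then obtain p where "q = 2 * p" by (elim evenE)
        then show ?thesis using r q *(1)[of p] by (auto simp: in_free_on_iff lookup_evens)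
      next
        case False
        then obtain p where "q = 2 * p + 1" by (elim oddE)
        then show ?thesis using r q *(2)[of p] by (auto simp: in_free_on_iff lookup_odds)
      qed
    qed
  qed
qed

definition shifted_gens :: "('n, 'k::zero) graded_free_complex \<Rightarrow> nat \<Rightarrow> nat set" where
  "shifted_gens G i = (case i of 0 \<Rightarrow> {} | Suc j \<Rightarrow> gens G j)"

text \<open>The sign makes the cone a complex. The value 0 in degree 1 reflects that the generators
  of \<open>G\<close> in degree 0 are mapped into \<open>F\<close> alone.\<close>

definition shifted_bdry ::
  "('n, 'k::field) graded_free_complex \<Rightarrow> nat \<Rightarrow> (nat \<Rightarrow>\<^sub>0 ('n, 'k) mpoly) \<Rightarrow> (nat \<Rightarrow>\<^sub>0 ('n, 'k) mpoly)" where
  "shifted_bdry G i v = (case i of Suc (Suc j) \<Rightarrow> - bdry G (Suc j) v | _ \<Rightarrow> 0)"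

text \<open>Even indices carry \<open>F\<close>, odd ones carry \<open>G\<close> moved up by one
  homological degree and twisted by \<open>s\<close>. In degree 0 the truncated \<open>i - 1\<close>
  meets no generator, since \<open>shifted_gens G 0\<close> is empty.\<close>

definition cone :: "int \<Rightarrow> (nat \<Rightarrow> (nat \<Rightarrow>\<^sub>0 ('n, 'k) mpoly) \<Rightarrow> (nat \<Rightarrow>\<^sub>0 ('n, 'k) mpoly)) \<Rightarrow>
    ('n, 'k) graded_free_complex \<Rightarrow> ('n, 'k::field) graded_free_complex \<Rightarrow> ('n, 'k) graded_free_complex" where
  "cone s \<phi> G F =
     \<lparr>gens = (\<lambda>i. (\<lambda>q. 2 * q) ` gens F i \<union> (\<lambda>q. 2 * q + 1) ` shifted_gens G i),
      gdeg = (\<lambda>i q. if even q then gdeg F i (q div 2) else gdeg G (i - 1) (q div 2) + s),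
      bdry = (\<lambda>i v. interleave (bdry F i (evens v) + \<phi> (i - 1) (odds v)) (shifted_bdry G i (odds v))),
      augm = (\<lambda>v. augm F (evens v))\<rparr>"

lemma in_free_on_cone_iff:
  "v \<in> free_on (gens (cone s \<phi> G F) i) \<longleftrightarrow>
     evens v \<in> free_on (gens F i) \<and> odds v \<in> free_on (shifted_gens G i)"
  unfolding cone_def graded_free_complex.simps by (rule free_on_interleaved_iff)

lemma homogeneous_vec_cone_iff:
  "homogeneous_vec (gdeg (cone s \<phi> G F) i) j v \<longleftrightarrow>
     homogeneous_vec (gdeg F i) j (evens v) \<and> homogeneous_vec (gdeg G (i - 1)) (j - s) (odds v)"
  (is "?L \<longleftrightarrow> ?R")
proof
  assume L: ?L
  have "homogeneous (j - gdeg F i q) (Poly_Mapping.lookup (evens v) q)" for q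
    using L unfolding homogeneous_vec_def by (auto simp: cone_def lookup_evens dest: spec[of _ "2 * q"])
  moreover have "homogeneous (j - s - gdeg G (i - 1) q) (Poly_Mapping.lookup (odds v) q)" for q
    using L unfolding homogeneous_vec_def
    by (auto simp: cone_def lookup_odds algebra_simps dest: spec[of _ "2 * q + 1"])
  ultimately show ?R by (simp add: homogeneous_vec_def)
next
  assume R: ?R
  have "homogeneous (j - gdeg (cone s \<phi> G F) i q) (Poly_Mapping.lookup v q)" for q
  proof (cases "even q")
    case True
    then obtain p where "q = 2 * p" by (elim evenE)
    then show ?thesis using R by (auto simp: homogeneous_vec_def cone_def lookup_evens)
  next
    case False
    then obtain p where p: "q = 2 * p + 1" by (elim oddE)
    have "homogeneous (j - s - gdeg G (i - 1) p) (Poly_Mapping.lookup v (2 * p + 1))"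
      using R by (auto simp: homogeneous_vec_def lookup_odds)
    moreover have "j - s - gdeg G (i - 1) p = j - (gdeg G (i - 1) p + s)" by simp
    ultimately have "homogeneous (j - (gdeg G (i - 1) p + s)) (Poly_Mapping.lookup v (2 * p + 1))"
      by metis
    then show ?thesis using p by (simp add: cone_def)
  qed
  then show ?L by (simp add: homogeneous_vec_def)
qed

text \<open>The set in the conclusion is I + (u), and \<open>J\<close> is I : u. Multiplication by
  \<open>u\<close> gives the short exact sequence 0 -> R/J -> R/I -> R/(I + (u)) -> 0, whose last
  term is resolved by the cone of a lift of the first map.\<close>

lemma exact_resolution_cone:
  fixes u :: "('n, 'k::field) mpoly"
  assumes F: "graded_free_resolution I F" and G: "graded_free_resolution J G"
    and I: "is_ideal I" and J: "\<And>f. f \<in> J \<longleftrightarrow> u * f \<in> I"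
    and \<phi>: "chain_map_over u I (\<lambda>i. free_on (gens G i)) (bdry G) (augm G)
       (\<lambda>i. free_on (gens F i)) (bdry F) (augm F) \<phi>"
  shows "exact_resolution {f. \<exists>c. f - c * u \<in> I} (\<lambda>i. free_on (gens (cone s \<phi> G F) i))
     (bdry (cone s \<phi> G F)) (augm (cone s \<phi> G F))"
proof -
  note fr = graded_free_resolutionD[OF F] and gr = graded_free_resolutionD[OF G]
  note fx = exact_resolutionD[OF fr(2)] and gx = exact_resolutionD[OF gr(2)]
  note c = chain_map_overD[OF \<phi>] and il = is_idealD[OF I]
  note sub = fs.subspace_add[OF subspace_free_on] fs.subspace_neg[OF subspace_free_on]
    fs.subspace_0[OF subspace_free_on]
  let ?C = "cone s \<phi> G F" and ?I' = "{f. \<exists>c. f - c * u \<in> I}"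
  have bd1: "bdry ?C (Suc 0) v = interleave (bdry F (Suc 0) (evens v) + \<phi> 0 (odds v)) 0" for v
    by (simp add: cone_def shifted_bdry_def)
  have bd2: "bdry ?C (Suc (Suc i)) v = interleave (bdry F (Suc (Suc i)) (evens v) + \<phi> (Suc i) (odds v))
      (- bdry G (Suc i) (odds v))" for v i
    by (simp add: cone_def shifted_bdry_def)
  have sh [simp]: "shifted_gens G 0 = {}" "shifted_gens G (Suc i) = gens G i" for i
    by (simp_all add: shifted_gens_def)
  have aug: "augm ?C v = augm F (evens v)" for v by (simp add: cone_def)
  note rl = rlinear_compose[OF fx(1) rlinear_evens] rlinear_compose[OF c(1) rlinear_odds]
    rlinear_compose[OF gx(1) rlinear_odds]
  \<comment> \<open>Injectivity of multiplication by \<open>u\<close> from R/J to R/I; this is where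
    exactness in degree 1 of the cone comes from.\<close>
  have colon: "g \<in> bdry G (Suc 0) ` free_on (gens G (Suc 0))"
    if g: "g \<in> free_on (gens G 0)" "augm F (\<phi> 0 g) \<in> I" for g
  proof (rule gx(5)[OF g(1)])
    have "u * augm G g \<in> I" using il(2)[OF c(3)[OF g(1)] g(2)] by simp
    then show "augm G g \<in> J" using J by simp
  qed
  text \<open>If the \<open>G\<close>-part \<open>g\<close> of a cycle is the boundary of \<open>g'\<close>, then subtracting the boundary of
    \<open>- g'\<close> leaves a cycle of \<open>F\<close>.\<close>
  have preimage: "v \<in> bdry ?C (Suc (Suc i)) ` free_on (gens ?C (Suc (Suc i)))"
    if v: "evens v \<in> free_on (gens F (Suc i))" "odds v = bdry G (Suc i) g'" "g' \<in> free_on (gens G (Suc i))"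
      "bdry F (Suc i) (evens v) + \<phi> i (odds v) = 0" for v g' i
  proof -
    have "bdry F (Suc i) (evens v + \<phi> (Suc i) g') = 0"
      using v(4) by (simp add: hom_add[OF fx(1)] c(4)[OF v(3)] v(2))
    moreover have "evens v + \<phi> (Suc i) g' \<in> free_on (gens F (Suc i))"
      by (intro sub v(1) c(2) v(3))
    ultimately obtain f where f: "f \<in> free_on (gens F (Suc (Suc i)))"
      "evens v + \<phi> (Suc i) g' = bdry F (Suc (Suc i)) f" using fx(7) by blast
    have "v = interleave (evens v) (odds v)" by simp
    also have "evens v = bdry F (Suc (Suc i)) f + \<phi> (Suc i) (- g')"
      using f(2) by (simp add: hom_neg[OF c(1)] eq_diff_eq)
    also have "odds v = - bdry G (Suc i) (- g')"
      using v(2) by (simp add: hom_neg[OF gx(1)])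
    finally have "v = bdry ?C (Suc (Suc i)) (interleave f (- g'))" by (simp add: bd2)
    moreover have "interleave f (- g') \<in> free_on (gens ?C (Suc (Suc i)))"
      using f(1) v(3) by (simp add: in_free_on_cone_iff sub)
    ultimately show ?thesis by blast
  qed
  have bdlin: "rlinear (bdry ?C (Suc i))" for i
  proof (cases i)
    case 0
    have "rlinear (\<lambda>v. interleave (bdry F (Suc 0) (evens v) + \<phi> 0 (odds v)) 0)"
      by (intro rlinear_interleave fs2.module_hom_add rl fs2.module_hom_zero)
    then show ?thesis by (simp add: 0 bd1[abs_def])
  next
    case (Suc j)
    have "rlinear (\<lambda>v. interleave (bdry F (Suc (Suc j)) (evens v) + \<phi> (Suc j) (odds v)) (- bdry G (Suc j) (odds v)))"
      by (intro rlinear_interleave fs2.module_hom_add fs2.module_hom_neg rl)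
    then show ?thesis by (simp add: Suc bd2[abs_def])
  qed
  have into: "bdry ?C (Suc i) v \<in> free_on (gens ?C i)" if "v \<in> free_on (gens ?C (Suc i))" for i v
  proof (cases i)
    case 0
    then show ?thesis using that fx(3) c(2) by (simp add: in_free_on_cone_iff bd1 sub)
  next
    case (Suc j)
    then show ?thesis using that fx(3) c(2) gx(3) by (simp add: in_free_on_cone_iff bd2 sub)
  qed
  have surj: "\<exists>v\<in>free_on (gens ?C 0). f - augm ?C v \<in> ?I'" for f
  proof -
    obtain v where v: "v \<in> free_on (gens F 0)" "f - augm F v \<in> I" using fx(4) by blast
    then have "interleave v 0 \<in> free_on (gens ?C 0)" "f - augm ?C (interleave v 0) - 0 * u \<in> I"
      by (simp_all add: in_free_on_cone_iff aug)
    then show ?thesis by blast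
  qed
  have ex0: "{v \<in> free_on (gens ?C 0). augm ?C v \<in> ?I'} = bdry ?C 1 ` free_on (gens ?C 1)"
  proof (intro equalityI subsetI)
    fix v assume "v \<in> {v \<in> free_on (gens ?C 0). augm ?C v \<in> ?I'}"
    then obtain b where v: "evens v \<in> free_on (gens F 0)" "odds v = 0" "augm F (evens v) - b * u \<in> I"
      by (auto simp: in_free_on_cone_iff aug)
    \<comment> \<open>The augmentation of \<open>v\<close> is \<open>b * u\<close> modulo
      \<open>I\<close>. Lifting \<open>b\<close> to \<open>g\<close> and subtracting
      \<open>\<phi> 0 g\<close> moves it into \<open>I\<close>, where exactness of \<open>F\<close>
      applies.\<close>
    obtain g where g: "g \<in> free_on (gens G 0)" "b - augm G g \<in> J" using gx(4) by blast
    have "u * (b - augm G g) \<in> I" using g J by blast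
    from il(2)[OF il(2)[OF v(3) this] c(3)[OF g(1)]]
    have "augm F (evens v - \<phi> 0 g) \<in> I"
      by (simp add: hom_diff[OF fx(2)] right_diff_distrib mult.commute)
    moreover have "evens v - \<phi> 0 g \<in> free_on (gens F 0)"
      using fs.subspace_diff[OF subspace_free_on v(1) c(2)[OF g(1)]] .
    ultimately obtain f where f: "f \<in> free_on (gens F (Suc 0))" "evens v - \<phi> 0 g = bdry F (Suc 0) f"
      using fx(5) by blast
    have "v = interleave (evens v) (odds v)" by simp
    also have "\<dots> = bdry ?C 1 (interleave f g)"
      using f(2) v(2) by (simp add: bd1 diff_eq_eq)
    finally have "v = bdry ?C 1 (interleave f g)" .
    moreover have "interleave f g \<in> free_on (gens ?C 1)"
      using f(1) g(1) by (simp add: in_free_on_cone_iff)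
    ultimately show "v \<in> bdry ?C 1 ` free_on (gens ?C 1)" by blast
  next
    fix v assume "v \<in> bdry ?C 1 ` free_on (gens ?C 1)"
    then obtain w where w: "evens w \<in> free_on (gens F (Suc 0))" "odds w \<in> free_on (gens G 0)"
      "w \<in> free_on (gens ?C (Suc 0))" "v = bdry ?C (Suc 0) w"
      by (auto simp: in_free_on_cone_iff)
    have "augm F (bdry F (Suc 0) (evens w)) - (u * augm G (odds w) - augm F (\<phi> 0 (odds w))) \<in> I"
      by (rule il(5)[OF fx(6)[OF w(1)] c(3)[OF w(2)]])
    then have "augm ?C v - augm G (odds w) * u \<in> I"
      by (simp add: w(4) bd1 aug hom_add[OF fx(2)] algebra_simps)
    then show "v \<in> {v \<in> free_on (gens ?C 0). augm ?C v \<in> ?I'}"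
      using into[OF w(3)] w(4) by blast
  qed
  have exS: "{v \<in> free_on (gens ?C (Suc i)). bdry ?C (Suc i) v = 0} =
      bdry ?C (Suc (Suc i)) ` free_on (gens ?C (Suc (Suc i)))" for i
  proof (intro equalityI subsetI)
    fix v assume "v \<in> {v \<in> free_on (gens ?C (Suc i)). bdry ?C (Suc i) v = 0}"
    then have v: "evens v \<in> free_on (gens F (Suc i))" "odds v \<in> free_on (gens G i)"
      "bdry ?C (Suc i) v = 0" by (auto simp: in_free_on_cone_iff)
    have cyc: "bdry F (Suc i) (evens v) + \<phi> i (odds v) = 0"
      using v(3) by (cases i) (auto simp: bd1 bd2 interleave_eq_iff)
    have "odds v \<in> bdry G (Suc i) ` free_on (gens G (Suc i))"
    proof (cases i)
      case [simp]: 0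
      have "\<phi> 0 (odds v) = - bdry F (Suc 0) (evens v)" using cyc by (simp add: eq_neg_iff_add_eq_0 add.commute)
      then have "augm F (\<phi> 0 (odds v)) = - augm F (bdry F (Suc 0) (evens v))"
        by (simp add: hom_neg[OF fx(2)])
      then have "augm F (\<phi> 0 (odds v)) \<in> I" using il(4)[OF fx(6)] v(1) by simp
      then show ?thesis using colon v(2) by simp
    next
      case (Suc j)
      then have "bdry G (Suc j) (odds v) = 0" using v(3) by (auto simp: bd2 interleave_eq_iff)
      then show ?thesis using gx(7) v(2) Suc by simp
    qed
    then obtain g' where "odds v = bdry G (Suc i) g'" "g' \<in> free_on (gens G (Suc i))" by blast
    from preimage[OF v(1) this cyc]
    show "v \<in> bdry ?C (Suc (Suc i)) ` free_on (gens ?C (Suc (Suc i)))" .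
  next
    fix v assume "v \<in> bdry ?C (Suc (Suc i)) ` free_on (gens ?C (Suc (Suc i)))"
    then obtain w where w: "evens w \<in> free_on (gens F (Suc (Suc i)))" "odds w \<in> free_on (gens G (Suc i))"
      "w \<in> free_on (gens ?C (Suc (Suc i)))" "v = bdry ?C (Suc (Suc i)) w"
      by (auto simp: in_free_on_cone_iff)
    have "bdry F (Suc i) (evens v) + \<phi> i (odds v) = 0"
      by (simp add: w(4) bd2 hom_add[OF fx(1)] hom_neg[OF c(1)] fx(8)[OF w(1)] c(4)[OF w(2)])
    moreover have "bdry G (Suc j) (odds v) = 0" if "i = Suc j" for j
      using gx(8) w(2) that by (simp add: w(4) bd2 hom_neg[OF gx(1)])
    ultimately have "bdry ?C (Suc i) v = 0"
      by (cases i) (auto simp: bd1 bd2 interleave_eq_iff)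
    then show "v \<in> {v \<in> free_on (gens ?C (Suc i)). bdry ?C (Suc i) v = 0}"
      using into[OF w(3)] w(4) by blast
  qed
  have auglin: "rform (augm ?C)"
    using rform_compose[OF fx(2) rlinear_evens] by (simp add: cone_def)
  show ?thesis unfolding exact_resolution_def using bdlin auglin into surj ex0 exS by blast
qed

lemma graded_free_resolution_cone:
  fixes u :: "('n, 'k::field) mpoly"
  assumes F: "graded_free_resolution I F" and G: "graded_free_resolution J G"
    and I: "is_ideal I" and J: "\<And>f. f \<in> J \<longleftrightarrow> u * f \<in> I"
    and \<phi>: "chain_map_over u I (\<lambda>i. free_on (gens G i)) (bdry G) (augm G)
       (\<lambda>i. free_on (gens F i)) (bdry F) (augm F) \<phi>"
      "\<And>i. graded_map (gens G i) (gdeg G i) (gdeg F i) s (\<phi> i)"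
  shows "graded_free_resolution {f. \<exists>c. f - c * u \<in> I} (cone s \<phi> G F)"
proof -
  note fr = graded_free_resolutionD[OF F] and gr = graded_free_resolutionD[OF G]
  let ?C = "cone s \<phi> G F"
  have "finite (gens ?C i)" for i
    using fr(1) gr(1) by (cases i) (simp_all add: cone_def shifted_gens_def)
  moreover have "homogeneous_vec (gdeg ?C i) j (bdry ?C (Suc i) v)"
    if v: "v \<in> free_on (gens ?C (Suc i))" "homogeneous_vec (gdeg ?C (Suc i)) j v" for i j v
  proof -
    have v': "evens v \<in> free_on (gens F (Suc i))" "odds v \<in> free_on (gens G i)"
      "homogeneous_vec (gdeg F (Suc i)) j (evens v)" "homogeneous_vec (gdeg G i) (j - s) (odds v)"
      using v by (simp_all add: in_free_on_cone_iff homogeneous_vec_cone_iff shifted_gens_def)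
    have "homogeneous_vec (gdeg F i) j (bdry F (Suc i) (evens v) + \<phi> i (odds v))"
      using homogeneous_vec_add[OF graded_mapD[OF fr(3) v'(1,3)]] graded_mapD[OF \<phi>(2) v'(2,4)] by simp
    moreover have "homogeneous_vec (gdeg G (i - 1)) (j - s) (shifted_bdry G (Suc i) (odds v))"
    proof (cases i)
      case (Suc l)
      have "homogeneous_vec (gdeg G l) (j - s) (bdry G (Suc l) (odds v))"
        using graded_mapD[OF gr(3)] v'(2,4) unfolding Suc by fastforce
      then show ?thesis using Suc by (simp add: shifted_bdry_def homogeneous_vec_def homogeneous_def)
    qed (simp add: shifted_bdry_def)
    ultimately show ?thesis unfolding homogeneous_vec_cone_iff by (simp add: cone_def)
  qed
  moreover have "homogeneous j (augm ?C v)"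
    if "v \<in> free_on (gens ?C 0)" "homogeneous_vec (gdeg ?C 0) j v" for j v
    using that fr(4) unfolding in_free_on_cone_iff homogeneous_vec_cone_iff by (simp add: cone_def)
  ultimately show ?thesis
    unfolding graded_free_resolution_def using exact_resolution_cone[OF F G I J \<phi>(1)] by blast
qed

section \<open>Linear resolutions of monomial ideals\<close>

text \<open>\<open>\<beta> i\<close> is the rank in homological degree i + 1, as degree 0 always has
  rank 1. For \<open>d = 1\<close> the generators have degree i in every homological degree i,
  including 0.\<close>

definition linear_resolution ::
  "('n, 'k::field) mpoly set \<Rightarrow> nat \<Rightarrow> ('n, 'k) graded_free_complex \<Rightarrow> (nat \<Rightarrow> nat) \<Rightarrow> bool" where
  "linear_resolution I d F \<beta> \<longleftrightarrow> graded_free_resolution I F \<and>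
     card (gens F 0) = 1 \<and> (\<forall>q\<in>gens F 0. gdeg F 0 q = 0) \<and>
     (\<forall>i. card (gens F (Suc i)) = \<beta> i) \<and> (\<forall>i. \<forall>q\<in>gens F (Suc i). gdeg F (Suc i) q = int i + int d)"

text \<open>A nonzero constant in a boundary matrix would join generators of equal degree, but the
  degrees strictly increase from each module to the next. From degree 0 to degree 1 the increase is
  \<open>d\<close>, hence the condition \<open>d \<ge> 1\<close>.\<close>

lemma linear_resolution_minimal:
  assumes F: "linear_resolution I d F \<beta>" and d: "d \<ge> 1"
  shows "minimal_complex F"
  unfolding minimal_complex_def
proof (intro allI ballI)
  fix i and w :: "nat \<Rightarrow>\<^sub>0 'b"
  have gr: "graded_free_resolution I F" using F by (simp add: linear_resolution_def)
  note fr = graded_free_resolutionD[OF gr]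
  note fx = exact_resolutionD[OF fr(2)]
  have lin: "rlinear (tensor_bdry F (Suc i))"
    unfolding tensor_bdry_eq_tens by (rule rlinear_tens[OF fx(1)])
  have basis: "tensor_bdry F (Suc i) (bvec q) = 0" if q: "q \<in> gens F (Suc i)" for q
  proof -
    have "p \<notin> Poly_Mapping.keys (tensor_bdry F (Suc i) (bvec q))" for p
    proof
      assume p: "p \<in> Poly_Mapping.keys (tensor_bdry F (Suc i) (bvec q))"
      have "tens (bdry F (Suc i)) (bvec q) \<in> free_on (gens F i)"
        by (rule tens_in_free_on[OF fx(3) bvec_in_free_on[OF q]])
      then have pg: "p \<in> gens F i" using p by (auto simp: free_on_def tensor_bdry_eq_tens)
      have "gdeg F i p = gdeg F (Suc i) q"
        by (rule tens_graded[OF fr(3) bvec_in_free_on[OF q]])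
          (use p in \<open>auto simp: tensor_bdry_eq_tens\<close>)
      moreover have "gdeg F (Suc i) q = int i + int d" using F q by (auto simp: linear_resolution_def)
      moreover have "gdeg F i p < int i + int d"
        using F pg d by (cases i) (auto simp: linear_resolution_def)
      ultimately show False by simp
    qed
    then show ?thesis by (metis all_not_in_conv keys_eq_empty)
  qed
  assume "w \<in> free_on (gens F (Suc i))"
  then show "tensor_bdry F (Suc i) w = 0"
    by (induction rule: free_on_induct)
      (simp_all add: hom_zero[OF lin] hom_add[OF lin] hom_scale[OF lin] basis)
qed

text \<open>Generators of \<open>G\<close> in homological degree i have degree i. After the shift
  and the twist by \<open>d\<close> they sit in homological degree i + 1 with degree i + d, as those
  of \<open>F\<close> do, so the cone is again linear. The 1 in the new ranks is the rank of
  \<open>G\<close> in degree 0.\<close>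

lemma linear_resolution_cone:
  fixes u :: "('n, 'k::field) mpoly"
  assumes F: "linear_resolution I d F \<beta>" and G: "linear_resolution J 1 G \<gamma>"
    and I: "homogeneous_ideal I" and J: "\<And>f. f \<in> J \<longleftrightarrow> u * f \<in> I" and u: "homogeneous (int d) u"
  shows "\<exists>C. linear_resolution {f. \<exists>c. f - c * u \<in> I} d C
     (\<lambda>i. \<beta> i + (case i of 0 \<Rightarrow> 1 | Suc j \<Rightarrow> \<gamma> j))"
proof -
  have F': "graded_free_resolution I F" and G': "graded_free_resolution J G"
    using F G by (simp_all add: linear_resolution_def)
  obtain \<phi> where \<phi>: "chain_map_over u I (\<lambda>i. free_on (gens G i)) (bdry G) (augm G)
       (\<lambda>i. free_on (gens F i)) (bdry F) (augm F) \<phi>"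
      "\<And>i. graded_map (gens G i) (gdeg G i) (gdeg F i) (int d) (\<phi> i)"
    using graded_chain_map_exists[OF G' F' I _ u] J by blast
  let ?C = "cone (int d) \<phi> G F"
  have "graded_free_resolution {f. \<exists>c. f - c * u \<in> I} ?C"
    by (rule graded_free_resolution_cone[OF F' G' _ J \<phi>]) (use I in \<open>simp add: homogeneous_ideal_def\<close>)
  moreover have "card (gens ?C (Suc i)) = card (gens F (Suc i)) + card (gens G i)" for i
  proof -
    have "card (gens ?C (Suc i)) = card ((\<lambda>q. 2 * q) ` gens F (Suc i)) + card ((\<lambda>q. 2 * q + 1) ` gens G i)"
      using graded_free_resolutionD(1)[OF F'] graded_free_resolutionD(1)[OF G']
      unfolding cone_def shifted_gens_def graded_free_complex.simps nat.case
      by (intro card_Un_disjoint) (auto, presburger)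
    also have "\<dots> = card (gens F (Suc i)) + card (gens G i)"
      by (simp add: card_image inj_on_def)
    finally show ?thesis .
  qed
  moreover have "card (gens G i) = (case i of 0 \<Rightarrow> 1 | Suc j \<Rightarrow> \<gamma> j)" for i
    using G by (cases i) (simp_all add: linear_resolution_def)
  moreover have "card (gens ?C 0) = 1"
    using F by (simp add: cone_def shifted_gens_def card_image inj_on_def linear_resolution_def)
  moreover have "gdeg G i q = int i" if "q \<in> gens G i" for i q
    using G that by (cases i) (auto simp: linear_resolution_def)
  ultimately show ?thesis using F
    by (intro exI[of _ ?C]) (auto simp: linear_resolution_def cone_def shifted_gens_def)
qed

lemma linear_resolution_zero: "\<exists>F. linear_resolution {0 :: ('n, 'k::field) mpoly} d F (\<lambda>_. 0)"
proof -
  let ?F = "\<lparr>gens = (\<lambda>i. if i = 0 then {0} else {}), gdeg = (\<lambda>_ _. 0), bdry = (\<lambda>_ _. 0),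
      augm = (\<lambda>v. Poly_Mapping.lookup v 0)\<rparr> :: ('n, 'k) graded_free_complex"
  have 1: "rform (\<lambda>v :: nat \<Rightarrow>\<^sub>0 ('n, 'k) mpoly. Poly_Mapping.lookup v 0)"
    by (rule rformI) (simp_all add: lookup_add lookup_fscale)
  have 2: "\<exists>v\<in>free_on {0}. f - Poly_Mapping.lookup v 0 \<in> {0}" for f :: "('n, 'k) mpoly"
    by (rule bexI[of _ "Poly_Mapping.single 0 f"]) (auto simp: in_free_on_iff lookup_single)
  have 3: "{v \<in> free_on {0}. Poly_Mapping.lookup v 0 \<in> {0 :: ('n, 'k) mpoly}} = {0}"
  proof (intro equalityI subsetI)
    fix v :: "nat \<Rightarrow>\<^sub>0 ('n, 'k) mpoly"
    assume "v \<in> {v \<in> free_on {0}. Poly_Mapping.lookup v 0 \<in> {0}}"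
    then have "Poly_Mapping.lookup v q = 0" for q by (cases "q = 0") (auto simp: in_free_on_iff)
    then show "v \<in> {0}" by (simp add: poly_mapping_eqI)
  qed (auto simp: in_free_on_iff)
  have "graded_free_resolution {0} ?F"
    using 1 2 3 unfolding graded_free_resolution_def exact_resolution_def
    by (auto simp: fs2.module_hom_zero homogeneous_vec_def dest: spec[of _ 0])
  then show ?thesis by (auto simp: linear_resolution_def)
qed

section \<open>Divisibility and membership in monomial ideals\<close>

lemma adds_iff: "(\<exists>s. t = g + s) \<longleftrightarrow> (\<forall>v. Poly_Mapping.lookup g v \<le> Poly_Mapping.lookup t v)"
  for g t :: "'n \<Rightarrow>\<^sub>0 nat"
proof
  assume "\<forall>v. Poly_Mapping.lookup g v \<le> Poly_Mapping.lookup t v"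
  then have "t = g + (t - g)" by (intro poly_mapping_eqI) (simp add: lookup_add lookup_minus)
  then show "\<exists>s. t = g + s" by blast
qed (auto simp: lookup_add)

lemma is_ideal_span: "is_ideal (module.span (*) S)"
  using module.span_zero[OF module_mult] module.span_add[OF module_mult] module.span_scale[OF module_mult]
  unfolding is_ideal_def by blast

lemma is_ideal_monomial_ideal: "is_ideal (monomial_ideal G)"
  unfolding monomial_ideal_def by (rule is_ideal_span)

lemma mpoly_sum_monomials: "f = (\<Sum>t\<in>Poly_Mapping.keys f. Poly_Mapping.single t (Poly_Mapping.lookup f t))"
proof (rule poly_mapping_eqI)
  fix k
  have "(\<Sum>t\<in>Poly_Mapping.keys f. Poly_Mapping.lookup (Poly_Mapping.single t (Poly_Mapping.lookup f t)) k) =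
        (\<Sum>t\<in>Poly_Mapping.keys f. if t = k then Poly_Mapping.lookup f k else 0)"
    by (rule sum.cong) (auto simp: lookup_single when_def)
  then show "Poly_Mapping.lookup f k = Poly_Mapping.lookup
      (\<Sum>t\<in>Poly_Mapping.keys f. Poly_Mapping.single t (Poly_Mapping.lookup f t)) k"
    by (simp add: lookup_sum sum.delta in_keys_iff)
qed

text \<open>Membership is decided term by term, so questions about colon ideals become questions
  about divisibility of exponent vectors. The polynomials satisfying the right-hand side form an
  ideal containing the generators.\<close>

lemma in_monomial_ideal_iff:
  fixes f :: "('n, 'k::field) mpoly"
  shows "f \<in> monomial_ideal G \<longleftrightarrow> (\<forall>t\<in>Poly_Mapping.keys f. \<exists>g\<in>G. \<exists>s. t = g + s)"
proof
  let ?S = "{f :: ('n, 'k) mpoly. \<forall>t\<in>Poly_Mapping.keys f. \<exists>g\<in>G. \<exists>s. t = g + s}"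
  have "monomial_ideal G \<subseteq> ?S"
    unfolding monomial_ideal_def
  proof (rule module.span_minimal[OF module_mult])
    show "(\<lambda>t. Poly_Mapping.single t 1) ` G \<subseteq> ?S"
      by (auto intro!: exI[of _ 0])
    show "module.subspace (*) ?S"
    proof (rule module.subspaceI[OF module_mult])
      show "x + y \<in> ?S" if "x \<in> ?S" "y \<in> ?S" for x y
        using that keys_add[of x y] by blast
      show "c * x \<in> ?S" if x: "x \<in> ?S" for c x
      proof -
        have "\<exists>g\<in>G. \<exists>s. t = g + s" if t: "t \<in> Poly_Mapping.keys (c * x)" for t
        proof -
          obtain a b where ab: "t = a + b" "b \<in> Poly_Mapping.keys x"
            using keys_mult[of c x] t by blast
          then obtain g s where "g \<in> G" "b = g + s" using x by blast
          then have "t = g + (a + s)" using ab by (simp add: ac_simps)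
          then show ?thesis using \<open>g \<in> G\<close> by blast
        qed
        then show ?thesis by blast
      qed
    qed simp
  qed
  then show "f \<in> monomial_ideal G \<Longrightarrow> \<forall>t\<in>Poly_Mapping.keys f. \<exists>g\<in>G. \<exists>s. t = g + s" by blast
next
  assume f: "\<forall>t\<in>Poly_Mapping.keys f. \<exists>g\<in>G. \<exists>s. t = g + s"
  have "Poly_Mapping.single t c \<in> monomial_ideal G" if t: "t \<in> Poly_Mapping.keys f" for t and c :: 'k
  proof -
    obtain g s where g: "g \<in> G" "t = g + s" using f t by blast
    have "Poly_Mapping.single g 1 \<in> (monomial_ideal G :: ('n, 'k) mpoly set)"
      unfolding monomial_ideal_def using g(1) by (intro module.span_base[OF module_mult]) simp
    from is_idealD(3)[OF is_ideal_monomial_ideal this, of "Poly_Mapping.single s c"]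
    show ?thesis by (simp add: mult_single g(2) add.commute)
  qed
  then have "(\<Sum>t\<in>Poly_Mapping.keys f. Poly_Mapping.single t (Poly_Mapping.lookup f t)) \<in> monomial_ideal G"
    unfolding monomial_ideal_def by (intro module.span_sum[OF module_mult]) simp
  then show "f \<in> monomial_ideal G" using mpoly_sum_monomials[of f] by simp
qed

lemma homogeneous_ideal_monomial_ideal: "homogeneous_ideal (monomial_ideal G)"
proof -
  have "hcomp j f \<in> monomial_ideal G" if f: "f \<in> monomial_ideal G" for f :: "('a, 'b) mpoly" and j
    unfolding in_monomial_ideal_iff
  proof
    fix t assume "t \<in> Poly_Mapping.keys (hcomp j f)"
    then have "t \<in> Poly_Mapping.keys f" by (auto simp: in_keys_iff lookup_hcomp split: if_splits)
    then show "\<exists>g\<in>G. \<exists>s. t = g + s" using f by (simp add: in_monomial_ideal_iff)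
  qed
  then show ?thesis by (simp add: homogeneous_ideal_def is_ideal_monomial_ideal)
qed

lemma keys_monomial_mult:
  fixes f :: "('n, 'k::field) mpoly"
  shows "Poly_Mapping.keys (Poly_Mapping.single u 1 * f) = (\<lambda>t. u + t) ` Poly_Mapping.keys f"
proof
  show "Poly_Mapping.keys (Poly_Mapping.single u 1 * f) \<subseteq> (\<lambda>t. u + t) ` Poly_Mapping.keys f"
    using keys_mult[of "Poly_Mapping.single u 1" f] by auto
  have "Poly_Mapping.lookup (Poly_Mapping.single u 1 * f) (u + t) = Poly_Mapping.lookup f t" for t
    by (simp add: lookup_mult lookup_single when_mult)
  then show "(\<lambda>t. u + t) ` Poly_Mapping.keys f \<subseteq> Poly_Mapping.keys (Poly_Mapping.single u 1 * f)"
    by (auto simp: in_keys_iff)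
qed

lemma monomial_ideal_insert:
  "monomial_ideal (insert u U) = {f. \<exists>c. f - c * Poly_Mapping.single u 1 \<in> monomial_ideal U}"
  unfolding monomial_ideal_def by (simp add: module.span_insert[OF module_mult])

lemma homogeneous_monomial: "mdeg u = d \<Longrightarrow> homogeneous (int d) (Poly_Mapping.single u 1)"
  using homogeneous_single[of u 1] by simp

text \<open>Multiplication by a monomial translates the support without cancellation, so I : u = J
  need only be tested on monomials.\<close>

lemma linear_resolution_insert:
  assumes F: "linear_resolution (monomial_ideal U :: ('n, 'k::field) mpoly set) d F \<beta>"
    and G: "linear_resolution (monomial_ideal W :: ('n, 'k) mpoly set) 1 G \<gamma>"
    and u: "mdeg u = d"
    and colon: "\<And>t. (\<exists>g\<in>U. \<exists>s. u + t = g + s) \<longleftrightarrow> (\<exists>g\<in>W. \<exists>s. t = g + s)"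
  shows "\<exists>C. linear_resolution (monomial_ideal (insert u U) :: ('n, 'k) mpoly set) d C
     (\<lambda>i. \<beta> i + (case i of 0 \<Rightarrow> 1 | Suc j \<Rightarrow> \<gamma> j))"
  unfolding monomial_ideal_insert
proof (rule linear_resolution_cone[OF F G homogeneous_ideal_monomial_ideal _ homogeneous_monomial[OF u]])
  fix f :: "('n, 'k) mpoly"
  show "f \<in> monomial_ideal W \<longleftrightarrow> Poly_Mapping.single u 1 * f \<in> monomial_ideal U"
    unfolding in_monomial_ideal_iff keys_monomial_mult using colon by simp
qed

lemma variable_adds_iff: "(\<exists>s. t = Poly_Mapping.single v 1 + s) \<longleftrightarrow> 1 \<le> Poly_Mapping.lookup t v"
  for t :: "'n \<Rightarrow>\<^sub>0 nat"
  unfolding adds_iff by (auto simp: lookup_single when_def)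

text \<open>A variable outside \<open>V\<close> is a nonzerodivisor modulo the variables in
  \<open>V\<close>, so the ideal is its own colon and one resolution serves as both inputs of the
  cone. The result is the Koszul complex, with ranks given by Pascal's rule.\<close>

lemma linear_resolution_variables:
  assumes "finite V"
  shows "\<exists>F. linear_resolution (monomial_ideal ((\<lambda>v. Poly_Mapping.single v 1) ` V) :: ('n, 'k::field) mpoly set)
     1 F (\<lambda>i. card V choose Suc i)"
  using assms
proof induction
  case empty
  have "monomial_ideal {} = {0 :: ('n, 'k) mpoly}"
    by (simp add: monomial_ideal_def module.span_empty[OF module_mult])
  then show ?case using linear_resolution_zero by simp
next
  case (insert w V)
  let ?I = "monomial_ideal ((\<lambda>v. Poly_Mapping.single v 1) ` V) :: ('n, 'k) mpoly set"
  obtain F where F: "linear_resolution ?I 1 F (\<lambda>i. card V choose Suc i)" using insert.IH by blast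
  have "\<exists>C. linear_resolution (monomial_ideal (insert (Poly_Mapping.single w 1)
        ((\<lambda>v. Poly_Mapping.single v 1) ` V)) :: ('n, 'k) mpoly set) 1 C
      (\<lambda>i. (card V choose Suc i) + (case i of 0 \<Rightarrow> 1 | Suc j \<Rightarrow> card V choose Suc j))"
  proof (rule linear_resolution_insert[OF F F])
    fix t :: "'n \<Rightarrow>\<^sub>0 nat"
    have "1 \<le> Poly_Mapping.lookup (Poly_Mapping.single w 1 + t) v \<longleftrightarrow> 1 \<le> Poly_Mapping.lookup t v"
      if "v \<in> V" for v
      using that insert.hyps(2) by (auto simp: lookup_add lookup_single when_def)
    then show "(\<exists>g\<in>(\<lambda>v. Poly_Mapping.single v 1) ` V. \<exists>s. Poly_Mapping.single w 1 + t = g + s) \<longleftrightarrow>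
        (\<exists>g\<in>(\<lambda>v. Poly_Mapping.single v 1) ` V. \<exists>s. t = g + s)"
      by (simp only: bex_simps variable_adds_iff) blast
  qed simp
  moreover have "(card V choose Suc i) + (case i of 0 \<Rightarrow> 1 | Suc j \<Rightarrow> card V choose Suc j) =
      card (insert w V) choose Suc i" for i
    using insert.hyps by (cases i) simp_all
  ultimately show ?case by simp
qed

text \<open>The colon ideal is generated by the variables in \<open>V\<close>, so the cone adds the
  ranks of a Koszul complex; its rank 1 in degree 0 is the case \<open>i = 0\<close> of the
  binomial.\<close>

lemma linear_resolution_insert_linear_quotient:
  assumes F: "linear_resolution (monomial_ideal U :: ('n, 'k::field) mpoly set) d F \<beta>"
    and u: "mdeg u = d" and V: "finite V"
    and colon: "\<And>t. (\<exists>g\<in>U. \<exists>s. u + t = g + s) \<longleftrightarrow> (\<exists>v\<in>V. 1 \<le> Poly_Mapping.lookup t v)"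
  shows "\<exists>C. linear_resolution (monomial_ideal (insert u U) :: ('n, 'k) mpoly set) d C
     (\<lambda>i. \<beta> i + (card V choose i))"
proof -
  obtain G where "linear_resolution (monomial_ideal ((\<lambda>v. Poly_Mapping.single v 1) ` V) :: ('n, 'k) mpoly set)
     1 G (\<lambda>i. card V choose Suc i)" using linear_resolution_variables[OF V] by blast
  from linear_resolution_insert[OF F this u]
  have "\<exists>C. linear_resolution (monomial_ideal (insert u U) :: ('n, 'k) mpoly set) d C
     (\<lambda>i. \<beta> i + (case i of 0 \<Rightarrow> 1 | Suc j \<Rightarrow> card V choose Suc j))"
    unfolding colon by (simp add: variable_adds_iff[unfolded One_nat_def])
  moreover have "(case i of 0 \<Rightarrow> 1 | Suc j \<Rightarrow> card V choose Suc j) = card V choose i" for i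
    by (cases i) simp_all
  ultimately show ?thesis by simp
qed

section \<open>Counting monomials\<close>

lemma keys_add_nat: "Poly_Mapping.keys (s + t) = Poly_Mapping.keys s \<union> Poly_Mapping.keys t"
  for s t :: "'n \<Rightarrow>\<^sub>0 nat"
  by (auto simp: in_keys_iff lookup_add)

lemma mdeg_mono:
  assumes "\<And>v. Poly_Mapping.lookup s v \<le> Poly_Mapping.lookup t v"
  shows "mdeg s \<le> mdeg t"
proof -
  obtain w where "t = s + w" using assms adds_iff[of t s] by auto
  then show ?thesis by (simp add: mdeg_add)
qed

lemma eq_if_le_mdeg:
  assumes "\<And>v. Poly_Mapping.lookup s v \<le> Poly_Mapping.lookup t v" "mdeg t \<le> mdeg s"
  shows "s = t"
proof -
  obtain w where w: "t = s + w" using assms adds_iff[of t s] by auto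
  then have "mdeg w = 0" using assms(2) by (simp add: mdeg_add)
  then show ?thesis using w by (simp add: mdeg_eq_0_iff)
qed

text \<open>A monomial in \<open>insert a A\<close> either avoids \<open>a\<close> or is
  \<open>a\<close> times a monomial of degree one less; Pascal's rule adds the two counts.\<close>

lemma finite_card_monomials:
  assumes "finite A"
  shows "finite {t. Poly_Mapping.keys t \<subseteq> A \<and> mdeg t = e} \<and>
    card {t. Poly_Mapping.keys t \<subseteq> A \<and> mdeg t = e} = (card A + e - 1) choose e"
  using assms
proof (induction A arbitrary: e)
  case empty
  \<comment> \<open>Without variables the binomial is \<open>(e - 1) choose e\<close>: it is 1 for
    \<open>e = 0\<close>, where the subtraction truncates, and 0 otherwise.\<close>
  have eq: "{t :: 'a \<Rightarrow>\<^sub>0 nat. Poly_Mapping.keys t \<subseteq> {} \<and> mdeg t = e} = (if e = 0 then {0} else {})" by auto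
  show ?case unfolding eq by (cases e) auto
next
  case (insert a A)
  note IH = insert.IH and hyps = insert.hyps
  show ?case
  proof (induction e)
    case 0
    have "{t :: 'a \<Rightarrow>\<^sub>0 nat. Poly_Mapping.keys t \<subseteq> insert a A \<and> mdeg t = 0} = {0}"
      by (auto simp: mdeg_eq_0_iff)
    then show ?case by simp
  next
    case (Suc e)
    let ?X = "{t. Poly_Mapping.keys t \<subseteq> A \<and> mdeg t = Suc e}"
    let ?Y = "{t. Poly_Mapping.keys t \<subseteq> insert a A \<and> mdeg t = e}"
    let ?f = "\<lambda>t :: 'a \<Rightarrow>\<^sub>0 nat. Poly_Mapping.single a 1 + t"
    have eq: "{t. Poly_Mapping.keys t \<subseteq> insert a A \<and> mdeg t = Suc e} = ?X \<union> ?f ` ?Y"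
    proof (intro equalityI subsetI)
      fix t assume t: "t \<in> {t. Poly_Mapping.keys t \<subseteq> insert a A \<and> mdeg t = Suc e}"
      show "t \<in> ?X \<union> ?f ` ?Y"
      proof (cases "a \<in> Poly_Mapping.keys t")
        case True
        then obtain s where s: "t = ?f s" using variable_adds_iff[of t a] by (auto simp: in_keys_iff)
        then have "s \<in> ?Y" using t by (auto simp: keys_add_nat mdeg_add)
        then show ?thesis using s by blast
      qed (use t in auto)
    qed (auto simp: keys_add_nat mdeg_add)
    have disj: "?X \<inter> ?f ` ?Y = {}"
      using hyps(2) by (auto simp: keys_add_nat)
    have inj: "inj_on ?f ?Y" by (rule inj_onI) simp
    have fin: "finite ?X" "finite ?Y" "card ?X = (card A + e) choose Suc e"
      "card ?Y = (card A + e) choose e"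
      using IH[of "Suc e"] Suc hyps by auto
    then show ?case unfolding eq
      using card_Un_disjoint[OF fin(1) finite_imageI[OF fin(2)] disj] card_image[OF inj] hyps
      by simp
  qed
qed

section \<open>Monomials sorted by their last variable\<close>

lemma finite_monomials: "finite {t :: 'n::finite \<Rightarrow>\<^sub>0 nat. mdeg t = d}"
  using finite_card_monomials[of "UNIV :: 'n set" d] by simp

text \<open>The position of a variable, counted from 0. If no power is removed, the colon ideal at
  \<open>u\<close> has \<open>idx (last_var u)\<close> variables.\<close>

abbreviation idx :: "'n::linorder \<Rightarrow> nat" where
  "idx v \<equiv> card {..<v}"

abbreviation last_var :: "('n::linorder \<Rightarrow>\<^sub>0 nat) \<Rightarrow> 'n" where
  "last_var t \<equiv> Max (Poly_Mapping.keys t)"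

lemma idx_less_iff: "idx v < idx w \<longleftrightarrow> v < w" for v w :: "'n::{finite,linorder}"
proof
  assume "idx v < idx w"
  show "v < w"
  proof (rule ccontr)
    assume "\<not> v < w"
    then have "idx w \<le> idx v" by (intro card_mono) auto
    then show False using \<open>idx v < idx w\<close> by simp
  qed
next
  assume "v < w"
  then show "idx v < idx w" by (intro psubset_card_mono) auto
qed

lemma bij_betw_idx: "bij_betw idx (UNIV :: 'n::{finite,linorder} set) {..<CARD('n)}"
proof -
  have inj: "inj (idx :: 'n \<Rightarrow> nat)"
    by (rule injI) (metis idx_less_iff less_irrefl linorder_less_linear)
  have "idx v < CARD('n)" for v :: 'n by (intro psubset_card_mono) auto
  then have "range (idx :: 'n \<Rightarrow> nat) \<subseteq> {..<CARD('n)}" by auto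
  then have "range (idx :: 'n \<Rightarrow> nat) = {..<CARD('n)}"
    by (intro card_subset_eq) (simp_all add: card_image[OF inj])
  with inj show ?thesis by (simp add: bij_betw_def)
qed

lemma bij_betw_idx_greater:
  "bij_betw idx {i::'n::{finite,linorder}<..} {idx i<..<CARD('n)}"
proof -
  have "idx ` {i<..} = {idx i<..<CARD('n)}"
  proof (intro equalityI subsetI)
    fix q assume q: "q \<in> {idx i<..<CARD('n)}"
    then have "q \<in> range (idx :: 'n \<Rightarrow> nat)"
      using bij_betw_idx[where 'n = 'n] by (simp add: bij_betw_def)
    then obtain v :: 'n where "q = idx v" by blast
    then show "q \<in> idx ` {i<..}" using q idx_less_iff by auto
  next
    fix q assume "q \<in> idx ` {i<..}"
    then show "q \<in> {idx i<..<CARD('n)}"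
      using bij_betwE[OF bij_betw_idx[where 'n = 'n]] idx_less_iff by auto
  qed
  then show ?thesis using bij_betw_idx[where 'n = 'n] unfolding bij_betw_def by (auto intro: inj_on_subset)
qed

lemma last_var_in_keys: "mdeg t \<ge> 1 \<Longrightarrow> last_var t \<in> Poly_Mapping.keys t"
  by (intro Max_in) (auto simp: mdeg_def)

text \<open>Dividing by the last variable leaves an arbitrary monomial of degree
  \<open>d - 1\<close> in the \<open>idx m + 1\<close> variables up to \<open>m\<close>.\<close>

lemma card_last_var_eq:
  fixes m :: "'n::{finite,linorder}"
  assumes "d \<ge> 1"
  shows "card {t. mdeg t = d \<and> last_var t = m} = (idx m + d - 1) choose (d - 1)"
proof -
  let ?Y = "{t. Poly_Mapping.keys t \<subseteq> {..m} \<and> mdeg t = d - 1}"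
  let ?f = "\<lambda>t :: 'n \<Rightarrow>\<^sub>0 nat. Poly_Mapping.single m 1 + t"
  have "{t. mdeg t = d \<and> last_var t = m} = ?f ` ?Y"
  proof (intro equalityI subsetI)
    fix t assume t: "t \<in> {t. mdeg t = d \<and> last_var t = m}"
    then have "m \<in> Poly_Mapping.keys t" using last_var_in_keys[of t] assms by auto
    then obtain s where s: "t = ?f s" using variable_adds_iff[of t m] by (auto simp: in_keys_iff)
    have "Poly_Mapping.keys t \<subseteq> {..m}" using t by auto
    then have "s \<in> ?Y" using t s by (auto simp: keys_add_nat mdeg_add)
    then show "t \<in> ?f ` ?Y" using s by blast
  next
    fix t assume "t \<in> ?f ` ?Y"
    then obtain s where s: "t = ?f s" "Poly_Mapping.keys s \<subseteq> {..m}" "mdeg s = d - 1" by blast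
    then have "last_var t = m" by (intro Max_eqI) (auto simp: keys_add_nat)
    then show "t \<in> {t. mdeg t = d \<and> last_var t = m}" using s assms by (simp add: mdeg_add)
  qed
  then have "card {t. mdeg t = d \<and> last_var t = m} = card ?Y"
    by (simp add: card_image inj_on_def)
  also have "\<dots> = (card {..m} + (d - 1) - 1) choose (d - 1)"
    using finite_card_monomials[of "{..m}" "d - 1"] by simp
  also have "card {..m} = Suc (idx m)"
    by (metis finite card_insert_disjoint ivl_disj_un_singleton(2) insert_is_Un lessThan_iff less_irrefl Un_commute)
  finally show ?thesis using assms by simp
qed

lemma hockey_stick: "(\<Sum>i<n. (i + e) choose (l + e)) = (n + e) choose (l + Suc e)"
  by (induction n) simp_all

text \<open>The identity C(i+e, e) C(i, l) = C(i+e, l+e) C(l+e, l) pulls out a factor independent of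
  \<open>i\<close>; the rest is a hockey-stick sum.\<close>

lemma sum_binomial_products: "(\<Sum>i<n. ((i + e) choose e) * (i choose l)) = ((n + e) choose (l + Suc e)) * ((l + e) choose l)"
proof -
  have "((i + e) choose e) * (i choose l) = ((i + e) choose (l + e)) * ((l + e) choose l)" for i
  proof (cases "l \<le> i")
    case True
    then show ?thesis
      using choose_mult[of e "l + e" "i + e"] binomial_symmetric[of l "l + e"] by simp
  next
    case False
    then have "i choose l = 0" "(i + e) choose (l + e) = 0" by simp_all
    then show ?thesis by (simp only: mult_zero_left mult_zero_right)
  qed
  then have "(\<Sum>i<n. ((i + e) choose e) * (i choose l)) = (\<Sum>i<n. (i + e) choose (l + e)) * ((l + e) choose l)"
    by (simp add: sum_distrib_right)
  then show ?thesis by (simp add: hockey_stick)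
qed

text \<open>The case in which no power is removed: the values are the Betti numbers of the
  \<open>d\<close>-th power of the maximal ideal, in column l + 1.\<close>

lemma sum_last_var:
  assumes "d \<ge> 1"
  shows "(\<Sum>t\<in>{t :: 'n::{finite,linorder} \<Rightarrow>\<^sub>0 nat. mdeg t = d}. idx (last_var t) choose l) =
    ((CARD('n) + d - 1) choose (l + d)) * ((l + d - 1) choose l)"
    (is "(\<Sum>t\<in>?T. ?g t) = _")
proof -
  have "(\<Sum>t\<in>?T. ?g t) = (\<Sum>m\<in>UNIV. sum ?g {t \<in> ?T. last_var t = m})"
    by (rule sum.group[symmetric]) (simp_all add: finite_monomials)
  also have "\<dots> = (\<Sum>m::'n\<in>UNIV. ((idx m + d - 1) choose (d - 1)) * (idx m choose l))"
  proof (rule sum.cong)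
    fix m :: 'n
    have "sum ?g {t \<in> ?T. last_var t = m} = (\<Sum>t | mdeg t = d \<and> last_var t = m. idx m choose l)"
      by (rule sum.cong) auto
    then show "sum ?g {t \<in> ?T. last_var t = m} =
        ((idx m + d - 1) choose (d - 1)) * (idx m choose l)"
      by (simp add: card_last_var_eq[OF assms])
  qed simp
  also have "\<dots> = (\<Sum>i<CARD('n). ((i + d - 1) choose (d - 1)) * (i choose l))"
    by (rule sum.reindex_bij_betw[OF bij_betw_idx])
  also have "\<dots> = ((CARD('n) + d - 1) choose (l + d)) * ((l + d - 1) choose l)"
    using sum_binomial_products[of "d - 1" l "CARD('n)"] assms by simp
  finally show ?thesis .
qed

section \<open>Linear quotients\<close>

definition gens_without_powers :: "nat \<Rightarrow> 'n set \<Rightarrow> ('n \<Rightarrow>\<^sub>0 nat) set" where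
  "gens_without_powers d S = {t. mdeg t = d} - (\<lambda>v. Poly_Mapping.single v d) ` S"

text \<open>
  The generators are ordered decreasingly in the lexicographic order whose largest variable is the
  smallest element of \<open>'n\<close>. The colon ideal at \<open>u\<close> is generated by all variables before the last
  variable of \<open>u\<close>, except for \<open>x\<^sub>v\<close> when \<open>u x\<^sub>v / x\<^sub>m\<close> (\<open>m\<close> being the last variable of \<open>u\<close>)
  is one of the removed powers.
\<close>

definition colon_vars :: "nat \<Rightarrow> 'n set \<Rightarrow> ('n::linorder \<Rightarrow>\<^sub>0 nat) \<Rightarrow> 'n set" where
  "colon_vars d S u = {v. v < last_var u \<and> \<not> (v \<in> S \<and> Poly_Mapping.lookup u v = d - 1)}"

text \<open>Forwards, let x_k be the first variable where \<open>u\<close> and \<open>g\<close>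
  differ. There \<open>g\<close> is larger, and as the degrees agree it is smaller at a later
  variable of \<open>u\<close>, so x_k precedes the last variable x_m. Backwards, x_v * u / x_m is a
  larger generator and divides x_v * u.\<close>

lemma colon_by_variables:
  fixes u :: "'n::{finite,linorder} \<Rightarrow>\<^sub>0 nat"
  assumes d: "d \<ge> 1" and u: "mdeg u = d"
  shows "(\<exists>g\<in>{g \<in> gens_without_powers d S. u < g}. \<exists>s. u + t = g + s) \<longleftrightarrow>
    (\<exists>v\<in>colon_vars d S u. 1 \<le> Poly_Mapping.lookup t v)"
proof
  assume "\<exists>g\<in>{g \<in> gens_without_powers d S. u < g}. \<exists>s. u + t = g + s"
  then obtain g where g: "mdeg g = d" "\<And>v. v \<in> S \<Longrightarrow> g \<noteq> Poly_Mapping.single v d" "u < g"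
    "\<And>v. Poly_Mapping.lookup g v \<le> Poly_Mapping.lookup u v + Poly_Mapping.lookup t v"
    unfolding adds_iff by (auto simp: gens_without_powers_def lookup_add)
  obtain k where k: "Poly_Mapping.lookup u k < Poly_Mapping.lookup g k"
    "\<And>k'. k' < k \<Longrightarrow> Poly_Mapping.lookup u k' = Poly_Mapping.lookup g k'"
    using g(3) by (auto simp: less_poly_mapping.rep_eq less_fun_def)
  have "\<exists>j. Poly_Mapping.lookup g j < Poly_Mapping.lookup u j"
  proof (rule ccontr)
    assume "\<nexists>j. Poly_Mapping.lookup g j < Poly_Mapping.lookup u j"
    then have "u = g" by (intro eq_if_le_mdeg) (auto simp: g(1) u not_less)
    then show False using k(1) by simp
  qed
  then obtain j where j: "Poly_Mapping.lookup g j < Poly_Mapping.lookup u j" by blast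
  have "k < j" using k j by (metis less_asym linorder_less_linear less_irrefl)
  also have "j \<le> last_var u" using j by (intro Max_ge) (auto simp: in_keys_iff)
  finally have "k < last_var u" .
  moreover have False if "k \<in> S" "Poly_Mapping.lookup u k = d - 1"
  \<comment> \<open>The exponent of \<open>g\<close> at \<open>k\<close> would reach
    \<open>d\<close>, so \<open>g\<close> would be the removed power of x_k.\<close>
  proof -
    have "d \<le> Poly_Mapping.lookup g k" using that(2) k(1) by simp
    then have "Poly_Mapping.single k d = g"
      by (intro eq_if_le_mdeg) (auto simp: g(1) lookup_single when_def)
    then show False using g(2)[OF that(1)] by simp
  qed
  ultimately have "k \<in> colon_vars d S u" by (auto simp: colon_vars_def)
  moreover have "1 \<le> Poly_Mapping.lookup t k" using k(1) g(4)[of k] by simp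
  ultimately show "\<exists>v\<in>colon_vars d S u. 1 \<le> Poly_Mapping.lookup t v" by blast
next
  assume "\<exists>v\<in>colon_vars d S u. 1 \<le> Poly_Mapping.lookup t v"
  then obtain v where v: "v < last_var u" "\<not> (v \<in> S \<and> Poly_Mapping.lookup u v = d - 1)"
    "1 \<le> Poly_Mapping.lookup t v" by (auto simp: colon_vars_def)
  let ?m = "last_var u"
  have "?m \<in> Poly_Mapping.keys u" using last_var_in_keys[of u] u d by simp
  then obtain w where w: "u = Poly_Mapping.single ?m 1 + w"
    using variable_adds_iff[of u ?m] by (auto simp: in_keys_iff)
  have "mdeg u = 1 + mdeg w" by (subst w) (simp add: mdeg_add)
  then have mw: "Suc (mdeg w) = d" using u by simp
  have luw: "Poly_Mapping.lookup u x = Poly_Mapping.lookup w x + (1 when ?m = x)" for x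
    by (subst w) (simp add: lookup_add lookup_single)
  \<comment> \<open>One factor of the last variable is traded for x_v. The result is a removed power
    only if v is in \<open>S\<close> and has exponent \<open>d - 1\<close> in \<open>u\<close>,
    which \<open>colon_vars\<close> excludes.\<close>
  let ?g = "Poly_Mapping.single v 1 + w"
  have "?g \<noteq> Poly_Mapping.single x d" if "x \<in> S" for x
  proof
    assume g: "?g = Poly_Mapping.single x d"
    have "Poly_Mapping.lookup (Poly_Mapping.single x d) v = Suc (Poly_Mapping.lookup w v)"
      by (simp add: g[symmetric] lookup_add)
    then have "x = v" "d = Suc (Poly_Mapping.lookup w v)"
      by (auto simp: lookup_single when_def split: if_splits)
    then show False using v(1,2) that luw[of v] by simp
  qed
  moreover have "mdeg ?g = d" by (simp add: mdeg_add mw)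
  ultimately have "?g \<in> gens_without_powers d S" by (auto simp: gens_without_powers_def)
  moreover have "u < ?g" unfolding less_poly_mapping.rep_eq less_fun_def
    by (intro exI[of _ v]) (use v(1) in \<open>auto simp: luw lookup_add lookup_single when_def\<close>)
  moreover have "\<exists>s. u + t = ?g + s"
    unfolding adds_iff using v(3) by (auto simp: luw lookup_add lookup_single when_def)
  ultimately show "\<exists>g\<in>{g \<in> gens_without_powers d S. u < g}. \<exists>s. u + t = g + s" by blast
qed

text \<open>The induction adds generators from the largest down, over sets closed upwards among the
  generators. Thus the set present when \<open>b\<close> is added is exactly that of the generators
  above \<open>b\<close>, as the colon computation requires.\<close>

lemma linear_resolution_gens_without_powers:
  fixes S :: "'n::{finite,linorder} set"
  assumes d: "d \<ge> 1"
  shows "\<exists>F. linear_resolution (monomial_ideal (gens_without_powers d S) :: ('n, 'k::field) mpoly set) d F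
     (\<lambda>i. \<Sum>u\<in>gens_without_powers d S. card (colon_vars d S u) choose i)"
proof -
  let ?B = "gens_without_powers d S"
  have fin: "finite ?B" by (simp add: gens_without_powers_def finite_monomials)
  have "\<exists>F. linear_resolution (monomial_ideal U :: ('n, 'k) mpoly set) d F
     (\<lambda>i. \<Sum>u\<in>U. card (colon_vars d S u) choose i)"
    if "finite U" "U \<subseteq> ?B" "\<And>u v. u \<in> U \<Longrightarrow> v \<in> ?B \<Longrightarrow> u < v \<Longrightarrow> v \<in> U" for U
    using that
  proof (induction rule: finite_linorder_min_induct)
    case empty
    have "monomial_ideal {} = {0 :: ('n, 'k) mpoly}"
      by (simp add: monomial_ideal_def module.span_empty[OF module_mult])
    then show ?case using linear_resolution_zero by simp
  next
    case (insert b A)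
    have up: "v \<in> A" if "u \<in> A" "v \<in> ?B" "u < v" for u v
      using insert.prems(2)[of u v] insert.hyps(2) that less_asym by blast
    obtain F where F: "linear_resolution (monomial_ideal A :: ('n, 'k) mpoly set) d F
        (\<lambda>i. \<Sum>u\<in>A. card (colon_vars d S u) choose i)"
      using insert.IH insert.prems(1) up by blast
    have b: "mdeg b = d" using insert.prems(1) by (auto simp: gens_without_powers_def)
    have A: "A = {g \<in> ?B. b < g}"
      using insert.prems insert.hyps(2) by blast
    have "\<exists>C. linear_resolution (monomial_ideal (insert b A) :: ('n, 'k) mpoly set) d C
        (\<lambda>i. (\<Sum>u\<in>A. card (colon_vars d S u) choose i) + (card (colon_vars d S b) choose i))"
      by (rule linear_resolution_insert_linear_quotient[OF F b])
        (use colon_by_variables[OF d b] A in auto)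
    moreover have "(\<Sum>u\<in>insert b A. card (colon_vars d S u) choose i) =
        (\<Sum>u\<in>A. card (colon_vars d S u) choose i) + (card (colon_vars d S b) choose i)" for i
      using insert.hyps by (subst sum.insert) auto
    ultimately show ?case by simp
  qed
  from this[OF fin] show ?thesis by blast
qed

text \<open>At most one variable is missing from the variables before the last one. The correction
  is nevertheless written as a sum over the missing variables, empty or with one term, so that it
  can be exchanged with the sum over \<open>u\<close>.\<close>

lemma card_colon_vars_choose:
  fixes S :: "'n::{finite,linorder} set"
  assumes d: "d \<ge> 1" and S: "d = 1 \<Longrightarrow> card S \<le> 1" and u: "mdeg u = d"
  shows "int (card (colon_vars d S u) choose l) = int (idx (last_var u) choose l) -
    (\<Sum>i | i \<in> S \<and> i < last_var u \<and> Poly_Mapping.lookup u i = d - 1.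
       int (idx (last_var u) choose l) - int ((idx (last_var u) - 1) choose l))"
proof -
  let ?m = "last_var u"
  let ?E = "{i \<in> S. i < ?m \<and> Poly_Mapping.lookup u i = d - 1}"
  have m: "?m \<in> Poly_Mapping.keys u" using last_var_in_keys[of u] u d by simp
  have "colon_vars d S u = {..<?m} - ?E" by (auto simp: colon_vars_def)
  then have card: "card (colon_vars d S u) = idx ?m - card ?E"
    by (subst card_Diff_subset[symmetric]) auto
  have "i = i'" if i: "i \<in> ?E" "i' \<in> ?E" for i i'
  proof (rule ccontr)
    assume "i \<noteq> i'"
    \<comment> \<open>Two missing variables would make this monomial of degree 2d - 1 divide
      \<open>u\<close>, forcing \<open>d = 1\<close>; then \<open>S\<close> would have two
      elements.\<close>
    let ?w = "Poly_Mapping.single i (d - 1) + Poly_Mapping.single i' (d - 1) + Poly_Mapping.single ?m 1"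
    have "mdeg ?w \<le> mdeg u"
      by (rule mdeg_mono) (use i m \<open>i \<noteq> i'\<close> in \<open>auto simp: lookup_add lookup_single when_def in_keys_iff\<close>)
    then have "d = 1" using u d by (simp add: mdeg_add)
    then have "card {i, i'} \<le> 1"
      using S card_mono[of S "{i, i'}"] i by auto
    then show False using \<open>i \<noteq> i'\<close> by simp
  qed
  then have "?E = {} \<or> (\<exists>i. ?E = {i})" by blast
  then show ?thesis by (elim disjE exE) (simp_all only: card, simp_all)
qed

text \<open>The variables after \<open>i\<close> occupy the positions from \<open>idx i + 1\<close>
  to n - 1, so the sum telescopes. These positions are positive, so \<open>idx j - 1\<close> never
  truncates.\<close>

lemma sum_idx_differences:
  fixes i :: "'n::{finite,linorder}"
  shows "(\<Sum>j\<in>{i<..}. int (idx j choose l) - int ((idx j - 1) choose l)) =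
    int ((CARD('n) - 1) choose l) - int (idx i choose l)"
proof -
  have "(\<Sum>q\<in>{p<..<p + Suc k}. int (q choose l) - int ((q - 1) choose l)) =
      int ((p + k) choose l) - int (p choose l)" for p k
  proof (induction k)
    case (Suc k)
    have "{p<..<p + Suc (Suc k)} = insert (p + Suc k) {p<..<p + Suc k}" by auto
    then show ?case using Suc by simp
  next
    case 0
    have "{p<..<p + Suc 0} = {}" by auto
    then show ?case by simp
  qed
  note telescope = this
  have less: "idx i < CARD('n)" using bij_betwE[OF bij_betw_idx[where 'n = 'n]] by simp
  have eq: "idx i + Suc (CARD('n) - 1 - idx i) = CARD('n)" "idx i + (CARD('n) - 1 - idx i) = CARD('n) - 1"
    using less by linarith+
  have "(\<Sum>q\<in>{idx i<..<CARD('n)}. int (q choose l) - int ((q - 1) choose l)) =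
      int ((CARD('n) - 1) choose l) - int (idx i choose l)"
    using telescope[of "idx i" "CARD('n) - 1 - idx i"] unfolding eq .
  then show ?thesis
    using sum.reindex_bij_betw[OF bij_betw_idx_greater, of "\<lambda>q. int (q choose l) - int ((q - 1) choose l)" i]
    by simp
qed

text \<open>If \<open>i\<close> is missing at \<open>u\<close>, the degree leaves room only for u =
  x_i^(d-1) * x_j with j the last variable. So the pairs (u, i) correspond to pairs (i, j) with i in
  \<open>S\<close> and i < j.\<close>

lemma sum_corrections:
  fixes S :: "'n::{finite,linorder} set"
  assumes d: "d \<ge> 1" and S: "d = 1 \<Longrightarrow> card S \<le> 1"
  shows "(\<Sum>u\<in>gens_without_powers d S. \<Sum>i | i \<in> S \<and> i < last_var u \<and> Poly_Mapping.lookup u i = d - 1.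
       h (last_var u)) = (\<Sum>i\<in>S. \<Sum>j\<in>{i<..}. h j)"
proof -
  let ?B = "gens_without_powers d S"
  let ?E = "\<lambda>u. {i \<in> S. i < last_var u \<and> Poly_Mapping.lookup u i = d - 1}"
  let ?w = "\<lambda>i j :: 'n. Poly_Mapping.single i (d - 1) + Poly_Mapping.single j 1"
  have fin: "finite ?B" by (simp add: gens_without_powers_def finite_monomials)
  have u_eq: "?w i (last_var u) = u" if "u \<in> ?B" "i \<in> ?E u" for u i
  proof (rule eq_if_le_mdeg)
    have u: "mdeg u = d" using that by (simp add: gens_without_powers_def)
    have "last_var u \<in> Poly_Mapping.keys u" using last_var_in_keys[of u] u d by simp
    then show "Poly_Mapping.lookup (?w i (last_var u)) v \<le> Poly_Mapping.lookup u v" for v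
      using that(2) by (auto simp: lookup_add lookup_single when_def in_keys_iff)
    show "mdeg u \<le> mdeg (?w i (last_var u))" using d u by (simp add: mdeg_add)
  qed
  have w: "last_var (?w i j) = j" "Poly_Mapping.lookup (?w i j) i = d - 1" "?w i j \<in> ?B"
    if ij: "i \<in> S" "i < j" for i j
  proof -
    show "last_var (?w i j) = j"
      using ij by (intro Max_eqI) (auto simp: keys_add_nat split: if_splits)
    show "Poly_Mapping.lookup (?w i j) i = d - 1"
      using ij by (simp add: lookup_add lookup_single when_def)
    \<comment> \<open>With i < j this can be a removed power only for \<open>d = 1\<close>, when it
      is x_j; then \<open>S\<close> would contain both i and j.\<close>
    have "?w i j \<noteq> Poly_Mapping.single v d" if "v \<in> S" for v
    proof
      assume eq: "?w i j = Poly_Mapping.single v d"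
      have "Poly_Mapping.lookup (?w i j) j = 1" using ij by (simp add: lookup_add lookup_single when_def)
      then have "v = j" "d = 1" unfolding eq by (auto simp: lookup_single when_def split: if_splits)
      then have "card {i, j} \<le> 1" using S card_mono[of S "{i, j}"] that ij(1) by auto
      then show False using ij(2) by simp
    qed
    then show "?w i j \<in> ?B" using d by (auto simp: gens_without_powers_def mdeg_add)
  qed
  have "(\<Sum>u\<in>?B. \<Sum>i\<in>?E u. h (last_var u)) = (\<Sum>(u, i)\<in>Sigma ?B ?E. h (last_var u))"
    by (rule sum.Sigma) (use fin in auto)
  also have "\<dots> = (\<Sum>(i, j)\<in>Sigma S (\<lambda>i. {i<..}). h j)"
    by (rule sum.reindex_bij_witness[of _ "\<lambda>(i, j). (?w i j, i)" "\<lambda>(u, i). (i, last_var u)"])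
      (use u_eq w in auto)
  also have "\<dots> = (\<Sum>i\<in>S. \<Sum>j\<in>{i<..}. h j)"
    by (rule sum.Sigma[symmetric]) auto
  finally show ?thesis .
qed

text \<open>Each removed power x_i^d takes away its own term C(idx i, l), its last variable being
  x_i, and the missing variables take away C(n - 1, l) - C(idx i, l). The dependence on i
  cancels.\<close>

lemma sum_card_colon_vars:
  fixes S :: "'n::{finite,linorder} set"
  assumes d: "d \<ge> 1" and S: "d = 1 \<Longrightarrow> card S \<le> 1"
  shows "int (\<Sum>u\<in>gens_without_powers d S. card (colon_vars d S u) choose l) =
    int ((CARD('n) + d - 1) choose (l + d)) * int ((l + d - 1) choose l)
      - int (card S) * int ((CARD('n) - 1) choose l)"
proof -
  let ?B = "gens_without_powers d S" and ?T = "{t :: 'n \<Rightarrow>\<^sub>0 nat. mdeg t = d}"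
  let ?P = "(\<lambda>v. Poly_Mapping.single v d) ` S"
  let ?g = "\<lambda>u :: 'n \<Rightarrow>\<^sub>0 nat. int (idx (last_var u) choose l)"
  let ?\<delta> = "\<lambda>j :: 'n. int (idx j choose l) - int ((idx j - 1) choose l)"
  have inj: "inj_on (\<lambda>v. Poly_Mapping.single v d) S"
  proof (rule inj_onI)
    fix v w :: 'n assume "Poly_Mapping.single v d = Poly_Mapping.single w d"
    then have "Poly_Mapping.keys (Poly_Mapping.single v d) = Poly_Mapping.keys (Poly_Mapping.single w d)" by simp
    then show "v = w" using d by simp
  qed
  have "(\<Sum>u\<in>?B. ?g u) = (\<Sum>u\<in>?T. ?g u) - (\<Sum>u\<in>?P. ?g u)"
    unfolding gens_without_powers_def by (rule sum_diff) (auto simp: finite_monomials)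
  also have "(\<Sum>u\<in>?P. ?g u) = (\<Sum>i\<in>S. int (idx i choose l))"
    using d by (simp add: sum.reindex[OF inj])
  finally have B: "(\<Sum>u\<in>?B. ?g u) = (\<Sum>u\<in>?T. ?g u) - (\<Sum>i\<in>S. int (idx i choose l))" .
  have "int (\<Sum>u\<in>?B. card (colon_vars d S u) choose l) =
      (\<Sum>u\<in>?B. ?g u - (\<Sum>i | i \<in> S \<and> i < last_var u \<and> Poly_Mapping.lookup u i = d - 1. ?\<delta> (last_var u)))"
    unfolding of_nat_sum
    by (rule sum.cong[OF refl], rule card_colon_vars_choose[OF d S]) (simp_all add: gens_without_powers_def)
  also have "\<dots> = (\<Sum>u\<in>?B. ?g u) -
      (\<Sum>u\<in>?B. \<Sum>i | i \<in> S \<and> i < last_var u \<and> Poly_Mapping.lookup u i = d - 1. ?\<delta> (last_var u))"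
    by (rule sum_subtractf)
  also have "(\<Sum>u\<in>?B. \<Sum>i | i \<in> S \<and> i < last_var u \<and> Poly_Mapping.lookup u i = d - 1. ?\<delta> (last_var u)) =
      (\<Sum>i\<in>S. \<Sum>j\<in>{i<..}. ?\<delta> j)"
    by (rule sum_corrections[OF d]) (rule S)
  also have "(\<Sum>u\<in>?B. ?g u) - (\<Sum>i\<in>S. \<Sum>j\<in>{i<..}. ?\<delta> j) =
      (\<Sum>u\<in>?T. ?g u) - int (card S) * int ((CARD('n) - 1) choose l)"
    unfolding B sum_idx_differences unfolding sum_subtractf by simp
  also have "(\<Sum>u\<in>?T. ?g u) = int ((CARD('n) + d - 1) choose (l + d)) * int ((l + d - 1) choose l)"
    using arg_cong[OF sum_last_var[OF d, of l, where 'n = 'n], of int] by simp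
  finally show ?thesis .
qed

lemma card_colon_vars_less: "card (colon_vars d S u) < CARD('n)" for S :: "'n::{finite,linorder} set"
proof -
  have "last_var u \<notin> colon_vars d S u" by (simp add: colon_vars_def)
  then show ?thesis by (intro psubset_card_mono) auto
qed

theorem corollary5p7:
  fixes n d r :: nat
    and \<kappa> :: "nat \<Rightarrow> 'n::{finite,linorder}"
    and K' :: "('n, 'k::field) mpoly set"
  assumes "n = CARD('n)"
    and "d \<ge> 1"
    and "strict_mono_on {1..r} \<kappa>"
    and "\<And>s t. s \<in> {1..r} \<Longrightarrow> t \<in> {1..r} \<Longrightarrow> s \<noteq> t \<Longrightarrow>
           mdeg (mlcm (Poly_Mapping.single (\<kappa> s) d) (Poly_Mapping.single (\<kappa> t) d)) \<ge> d + 2"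
    and "K' = ideal_with_complement d ((\<lambda>s. Poly_Mapping.single (\<kappa> s) d) ` {1..r})"
  shows
    \<comment> \<open>the Betti table of \<open>R/K'\<close>: column \<open>0\<close>, columns \<open>\<ell> \<ge> 1\<close> of row \<open>d - 1\<close>, and all other entries\<close>
    "(\<forall>j. betti_entry K' j 0 = (if j = 0 then 1 else 0)) \<and>
     (\<forall>l\<in>{1..n}. int (betti_entry K' (int d - 1) l) =
        int ((n + d - 1) choose (l + d - 1)) * int ((d + l - 2) choose (l - 1))
        - int r * int ((n - 1) choose (l - 1))) \<and>
     int (betti_entry K' (int d - 1) 1) = int ((n + d - 1) choose d) - int r \<and>
     int (betti_entry K' (int d - 1) n) = int ((n + d - 2) choose (n - 1)) - int r \<and>
     (\<forall>j. \<forall>l\<ge>1. j \<noteq> int d - 1 \<or> l > n \<longrightarrow> betti_entry K' j l = 0) \<and>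
     has_linear_resolution K' d \<and>
     \<comment> \<open>the last column of the table is nonzero exactly if \<open>r \<noteq> (n + d - 2) choose (n - 1)\<close>\<close>
     (r \<noteq> (n + d - 2) choose (n - 1) \<longrightarrow>
        proj_dim K' = enat n \<and>
        int (ring_type K') = int ((n + d - 2) choose (n - 1)) - int r)"
proof -
  define S where "S = \<kappa> ` {1..r}"
  define \<beta> where "\<beta> = (\<lambda>i. \<Sum>u\<in>gens_without_powers d S. card (colon_vars d S u) choose i)"
  have n: "n \<ge> 1" using assms(1) by (simp add: Suc_leI)
  have card_S: "card S = r"
    using card_image[OF strict_mono_on_imp_inj_on[OF assms(3)]] by (simp add: S_def)
  have "r \<le> 1" if "d = 1"
  proof (rule ccontr)
    assume "\<not> r \<le> 1"
    \<comment> \<open>For \<open>d = 1\<close> the hypothesis asks for degree at least 3, but the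
      lcm of two variables divides their product, of degree 2.\<close>
    then have "d + 2 \<le> mdeg (mlcm (Poly_Mapping.single (\<kappa> 1) d) (Poly_Mapping.single (\<kappa> 2) d))"
      by (intro assms(4)) auto
    also have "\<dots> \<le> mdeg (Poly_Mapping.single (\<kappa> 1) d + Poly_Mapping.single (\<kappa> 2) d)"
      by (rule mdeg_mono) (simp add: mlcm.rep_eq lookup_add)
    finally show False using that by (simp add: mdeg_add)
  qed
  then have S: "d = 1 \<Longrightarrow> card S \<le> 1" using card_S by simp
  have K': "K' = monomial_ideal (gens_without_powers d S)"
    by (simp add: assms(5) ideal_with_complement_def gens_without_powers_def S_def image_image)
  obtain F where F: "linear_resolution K' d F \<beta>"
    using linear_resolution_gens_without_powers[OF assms(2), of S] unfolding K' \<beta>_def by blast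
  have gr: "graded_free_resolution K' F" using F by (simp add: linear_resolution_def)
  have min: "minimal_complex F" by (rule linear_resolution_minimal[OF F assms(2)])
  have hom: "homogeneous_ideal K'" unfolding K' by (rule homogeneous_ideal_monomial_ideal)
  note tor = tor_dim_eq_card_gens[OF gr min hom]
  \<comment> \<open>\<open>\<beta> i\<close> belongs to column i + 1, so column \<open>l\<close> of
    the table is read off at i = l - 1.\<close>
  have \<beta>: "int (\<beta> i) = int ((n + d - 1) choose (i + d)) * int ((i + d - 1) choose i)
      - int r * int ((n - 1) choose i)" for i
    unfolding \<beta>_def assms(1) card_S[symmetric] by (rule sum_card_colon_vars[OF assms(2)]) (rule S)
  have \<beta>_0: "\<beta> i = 0" if "n \<le> i" for i
    unfolding \<beta>_def
  proof (rule sum.neutral, rule ballI)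
    fix u
    have "card (colon_vars d S u) < i" using card_colon_vars_less[of d S u] that assms(1) by simp
    then show "card (colon_vars d S u) choose i = 0" by simp
  qed
  have betti_0: "betti_entry K' j 0 = (if j = 0 then 1 else 0)" for j
  proof -
    have "{q \<in> gens F 0. gdeg F 0 q = j} = (if j = 0 then gens F 0 else {})"
      using F by (auto simp: linear_resolution_def)
    then show ?thesis using F by (simp add: betti_entry_def tor linear_resolution_def)
  qed
  have betti_Suc: "betti_entry K' j (Suc i) = (if j = int d - 1 then \<beta> i else 0)" for j i
  proof -
    have "gdeg F (Suc i) q = int i + int d" if "q \<in> gens F (Suc i)" for q
      using F that by (simp add: linear_resolution_def)
    then have "{q \<in> gens F (Suc i). gdeg F (Suc i) q = int (Suc i) + j} =
        (if j = int d - 1 then gens F (Suc i) else {})" by auto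
    then show ?thesis using F by (simp only: betti_entry_def tor) (simp add: linear_resolution_def)
  qed
  have table: "int (betti_entry K' (int d - 1) l) =
      int ((n + d - 1) choose (l + d - 1)) * int ((d + l - 2) choose (l - 1))
      - int r * int ((n - 1) choose (l - 1))" if "l \<ge> 1" for l
    using that \<beta>[of "l - 1"] betti_Suc[of _ "l - 1"] assms(2) by (cases l) (simp_all add: add.commute)
  have first: "int (betti_entry K' (int d - 1) 1) = int ((n + d - 1) choose d) - int r"
    using table[of 1] by simp
  \<comment> \<open>In column n the first binomial is \<open>(n + d - 1) choose (n + d - 1)\<close>,
    that is 1.\<close>
  have last: "int (betti_entry K' (int d - 1) n) = int ((n + d - 2) choose (n - 1)) - int r"
    using table[OF n] by (simp add: add.commute)
  have rest: "betti_entry K' j l = 0" if "l \<ge> 1" "j \<noteq> int d - 1 \<or> l > n" for j l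
    using that betti_Suc[of j "l - 1"] \<beta>_0[of "l - 1"] by (cases l) auto
  have lin: "has_linear_resolution K' d"
    unfolding has_linear_resolution_def
  proof (intro exI[of _ F] conjI gr min allI impI ballI)
    show "gdeg F 0 q = 0" if "q \<in> gens F 0" for q using F that by (simp add: linear_resolution_def)
    show "gdeg F i q = int i + int d - 1" if "1 \<le> i" "q \<in> gens F i" for i q
      using F that by (cases i) (auto simp: linear_resolution_def)
  qed
  have top: "card (gens F n) = betti_entry K' (int d - 1) n"
    using F n betti_Suc[of _ "n - 1"] by (cases n) (simp_all add: linear_resolution_def)
  have pd: "proj_dim K' = enat n" if "r \<noteq> (n + d - 2) choose (n - 1)"
  proof (rule proj_dim_eqI[OF gr min])
    show "is_ideal K'" using hom by (simp add: homogeneous_ideal_def)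
    \<comment> \<open>The rank in degree n is the difference of the binomial and \<open>r\<close>,
      nonzero by assumption.\<close>
    show "gens F n \<noteq> {}" using last top that by auto
    show "gens F i = {}" if "n < i" for i
    proof -
      have "card (gens F i) = 0"
        using F that \<beta>_0[of "i - 1"] by (cases i) (auto simp: linear_resolution_def)
      then show ?thesis using graded_free_resolutionD(1)[OF gr] by simp
    qed
  qed
  have type: "int (ring_type K') = int ((n + d - 2) choose (n - 1)) - int r"
    if "r \<noteq> (n + d - 2) choose (n - 1)"
    using last top by (simp add: ring_type_def pd[OF that] tor)
  show ?thesis
    using betti_0 table first last rest lin pd type by auto
qed

end
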